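(* Given a trace $\sigma$ with $\mathcal{N}$ events, $\mathcal{T}$ threads and $\mathcal{L}$ locks, the problem of checking whether $\sigma$ has an optimistic sync-reversal data race can be solved in time $O\big(\mathcal{T}\,\mathcal{L}\,(\mathcal{T}^2+\mathcal{L})\,\mathcal{N}^2\big) = \widetilde{O}(\mathcal{N}^2)$.
   Context: **Traces.** A trace $\sigma$ is a finite sequence of events; each event $e$ has a unique identifier, a thread $\mathsf{th}(e)$ and an operation $\mathsf{op}(e)$, which is one of $\mathsf{r}(x)$, $\mathsf{w}(x)$ (read/write of variable $x$), $\mathsf{acq}(\ell)$, $\mathsf{rel}(\ell)$ (acquire/release of lock $\ell$). $\mathsf{Events}(\sigma)$ is its set of events. Traces are well-formed: for each lock $\ell$, the operations on $\ell$ alternate between acquires and releases, each release being preceded by a matching acquire of the same thread. For an acquire (release) $e$, $\mathsf{match}_\sigma(e)$ is its matching release (acquire) in $\sigma$, or $\bot$ if none exists. **Orders.** $e_1\le^\sigma_{tr}e_2$ iff $e_1=e_2$ or $e_1$ appears before $e_2$ in $\sigma$; $e_1\le^\sigma_{TO}e_2$ iff $\mathsf{th}(e_1)=\mathsf{th}(e_2)$ and $e_1\le^\sigma_{tr}e_2$. For a read $r$ of $x$, $\mathsf{rf}_\sigma(r)$ is the last write on $x$ before $r$ in $\sigma$ (assumed always to exist in the given trace). $\mathsf{prev}_\sigma(e)$ is the last event $f\neq e$ with $f\le^\sigma_{TO}e$, or $\bot$ if none exists; conditions on $\mathsf{prev}_\sigma(e)$ are vacuous when it is $\bot$. A set $S\subseteq\mathsf{Events}(\sigma)$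 is $(\le^\sigma_{TO},\mathsf{rf}_\sigma)$-closed if it is downward closed under $\le^\sigma_{TO}$ and contains $\mathsf{rf}_\sigma(r)$ for each read $r\in S$. $\mathsf{TRClosure}(e)$ is the smallest $(\le^\sigma_{TO},\mathsf{rf}_\sigma)$-closed set containing $e$. **Correct reordering.** A well-formed trace $\rho$ with $\mathsf{Events}(\rho)\subseteq\mathsf{Events}(\sigma)$ is a correct reordering of $\sigma$ if $\mathsf{Events}(\rho)$ is $(\le^\sigma_{TO},\mathsf{rf}_\sigma)$-closed, $e_1\le^\sigma_{TO}e_2$ implies $e_1\le^\rho_{TO}e_2$ for events of $\rho$, and $\mathsf{rf}_\rho(e)=\mathsf{rf}_\sigma(e)$ for every read $e$ of $\rho$. Two events conflict if they access the same variable and at least one is a write. An event $e$ is $\sigma$-enabled in $\rho$ if $e\notin\mathsf{Events}(\rho)$ but every $e'\ne e$ with $e'\le^\sigma_{TO}e$ is in $\mathsf{Events}(\rho)$. **Optimistic notions.** $S$ is optimistically lock-closed w.r.t. $(e_1,e_2)$ if (a) $e_1,e_2\notin S$ and $\mathsf{prev}_\sigma(e_1),\mathsf{prev}_\sigma(e_2)\in S$; (b) $S$ is $(\le^\sigma_{TO},\mathsf{rf}_\sigma)$-closed; (c) for every acquire $a\in S$ having a matching release, if neither $e_1$ nor $e_2$ is in $\mathsf{TRClosure}(\mathsf{match}_\sigma(a))$, then $\mathsf{match}_\sigma(a)\in S$. An optimistic correct reordering of $\sigma$ is a correct reordering $\rho$ of $\sigma$ such that any two conflicting events of $\rho$ are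 in the same relative order in $\rho$ as in $\sigma$, and any two distinct acquires of the same lock whose matching releases are both in $\rho$ are in the same relative order in $\rho$ as in $\sigma$. A pair of conflicting events $(e_1,e_2)$ of $\sigma$ is an optimistic sync-reversal data race if there is an optimistic correct reordering $\rho$ of $\sigma$ such that $\mathsf{Events}(\rho)$ is optimistically lock-closed w.r.t. $(e_1,e_2)$ and both $e_1,e_2$ are $\sigma$-enabled in $\rho$. $\widetilde{O}$ hides multiplicative factors polynomial in the numbers of threads and locks (viewed as constants). *)

theory Defs
  imports Complex_Main "HOL-Library.Landau_Symbols"
begin

section \<open>Traces\<close>

text \<open>Variables, locks, threads and event identifiers are arbitrary natural numbers
  (not necessarily an initial segment).\<close>

datatype operation = Read nat | Write nat | Acq nat | Rel nat

datatype event = Event (eid: nat) (th: nat) (oper: operation)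

type_synonym trace = "event list"

text \<open>The parts of a trace strictly before and strictly after an event.\<close>

definition before :: "trace \<Rightarrow> event \<Rightarrow> trace" where
  "before \<sigma> e = takeWhile (\<lambda>f. f \<noteq> e) \<sigma>"

definition after :: "trace \<Rightarrow> event \<Rightarrow> trace" where
  "after \<sigma> e = tl (dropWhile (\<lambda>f. f \<noteq> e) \<sigma>)"

definition match_of :: "trace \<Rightarrow> event \<Rightarrow> event option" where
  "match_of \<sigma> e = (case oper e of
      Acq l \<Rightarrow> find (\<lambda>f. oper f = Rel l) (after \<sigma> e)
    | Rel l \<Rightarrow> find (\<lambda>f. oper f = Acq l) (rev (before \<sigma> e))
    | _ \<Rightarrow> None)"

text \<open>Under the alternation condition the last acquire before a release is the
  immediately preceding operation on its lock, and the first release after an acquire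
  is the immediately following one.\<close>

definition well_formed :: "trace \<Rightarrow> bool" where
  "well_formed \<sigma> \<longleftrightarrow>
     distinct (map eid \<sigma>) \<and>
     (\<forall>l. successively (\<lambda>e f. oper e \<noteq> oper f)
            (filter (\<lambda>e. oper e \<in> {Acq l, Rel l}) \<sigma>)) \<and>
     (\<forall>r \<in> set \<sigma>. \<forall>l. oper r = Rel l \<longrightarrow> (\<exists>a. match_of \<sigma> r = Some a \<and> th a = th r))"

definition tr_le :: "trace \<Rightarrow> event \<Rightarrow> event \<Rightarrow> bool" where
  "tr_le \<sigma> e f \<longleftrightarrow> (\<exists>i j. i \<le> j \<and> j < length \<sigma> \<and> \<sigma> ! i = e \<and> \<sigma> ! j = f)"

definition to_le :: "trace \<Rightarrow> event \<Rightarrow> event \<Rightarrow> bool" where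
  "to_le \<sigma> e f \<longleftrightarrow> th e = th f \<and> tr_le \<sigma> e f"

definition rf :: "trace \<Rightarrow> event \<Rightarrow> event option" where
  "rf \<sigma> e = (case oper e of
      Read x \<Rightarrow> find (\<lambda>f. oper f = Write x) (rev (before \<sigma> e))
    | _ \<Rightarrow> None)"

definition prev :: "trace \<Rightarrow> event \<Rightarrow> event option" where
  "prev \<sigma> e = find (\<lambda>f. th f = th e) (rev (before \<sigma> e))"

text \<open>The traces given as input: every read has a write to read from.\<close>

definition input_traces :: "trace set" where
  "input_traces = {\<sigma>. well_formed \<sigma> \<and>
     (\<forall>r \<in> set \<sigma>. \<forall>x. oper r = Read x \<longrightarrow> rf \<sigma> r \<noteq> None)}"

definition num_threads :: "trace \<Rightarrow> nat" where
  "num_threads \<sigma> = card (th ` set \<sigma>)"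

definition num_locks :: "trace \<Rightarrow> nat" where
  "num_locks \<sigma> = card {l. \<exists>e \<in> set \<sigma>. oper e = Acq l \<or> oper e = Rel l}"


section \<open>Optimistic sync-reversal data races\<close>

definition to_rf_closed :: "trace \<Rightarrow> event set \<Rightarrow> bool" where
  "to_rf_closed \<sigma> S \<longleftrightarrow>
     S \<subseteq> set \<sigma> \<and>
     (\<forall>e f. f \<in> S \<and> to_le \<sigma> e f \<longrightarrow> e \<in> S) \<and>
     (\<forall>r \<in> S. \<forall>w. rf \<sigma> r = Some w \<longrightarrow> w \<in> S)"

definition TRClosure :: "trace \<Rightarrow> event \<Rightarrow> event set" where
  "TRClosure \<sigma> e = \<Inter> {S. to_rf_closed \<sigma> S \<and> e \<in> S}"

definition correct_reordering :: "trace \<Rightarrow> trace \<Rightarrow> bool" where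
  "correct_reordering \<sigma> \<rho> \<longleftrightarrow>
     well_formed \<rho> \<and> set \<rho> \<subseteq> set \<sigma> \<and> to_rf_closed \<sigma> (set \<rho>) \<and>
     (\<forall>e \<in> set \<rho>. \<forall>f \<in> set \<rho>. to_le \<sigma> e f \<longrightarrow> to_le \<rho> e f) \<and>
     (\<forall>e \<in> set \<rho>. \<forall>x. oper e = Read x \<longrightarrow> rf \<rho> e = rf \<sigma> e)"

text \<open>Two events conflict only if they are distinct: a write is not in conflict with itself.\<close>

definition conflict :: "event \<Rightarrow> event \<Rightarrow> bool" where
  "conflict e f \<longleftrightarrow> e \<noteq> f \<and>
     (\<exists>x. oper e \<in> {Read x, Write x} \<and> oper f \<in> {Read x, Write x} \<and>
          (oper e = Write x \<or> oper f = Write x))"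

definition enabled_in :: "trace \<Rightarrow> trace \<Rightarrow> event \<Rightarrow> bool" where
  "enabled_in \<sigma> \<rho> e \<longleftrightarrow> e \<notin> set \<rho> \<and> (\<forall>e'. e' \<noteq> e \<and> to_le \<sigma> e' e \<longrightarrow> e' \<in> set \<rho>)"

definition opt_lock_closed :: "trace \<Rightarrow> event \<Rightarrow> event \<Rightarrow> event set \<Rightarrow> bool" where
  "opt_lock_closed \<sigma> e1 e2 S \<longleftrightarrow>
     e1 \<notin> S \<and> e2 \<notin> S \<and>
     (\<forall>p. prev \<sigma> e1 = Some p \<longrightarrow> p \<in> S) \<and>
     (\<forall>p. prev \<sigma> e2 = Some p \<longrightarrow> p \<in> S) \<and>
     to_rf_closed \<sigma> S \<and>
     (\<forall>a \<in> S. \<forall>l r. oper a = Acq l \<and> match_of \<sigma> a = Some r \<and>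
        e1 \<notin> TRClosure \<sigma> r \<and> e2 \<notin> TRClosure \<sigma> r \<longrightarrow> r \<in> S)"

definition opt_correct_reordering :: "trace \<Rightarrow> trace \<Rightarrow> bool" where
  "opt_correct_reordering \<sigma> \<rho> \<longleftrightarrow>
     correct_reordering \<sigma> \<rho> \<and>
     (\<forall>e \<in> set \<rho>. \<forall>f \<in> set \<rho>. conflict e f \<longrightarrow> (tr_le \<rho> e f \<longleftrightarrow> tr_le \<sigma> e f)) \<and>
     (\<forall>a \<in> set \<rho>. \<forall>b \<in> set \<rho>. \<forall>l r s.
        a \<noteq> b \<and> oper a = Acq l \<and> oper b = Acq l \<and>
        match_of \<sigma> a = Some r \<and> match_of \<sigma> b = Some s \<and> r \<in> set \<rho> \<and> s \<in> set \<rho> \<longrightarrow>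
        (tr_le \<rho> a b \<longleftrightarrow> tr_le \<sigma> a b))"

definition osr_race :: "trace \<Rightarrow> event \<Rightarrow> event \<Rightarrow> bool" where
  "osr_race \<sigma> e1 e2 \<longleftrightarrow>
     e1 \<in> set \<sigma> \<and> e2 \<in> set \<sigma> \<and> conflict e1 e2 \<and>
     (\<exists>\<rho>. opt_correct_reordering \<sigma> \<rho> \<and> opt_lock_closed \<sigma> e1 e2 (set \<rho>) \<and>
          enabled_in \<sigma> \<rho> e1 \<and> enabled_in \<sigma> \<rho> e2)"

definition has_osr_race :: "trace \<Rightarrow> bool" where
  "has_osr_race \<sigma> \<longleftrightarrow> (\<exists>e1 e2. osr_race \<sigma> e1 e2)"


section \<open>Unit-cost random access machine\<close>

text \<open>Structured programs for a RAM whose memory is split into arrays of natural numbers.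
  Array names are static, so a program uses finitely many arrays, and interleaving them in
  a single memory costs a constant factor; a scalar variable is a cell with a constant
  index. The arithmetic operations are addition and truncated subtraction only (no
  multiplication, no bit operations), so that unit cost is the usual uniform cost
  measure. Every node of an expression and every executed command costs one step
  (a sequential composition itself is free).\<close>

type_synonym store = "nat \<Rightarrow> nat \<Rightarrow> nat"

datatype aexp = Const nat | Load nat aexp | Add aexp aexp | Sub aexp aexp

datatype bexp = Less aexp aexp | Eq aexp aexp | Neg bexp | Conj bexp bexp

datatype com = Skip | Store nat aexp aexp | Seq com com | If bexp com com | While bexp com

fun aval :: "aexp \<Rightarrow> store \<Rightarrow> nat" where
  "aval (Const n) s = n"
| "aval (Load a i) s = s a (aval i s)"
| "aval (Add e f) s = aval e s + aval f s"
| "aval (Sub e f) s = aval e s - aval f s"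

fun acost :: "aexp \<Rightarrow> nat" where
  "acost (Const n) = 1"
| "acost (Load a i) = 1 + acost i"
| "acost (Add e f) = 1 + acost e + acost f"
| "acost (Sub e f) = 1 + acost e + acost f"

fun bval :: "bexp \<Rightarrow> store \<Rightarrow> bool" where
  "bval (Less e f) s \<longleftrightarrow> aval e s < aval f s"
| "bval (Eq e f) s \<longleftrightarrow> aval e s = aval f s"
| "bval (Neg b) s \<longleftrightarrow> \<not> bval b s"
| "bval (Conj b c) s \<longleftrightarrow> bval b s \<and> bval c s"

fun bcost :: "bexp \<Rightarrow> nat" where
  "bcost (Less e f) = 1 + acost e + acost f"
| "bcost (Eq e f) = 1 + acost e + acost f"
| "bcost (Neg b) = 1 + bcost b"
| "bcost (Conj b c) = 1 + bcost b + bcost c"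

text \<open>\<open>run c s t s'\<close>: started in store \<open>s\<close>, the program \<open>c\<close> terminates in store \<open>s'\<close>
  after exactly \<open>t\<close> steps.\<close>

inductive run :: "com \<Rightarrow> store \<Rightarrow> nat \<Rightarrow> store \<Rightarrow> bool" where
  Skip: "run Skip s 1 s"
| Store: "run (Store a i e) s (1 + acost i + acost e)
            (s(a := (s a)(aval i s := aval e s)))"
| Seq: "run c s t s' \<Longrightarrow> run d s' u s'' \<Longrightarrow> run (Seq c d) s (t + u) s''"
| IfTrue: "bval b s \<Longrightarrow> run c s t s' \<Longrightarrow> run (If b c d) s (1 + bcost b + t) s'"
| IfFalse: "\<not> bval b s \<Longrightarrow> run d s t s' \<Longrightarrow> run (If b c d) s (1 + bcost b + t) s'"
| WhileFalse: "\<not> bval b s \<Longrightarrow> run (While b c) s (1 + bcost b) s"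
| WhileTrue: "bval b s \<Longrightarrow> run c s t s' \<Longrightarrow> run (While b c) s' u s'' \<Longrightarrow>
     run (While b c) s (1 + bcost b + t + u) s''"

lemma run_deterministic:
  assumes "run c s t s'" and "run c s u s''"
  shows "t = u \<and> s' = s''"
  using assms
proof (induction arbitrary: u s'' rule: run.induct)
  case (Skip s) then show ?case by (auto elim: run.cases)
next
  case (Store a i e s) then show ?case by (auto elim: run.cases)
next
  case (Seq c s t s1 d v s2)
  from Seq.prems show ?case by cases (blast dest: Seq.IH)+
next
  case (IfTrue b s c t s' d)
  from IfTrue.prems show ?case by cases (use IfTrue.hyps in \<open>auto dest: IfTrue.IH\<close>)
next
  case (IfFalse b s d t s' c)
  from IfFalse.prems show ?case by cases (use IfFalse.hyps in \<open>auto dest: IfFalse.IH\<close>)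
next
  case (WhileFalse b s c)
  from WhileFalse.prems show ?case by cases (use WhileFalse.hyps in auto)
next
  case (WhileTrue b s c t s1 v s2)
  from WhileTrue.prems show ?case by cases (use WhileTrue.hyps in \<open>blast dest: WhileTrue.IH\<close>)+
qed

fun opcode :: "operation \<Rightarrow> nat" where
  "opcode (Read x) = 0"
| "opcode (Write x) = 1"
| "opcode (Acq l) = 2"
| "opcode (Rel l) = 3"

fun operand :: "operation \<Rightarrow> nat" where
  "operand (Read x) = x"
| "operand (Write x) = x"
| "operand (Acq l) = l"
| "operand (Rel l) = l"

text \<open>Input convention: cell 0 of array 0 holds the length of the trace, and the arrays
  1 to 4 hold the identifiers, threads, operation codes and operands of its events in trace
  order; all other cells are 0. Output convention: the answer, 1 or 0, is left in cell 0 of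
  array 0.\<close>

definition input_store :: "trace \<Rightarrow> store" where
  "input_store \<sigma> a i =
     (if a = 0 then (if i = 0 then length \<sigma> else 0)
      else if i < length \<sigma> then
        (if a = 1 then eid (\<sigma> ! i)
         else if a = 2 then th (\<sigma> ! i)
         else if a = 3 then opcode (oper (\<sigma> ! i))
         else if a = 4 then operand (oper (\<sigma> ! i))
         else 0)
      else 0)"

definition decides_in_time :: "com \<Rightarrow> (trace \<Rightarrow> bool) \<Rightarrow> (trace \<Rightarrow> nat) \<Rightarrow> bool" where
  "decides_in_time c P time \<longleftrightarrow>
     (\<forall>\<sigma> \<in> input_traces. \<exists>s. run c (input_store \<sigma>) (time \<sigma>) s \<and> s 0 0 = of_bool (P \<sigma>))"

text \<open>\<open>O[principal input_traces](g)\<close> bounds a function on all input traces by one constant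
  multiple of \<open>g\<close>. The soft variant also hides a polynomial in the numbers of
  threads and locks.\<close>

definition soft_O :: "(trace \<Rightarrow> real) \<Rightarrow> (trace \<Rightarrow> real) set" where
  "soft_O g = {f. \<exists>k::nat. f \<in>
     O[principal input_traces](\<lambda>\<sigma>. real ((1 + num_threads \<sigma> + num_locks \<sigma>) ^ k) * g \<sigma>)}"

end

theory Submission
  imports Defs
begin

text \<open>For a pair of conflicting events there is a least candidate set \<open>C\<close> of events for a witness:
  the closure of the predecessors of the pair under thread order, reads-from and forced releases.
  Minimality suffices because an acquire that is unmatched in \<open>C\<close> stays unmatched in every
  candidate set, so shrinking to \<open>C\<close> only removes constraints. A witness on \<open>C\<close> exists iff each
  lock has at most one unmatched acquire in \<open>C\<close> and the following graph is acyclic: the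
  precedences that agree with the trace order, plus edges from every release of a lock to the
  unmatched acquire of that lock. Only the latter edges can point backwards, so acyclicity reduces
  to the graph on at most \<open>L\<close> locks in which \<open>l\<close> precedes \<open>l'\<close> if the unmatched acquire of \<open>l\<close>
  reaches a release of \<open>l'\<close> by forward edges inside \<open>C\<close>.

  Since candidate sets are prefixes of the threads, they are vectors of \<open>T\<close> numbers. For a fixed
  first event and a fixed thread of the second event they only grow as the second event moves
  forward, which bounds the number of closure steps by \<open>O(N)\<close> per first event and thread. A table
  of range minima over the successors in each thread gives constant-time edge queries, so that
  Dijkstra's algorithm on the threads finds everything reachable from one acquire in time
  \<open>O(T\<^sup>2)\<close>, and removing sources decides acyclicity of the lock graph in time \<open>O(L\<^sup>2)\<close>.\<close>

section \<open>Positions in lists\<close>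

text \<open>Two facts make the sweeps cheap. A release that is forced for a pair stays forced when
  the second event moves forward in its thread: the closure of the release is downward closed in
  thread order, so if it avoids an event, it avoids all later events of that thread. And a closure
  step that does not advance the second event adds at least one new event, so a sweep along one
  thread takes at most 2N steps, whereas closing the set afresh for each pair could cost a further
  factor N. A step inspects one acquire per thread and lock; with N first events and T sweeps for
  each, this amounts to O(T^2 L N^2). For a pair, L searches and the edges and the acyclicity of the
  lock graph take O(L (T^2 + L T)), so all pairs take O(L (T^2 + L T) N^2). Both terms lie below T L
  (T^2 + L) N^2. The machine shapes the rest: names are arbitrary numbers, so threads and locks are
  renumbered before they can index tables, and without multiplication the addresses of table cells
  need a table of multiples.\<close>

lemma before_nth: "distinct xs \<Longrightarrow> i < length xs \<Longrightarrow> before xs (xs ! i) = take i xs"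
  unfolding before_def
  by (rule takeWhile_eq_take_P_nth) (auto simp: nth_eq_iff_index_eq)

lemma after_nth:
  assumes "distinct xs" and "i < length xs"
  shows "after xs (xs ! i) = drop (Suc i) xs"
proof -
  have "takeWhile (\<lambda>f. f \<noteq> xs ! i) xs = take i xs"
    using before_nth[OF assms] by (simp add: before_def)
  moreover have "length (take i xs) = i" using assms by simp
  ultimately have "dropWhile (\<lambda>f. f \<noteq> xs ! i) xs = drop i xs"
    by (metis dropWhile_eq_drop)
  then show ?thesis by (simp add: after_def drop_Suc tl_drop)
qed

text \<open>\<open>rf\<close>, \<open>prev\<close> and the match of a release all search a reversed
  prefix; this turns such searches into statements about positions.\<close>

lemma find_rev_take_iff:
  "i \<le> length xs \<Longrightarrow> find P (rev (take i xs)) = Some f \<longleftrightarrow>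
     (\<exists>j<i. f = xs ! j \<and> P (xs ! j) \<and> (\<forall>k. j < k \<and> k < i \<longrightarrow> \<not> P (xs ! k)))"
proof (induction i)
  case (Suc i)
  show ?case
  proof (cases "P (xs ! i)")
    case True
    then have "find P (rev (take (Suc i) xs)) = Some (xs ! i)"
      using Suc.prems by (simp add: take_Suc_conv_app_nth)
    then show ?thesis
      using True by (auto simp: less_Suc_eq)
  next
    case False
    then have "find P (rev (take (Suc i) xs)) = find P (rev (take i xs))"
      using Suc.prems by (simp add: take_Suc_conv_app_nth)
    then show ?thesis
      using Suc False by (auto simp: less_Suc_eq)
  qed
qed simp

lemma find_drop_iff:
  "find P (drop i xs) = Some f \<longleftrightarrow>
     (\<exists>j<length xs. i \<le> j \<and> f = xs ! j \<and> P (xs ! j) \<and> (\<forall>k. i \<le> k \<and> k < j \<longrightarrow> \<not> P (xs ! k)))"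
  (is "?l = ?r")
proof
  assume ?l
  then obtain m where m: "m < length (drop i xs)" "P (drop i xs ! m)" "f = drop i xs ! m"
    "\<forall>j<m. \<not> P (drop i xs ! j)" by (auto simp: find_Some_iff)
  have "\<not> P (xs ! k)" if "i \<le> k" "k < i + m" for k
    using m(1) m(4)[rule_format, of "k - i"] that by (auto simp: less_diff_conv2)
  then show ?r using m by (intro exI[of _ "i + m"]) auto
next
  assume ?r
  then obtain j where "j < length xs" "i \<le> j" "f = xs ! j" "P (xs ! j)"
    "\<forall>k. i \<le> k \<and> k < j \<longrightarrow> \<not> P (xs ! k)" by blast
  then show ?l unfolding find_Some_iff
    by (intro exI[of _ "j - i"]) auto
qed

text \<open>Neighbours in a filtered list are positions satisfying \<open>Q\<close> with no such
  position strictly between them. The alternation condition of \<open>well_formed\<close> speaks of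
  such neighbours and becomes a condition on indices in this way.\<close>

lemma successively_filter_iff:
  "successively R (filter Q xs) \<longleftrightarrow>
     (\<forall>i j. i < j \<and> j < length xs \<and> Q (xs ! i) \<and> Q (xs ! j) \<and> (\<forall>k. i < k \<and> k < j \<longrightarrow> \<not> Q (xs ! k))
        \<longrightarrow> R (xs ! i) (xs ! j))" (is "_ = ?r xs")
proof
  assume s: "successively R (filter Q xs)"
  show "?r xs"
  proof (intro allI impI, elim conjE)
    fix i j assume ij: "i < j" "j < length xs" "Q (xs ! i)" "Q (xs ! j)"
      and n: "\<forall>k. i < k \<and> k < j \<longrightarrow> \<not> Q (xs ! k)"
    let ?m = "take (j - Suc i) (drop (Suc i) xs)"
    have "xs = take i xs @ xs ! i # drop (Suc i) xs" using ij by (simp add: id_take_nth_drop)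
    also have "drop (Suc i) xs = ?m @ drop j xs"
      using ij by (metis Suc_leI append_take_drop_id drop_drop le_add_diff_inverse2)
    also have "drop j xs = xs ! j # drop (Suc j) xs" using ij by (simp add: Cons_nth_drop_Suc)
    finally have x: "xs = take i xs @ xs ! i # ?m @ xs ! j # drop (Suc j) xs" .
    have m: "filter Q ?m = []"
      using ij n by (auto simp: filter_empty_conv in_set_conv_nth)
    have "filter Q xs = filter Q (take i xs) @ xs ! i # xs ! j # filter Q (drop (Suc j) xs)"
      using arg_cong[OF x, of "filter Q"] ij(3,4) m by simp
    with s show "R (xs ! i) (xs ! j)" by (simp add: successively_append_iff)
  qed
next
  show "?r xs \<Longrightarrow> successively R (filter Q xs)"
  proof (induction xs)
    case (Cons x xs)
    have "?r xs"
    proof (intro allI impI, elim conjE)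
      fix i j assume "i < j" "j < length xs" "Q (xs ! i)" "Q (xs ! j)"
        and n: "\<forall>k. i < k \<and> k < j \<longrightarrow> \<not> Q (xs ! k)"
      moreover have "\<not> Q ((x # xs) ! k)" if "Suc i < k" "k < Suc j" for k
        using n that by (cases k) auto
      ultimately show "R (xs ! i) (xs ! j)"
        using Cons.prems[rule_format, of "Suc i" "Suc j"] by simp
    qed
    then have IH: "successively R (filter Q xs)" by (rule Cons.IH)
    show ?case
    proof (cases "Q x")
      case True
      show ?thesis
      proof (cases "filter Q xs")
        case (Cons y ys)
        then obtain us vs where u: "xs = us @ y # vs" "\<forall>u\<in>set us. \<not> Q u" "Q y"
          by (auto simp: filter_eq_Cons_iff)
        have "\<not> Q ((x # xs) ! k)" if "0 < k" "k < Suc (length us)" for k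
          using u(1,2) that by (cases k) (auto simp: nth_append)
        then have "R x y"
          using Cons.prems[rule_format, of 0 "Suc (length us)"] True u by simp
        then show ?thesis using True IH Cons by simp
      qed (use True in simp)
    qed (use IH in simp)
  qed simp
qed

lemma oper_code:
  "oper e = Read x \<longleftrightarrow> opcode (oper e) = 0 \<and> operand (oper e) = x"
  "oper e = Write x \<longleftrightarrow> opcode (oper e) = 1 \<and> operand (oper e) = x"
  "oper e = Acq x \<longleftrightarrow> opcode (oper e) = 2 \<and> operand (oper e) = x"
  "oper e = Rel x \<longleftrightarrow> opcode (oper e) = 3 \<and> operand (oper e) = x"
  by (cases "oper e"; auto)+

lemma opcode_le_3: "opcode p \<le> 3"
  by (cases p) auto

lemma operation_eq_iff: "p = q \<longleftrightarrow> opcode p = opcode q \<and> operand p = operand q"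
  by (cases p; cases q) auto

section \<open>Positions of list elements and topological sorting\<close>

definition pos :: "'a list \<Rightarrow> 'a \<Rightarrow> nat" where
  "pos xs x = (THE k. k < length xs \<and> xs ! k = x)"

lemma pos_nth [simp]: "distinct xs \<Longrightarrow> k < length xs \<Longrightarrow> pos xs (xs ! k) = k"
  unfolding pos_def by (rule the_equality) (auto simp: nth_eq_iff_index_eq)

lemma
  assumes "distinct xs" and "x \<in> set xs"
  shows pos_less_length: "pos xs x < length xs" and nth_pos: "xs ! pos xs x = x"
  using assms by (auto simp: in_set_conv_nth)

lemma pos_eq_iff:
  "distinct xs \<Longrightarrow> x \<in> set xs \<Longrightarrow> y \<in> set xs \<Longrightarrow> pos xs x = pos xs y \<longleftrightarrow> x = y"
  by (metis nth_pos)

text \<open>Built from the end: a finite acyclic relation on a nonempty set has an element without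
  successors, and this element may come last.\<close>

lemma topological_sort:
  assumes "finite S" and "acyclic G" and "G \<subseteq> S \<times> S"
  shows "\<exists>xs. distinct xs \<and> set xs = S \<and> (\<forall>(x, y) \<in> G. pos xs x < pos xs y)"
  using assms
proof (induction "card S" arbitrary: S G)
  case 0
  then show ?case by (intro exI[of _ "[]"]) auto
next
  case (Suc k)
  have fG: "finite G" using Suc.prems by (meson finite_SigmaI finite_subset)
  have "wf (G\<inverse>)" using fG Suc.prems by (simp add: finite_acyclic_wf_converse)
  moreover have "S \<noteq> {}" using Suc.hyps by auto
  ultimately obtain z where z: "z \<in> S" "\<And>y. (y, z) \<in> G\<inverse> \<Longrightarrow> y \<notin> S"
    by (metis all_not_in_conv wfE_min)
  let ?G = "G \<inter> ((S - {z}) \<times> (S - {z}))"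
  have "k = card (S - {z})" using Suc z by simp
  moreover have "finite (S - {z})" using Suc.prems by simp
  moreover have "acyclic ?G" using Suc.prems by (meson Int_lower1 acyclic_subset)
  ultimately obtain xs where xs: "distinct xs" "set xs = S - {z}"
    "\<forall>(x, y) \<in> ?G. pos xs x < pos xs y"
    using Suc.hyps(1)[of "S - {z}" ?G] by auto
  have d: "distinct (xs @ [z])" using xs by auto
  have p: "pos (xs @ [z]) x = pos xs x" if "x \<in> S - {z}" for x
  proof -
    have "x \<in> set xs" using that xs by simp
    then obtain i where "i < length xs" "xs ! i = x" by (auto simp: in_set_conv_nth)
    then show ?thesis
      using pos_nth[OF d, of i] pos_nth[OF xs(1), of i] by (simp add: nth_append)
  qed
  have pz: "pos (xs @ [z]) z = length xs"
    using pos_nth[OF d, of "length xs"] by simp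
  have "pos (xs @ [z]) x < pos (xs @ [z]) y" if "(x, y) \<in> G" for x y
  proof -
    have xy: "x \<in> S" "y \<in> S" "x \<noteq> z" using that Suc.prems z by auto
    show ?thesis
    proof (cases "y = z")
      case True
      then show ?thesis
        using xy p[of x] pz pos_less_length[OF xs(1), of x] xs(2) by simp
    next
      case False
      then show ?thesis using xy p xs(3) that by auto
    qed
  qed
  then show ?case using d xs z by (intro exI[of _ "xs @ [z]"]) auto
qed

section \<open>Traces as sequences of indices\<close>

text \<open>Threads enter only through a numbering \<open>tn\<close> that separates them as
  \<open>th\<close> does. It stays abstract because the program computes it; the final
  interpretation takes it from the store.\<close>

locale indexed_trace =
  fixes \<sigma> :: trace and tn :: "nat \<Rightarrow> nat"
  assumes wf: "well_formed \<sigma>"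
    and tn_eq_iff: "i < length \<sigma> \<Longrightarrow> j < length \<sigma> \<Longrightarrow> tn i = tn j \<longleftrightarrow> th (\<sigma> ! i) = th (\<sigma> ! j)"
begin

abbreviation n :: nat where "n \<equiv> length \<sigma>"

definition oc :: "nat \<Rightarrow> nat" where "oc i = opcode (oper (\<sigma> ! i))"

definition od :: "nat \<Rightarrow> nat" where "od i = operand (oper (\<sigma> ! i))"

text \<open>Reorderings are lists of indices into \<sigma> rather than lists of events: trace order
  becomes \<open><\<close> on numbers, and \<open>pos\<close> gives the order in the
  reordering.\<close>

definition sublist_ix :: "nat list \<Rightarrow> bool" where
  "sublist_ix \<pi> \<longleftrightarrow> distinct \<pi> \<and> set \<pi> \<subseteq> {..<n}"

abbreviation subtrace :: "nat list \<Rightarrow> trace" where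
  "subtrace \<pi> \<equiv> map ((!) \<sigma>) \<pi>"

lemma distinct_trace: "distinct \<sigma>"
  using wf by (auto simp: well_formed_def distinct_map)

lemma nth_inj: "i < n \<Longrightarrow> j < n \<Longrightarrow> \<sigma> ! i = \<sigma> ! j \<longleftrightarrow> i = j"
  using distinct_trace by (simp add: nth_eq_iff_index_eq)

lemma oper_eq_iff: "oper (\<sigma> ! i) = oper (\<sigma> ! j) \<longleftrightarrow> oc i = oc j \<and> od i = od j"
  by (simp add: operation_eq_iff oc_def od_def)

lemma oper_ix:
  "oper (\<sigma> ! i) = Read x \<longleftrightarrow> oc i = 0 \<and> od i = x"
  "oper (\<sigma> ! i) = Write x \<longleftrightarrow> oc i = 1 \<and> od i = x"
  "oper (\<sigma> ! i) = Acq x \<longleftrightarrow> oc i = 2 \<and> od i = x"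
  "oper (\<sigma> ! i) = Rel x \<longleftrightarrow> oc i = 3 \<and> od i = x"
  by (simp_all add: oper_code oc_def od_def)

lemma oc_le_3: "oc i \<le> 3"
  by (simp add: oc_def opcode_le_3)

lemma oc_cases: "oc i = 0 \<or> oc i = 1 \<or> oc i = 2 \<or> oc i = 3"
  using oc_le_3[of i] by linarith

lemma sublist_ixD:
  assumes "sublist_ix \<pi>"
  shows "distinct \<pi>" "i \<in> set \<pi> \<Longrightarrow> i < n" "distinct (subtrace \<pi>)"
    "i \<in> set \<pi> \<Longrightarrow> subtrace \<pi> ! pos \<pi> i = \<sigma> ! i"
    "i \<in> set \<pi> \<Longrightarrow> pos \<pi> i < length \<pi>"
  using assms
  by (auto simp: sublist_ix_def distinct_map inj_on_def nth_inj subset_iff pos_less_length nth_pos)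

lemma sublist_ix_upt: "sublist_ix [0..<n]" "subtrace [0..<n] = \<sigma>" "i < n \<Longrightarrow> pos [0..<n] i = i"
proof -
  show "sublist_ix [0..<n]" "subtrace [0..<n] = \<sigma>"
    by (auto simp: sublist_ix_def map_nth)
  show "i < n \<Longrightarrow> pos [0..<n] i = i"
    using pos_nth[of "[0..<n]" i] by simp
qed

lemma find_before_subtrace:
  assumes \<pi>: "sublist_ix \<pi>" and r: "r \<in> set \<pi>"
  shows "find P (rev (before (subtrace \<pi>) (\<sigma> ! r))) = Some f \<longleftrightarrow>
    (\<exists>a\<in>set \<pi>. f = \<sigma> ! a \<and> P (\<sigma> ! a) \<and> pos \<pi> a < pos \<pi> r \<and>
       (\<forall>b\<in>set \<pi>. pos \<pi> a < pos \<pi> b \<and> pos \<pi> b < pos \<pi> r \<longrightarrow> \<not> P (\<sigma> ! b)))"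
proof -
  note D = sublist_ixD[OF \<pi>]
  have all: "(\<forall>a\<in>set \<pi>. Q a (pos \<pi> a)) \<longleftrightarrow> (\<forall>k<length \<pi>. Q (\<pi> ! k) k)" for Q
    by (simp add: all_set_conv_all_nth D(1))
  have ex: "(\<exists>a\<in>set \<pi>. Q a (pos \<pi> a)) \<longleftrightarrow> (\<exists>k<length \<pi>. Q (\<pi> ! k) k)" for Q
    using all[of "\<lambda>a k. \<not> Q a k"] by blast
  have all': "(\<forall>b\<in>set \<pi>. x < pos \<pi> b \<and> pos \<pi> b < y \<longrightarrow> \<not> P (\<sigma> ! b)) \<longleftrightarrow>
      (\<forall>k<length \<pi>. x < k \<and> k < y \<longrightarrow> \<not> P (\<sigma> ! (\<pi> ! k)))" for x y
    using all[of "\<lambda>b k. x < k \<and> k < y \<longrightarrow> \<not> P (\<sigma> ! b)"] .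
  have b: "before (subtrace \<pi>) (\<sigma> ! r) = take (pos \<pi> r) (subtrace \<pi>)"
    using before_nth[OF D(3), of "pos \<pi> r"] D(4,5)[OF r] by simp
  have l: "pos \<pi> r < length \<pi>" using D(5)[OF r] .
  have "find P (rev (before (subtrace \<pi>) (\<sigma> ! r))) = Some f \<longleftrightarrow>
    (\<exists>j<pos \<pi> r. f = subtrace \<pi> ! j \<and> P (subtrace \<pi> ! j) \<and>
       (\<forall>k. j < k \<and> k < pos \<pi> r \<longrightarrow> \<not> P (subtrace \<pi> ! k)))"
    unfolding b using l by (subst find_rev_take_iff) auto
  also have "\<dots> \<longleftrightarrow> (\<exists>j<length \<pi>. f = \<sigma> ! (\<pi> ! j) \<and> P (\<sigma> ! (\<pi> ! j)) \<and> j < pos \<pi> r \<and>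
       (\<forall>k<length \<pi>. j < k \<and> k < pos \<pi> r \<longrightarrow> \<not> P (\<sigma> ! (\<pi> ! k))))"
  proof (rule iff_exI)
    fix j
    show "(j < pos \<pi> r \<and> f = subtrace \<pi> ! j \<and> P (subtrace \<pi> ! j) \<and>
       (\<forall>k. j < k \<and> k < pos \<pi> r \<longrightarrow> \<not> P (subtrace \<pi> ! k))) \<longleftrightarrow>
      (j < length \<pi> \<and> f = \<sigma> ! (\<pi> ! j) \<and> P (\<sigma> ! (\<pi> ! j)) \<and> j < pos \<pi> r \<and>
       (\<forall>k<length \<pi>. j < k \<and> k < pos \<pi> r \<longrightarrow> \<not> P (\<sigma> ! (\<pi> ! k))))"
      using l by (cases "j < pos \<pi> r") auto
  qed
  also have "\<dots> \<longleftrightarrow> (\<exists>a\<in>set \<pi>. f = \<sigma> ! a \<and> P (\<sigma> ! a) \<and> pos \<pi> a < pos \<pi> r \<and>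
       (\<forall>b\<in>set \<pi>. pos \<pi> a < pos \<pi> b \<and> pos \<pi> b < pos \<pi> r \<longrightarrow> \<not> P (\<sigma> ! b)))"
    unfolding all'
    using ex[of "\<lambda>a j. f = \<sigma> ! a \<and> P (\<sigma> ! a) \<and> j < pos \<pi> r \<and>
       (\<forall>k<length \<pi>. j < k \<and> k < pos \<pi> r \<longrightarrow> \<not> P (\<sigma> ! (\<pi> ! k)))"] by (rule sym)
  finally show ?thesis .
qed

lemma tr_le_subtrace:
  assumes \<pi>: "sublist_ix \<pi>" and "i \<in> set \<pi>" "j \<in> set \<pi>"
  shows "tr_le (subtrace \<pi>) (\<sigma> ! i) (\<sigma> ! j) \<longleftrightarrow> pos \<pi> i \<le> pos \<pi> j"
proof -
  note D = sublist_ixD[OF \<pi>]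
  have u: "k = pos \<pi> i" if "k < length (subtrace \<pi>)" "subtrace \<pi> ! k = \<sigma> ! i" "i \<in> set \<pi>" for k i
    using that D(3) D(4,5)[of i] by (metis length_map nth_eq_iff_index_eq)
  show ?thesis
    unfolding tr_le_def
  proof
    assume "\<exists>k l. k \<le> l \<and> l < length (subtrace \<pi>) \<and> subtrace \<pi> ! k = \<sigma> ! i \<and> subtrace \<pi> ! l = \<sigma> ! j"
    then obtain k l where "k \<le> l" "l < length (subtrace \<pi>)" "subtrace \<pi> ! k = \<sigma> ! i"
      "subtrace \<pi> ! l = \<sigma> ! j" by blast
    then show "pos \<pi> i \<le> pos \<pi> j" using u[of k i] u[of l j] assms(2,3) by simp
  next
    assume "pos \<pi> i \<le> pos \<pi> j"
    then show "\<exists>k l. k \<le> l \<and> l < length (subtrace \<pi>) \<and> subtrace \<pi> ! k = \<sigma> ! i \<and> subtrace \<pi> ! l = \<sigma> ! j"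
      using D(4,5)[OF assms(2)] D(4,5)[OF assms(3)]
      by (intro exI[of _ "pos \<pi> i"] exI[of _ "pos \<pi> j"]) simp
  qed
qed

lemma tr_le_ix: "i < n \<Longrightarrow> j < n \<Longrightarrow> tr_le \<sigma> (\<sigma> ! i) (\<sigma> ! j) \<longleftrightarrow> i \<le> j"
  using tr_le_subtrace[OF sublist_ix_upt(1), of i j] by (simp add: sublist_ix_upt)

lemma to_le_ix: "i < n \<Longrightarrow> j < n \<Longrightarrow> to_le \<sigma> (\<sigma> ! i) (\<sigma> ! j) \<longleftrightarrow> i \<le> j \<and> tn i = tn j"
  by (auto simp: to_le_def tr_le_ix tn_eq_iff)

lemma find_before_ix:
  "r < n \<Longrightarrow> find P (rev (before \<sigma> (\<sigma> ! r))) = Some f \<longleftrightarrow>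
    (\<exists>a<r. f = \<sigma> ! a \<and> P (\<sigma> ! a) \<and> (\<forall>b. a < b \<and> b < r \<longrightarrow> \<not> P (\<sigma> ! b)))"
  by (simp add: before_nth distinct_trace find_rev_take_iff)

section \<open>Lock alternation and the matching of acquires with releases\<close>

definition alternating :: "nat list \<Rightarrow> bool" where
  "alternating \<pi> \<longleftrightarrow> (\<forall>i\<in>set \<pi>. \<forall>j\<in>set \<pi>.
     pos \<pi> i < pos \<pi> j \<and> 2 \<le> oc i \<and> oc i = oc j \<and> od i = od j \<longrightarrow>
     (\<exists>k\<in>set \<pi>. pos \<pi> i < pos \<pi> k \<and> pos \<pi> k < pos \<pi> j \<and> 2 \<le> oc k \<and> oc k \<noteq> oc i \<and> od k = od i))"

definition matched :: "nat list \<Rightarrow> bool" where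
  "matched \<pi> \<longleftrightarrow> (\<forall>r\<in>set \<pi>. oc r = 3 \<longrightarrow>
     (\<exists>a\<in>set \<pi>. oc a = 2 \<and> od a = od r \<and> pos \<pi> a < pos \<pi> r \<and> tn a = tn r \<and>
       (\<forall>b\<in>set \<pi>. pos \<pi> a < pos \<pi> b \<and> pos \<pi> b < pos \<pi> r \<longrightarrow> \<not> (oc b = 2 \<and> od b = od r))))"

text \<open>\<open>alternating\<close> constrains all pairs of equal operations on a lock, not just
  neighbours: between two of them lies the neighbour of the first, which is of the other kind. Codes
  2 and 3 are acquire and release, so \<open>2 \<le> oc i\<close> singles out the lock
  operations.\<close>

lemma alternating_iff:
  assumes \<pi>: "sublist_ix \<pi>"
  shows "(\<forall>l. successively (\<lambda>e f. oper e \<noteq> oper f)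
            (filter (\<lambda>e. oper e \<in> {Acq l, Rel l}) (subtrace \<pi>))) \<longleftrightarrow> alternating \<pi>" (is "?l \<longleftrightarrow> _")
proof -
  note D = sublist_ixD[OF \<pi>]
  have lock': "oper (\<sigma> ! i) = Acq l \<or> oper (\<sigma> ! i) = Rel l \<longleftrightarrow> 2 \<le> oc i \<and> od i = l" for i l
    using oc_cases[of i] by (auto simp: oper_ix)
  have "?l \<longleftrightarrow> (\<forall>l i j. i < j \<and> j < length \<pi> \<and> 2 \<le> oc (\<pi>!i) \<and> od (\<pi>!i) = l \<and> 2 \<le> oc (\<pi>!j) \<and> od (\<pi>!j) = l \<and>
      (\<forall>k. i < k \<and> k < j \<longrightarrow> \<not> (2 \<le> oc (\<pi>!k) \<and> od (\<pi>!k) = l)) \<longrightarrow> oc (\<pi>!i) \<noteq> oc (\<pi>!j))" (is "_ \<longleftrightarrow> ?m")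
    unfolding successively_filter_iff
    apply (rule iff_allI)+
    subgoal for l i j
      apply (cases "i < j \<and> j < length \<pi>")
       apply (simp add: lock' oper_eq_iff cong: conj_cong)
      apply (simp add: lock' oper_eq_iff del: imp_disjL)
       apply blast
      done
    done
  also have "?m \<longleftrightarrow> alternating \<pi>"
  proof
    assume m: ?m
    show "alternating \<pi>"
      unfolding alternating_def
    proof (intro ballI impI, elim conjE)
      fix x y assume xy: "x \<in> set \<pi>" "y \<in> set \<pi>" "pos \<pi> x < pos \<pi> y" "2 \<le> oc x" "oc x = oc y" "od x = od y"
      let ?i = "pos \<pi> x" and ?j = "pos \<pi> y"
      let ?Q = "\<lambda>k. ?i < k \<and> k < length \<pi> \<and> 2 \<le> oc (\<pi> ! k) \<and> od (\<pi> ! k) = od x"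
      have x: "\<pi> ! ?i = x" "\<pi> ! ?j = y" using nth_pos[OF D(1)] xy by auto
      have Qj: "?Q ?j" using xy x D(5)[OF xy(2)] by simp
      \<comment> \<open>The next operation on the lock after \<open>x\<close>. Being a neighbour of
        \<open>x\<close> it has the other code, so it is not \<open>y\<close> and lies before
        it.\<close>
      define k where "k = (LEAST k. ?Q k)"
      have k: "?Q k" "k \<le> ?j" unfolding k_def using LeastI[of ?Q, OF Qj] Least_le[of ?Q, OF Qj] by auto
      have "\<not> ?Q k'" if "k' < k" for k' using that not_less_Least unfolding k_def by blast
      then have ne: "oc x \<noteq> oc (\<pi> ! k)"
        using m[rule_format, of ?i k "od x"] k xy x by auto
      then have "k \<noteq> ?j" using xy x by auto
      then show "\<exists>k\<in>set \<pi>. ?i < pos \<pi> k \<and> pos \<pi> k < ?j \<and> 2 \<le> oc k \<and> oc k \<noteq> oc x \<and> od k = od x"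
        using k ne by (intro bexI[of _ "\<pi> ! k"]) (auto simp: D(1))
    qed
  next
    assume a: "alternating \<pi>"
    show ?m
    proof (intro allI impI notI, elim conjE)
      fix l i j assume ij: "i < j" "j < length \<pi>" "2 \<le> oc (\<pi>!i)" "od (\<pi>!i) = l" "od (\<pi>!j) = l"
        and n: "\<forall>k. i < k \<and> k < j \<longrightarrow> \<not> (2 \<le> oc (\<pi>!k) \<and> od (\<pi>!k) = l)" and e: "oc (\<pi>!i) = oc (\<pi>!j)"
      obtain k where k: "k \<in> set \<pi>" "i < pos \<pi> k" "pos \<pi> k < j" "2 \<le> oc k" "od k = l"
        using a[unfolded alternating_def, rule_format, of "\<pi>!i" "\<pi>!j"] ij e by (auto simp: D(1))
      then show False using n[rule_format, of "pos \<pi> k"] nth_pos[OF D(1) k(1)] by simp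
    qed
  qed
  finally show ?thesis .
qed

lemma match_of_release_subtrace:
  assumes "sublist_ix \<pi>" and "r \<in> set \<pi>" and "oc r = 3"
  shows "match_of (subtrace \<pi>) (\<sigma> ! r) = Some f \<longleftrightarrow>
    (\<exists>a\<in>set \<pi>. f = \<sigma> ! a \<and> oc a = 2 \<and> od a = od r \<and> pos \<pi> a < pos \<pi> r \<and>
       (\<forall>b\<in>set \<pi>. pos \<pi> a < pos \<pi> b \<and> pos \<pi> b < pos \<pi> r \<longrightarrow> \<not> (oc b = 2 \<and> od b = od r)))"
proof -
  have o: "oper (\<sigma> ! r) = Rel (od r)" using assms(3) by (simp add: oper_ix)
  show ?thesis
    unfolding match_of_def o
    by (simp add: find_before_subtrace[OF assms(1,2)] oper_ix conj_assoc)
qed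

lemma well_formed_subtrace:
  assumes \<pi>: "sublist_ix \<pi>"
  shows "well_formed (subtrace \<pi>) \<longleftrightarrow> alternating \<pi> \<and> matched \<pi>"
proof -
  note D = sublist_ixD[OF \<pi>]
  have "distinct (map eid (subtrace \<pi>))"
  proof -
    have "inj_on eid (set \<sigma>)" using wf by (simp add: well_formed_def distinct_map)
    moreover have "set (subtrace \<pi>) \<subseteq> set \<sigma>" using D(2) by auto
    ultimately show ?thesis using D(3) inj_on_subset unfolding distinct_map by blast
  qed
  moreover have "(\<forall>r \<in> set (subtrace \<pi>). \<forall>l. oper r = Rel l \<longrightarrow>
      (\<exists>a. match_of (subtrace \<pi>) r = Some a \<and> th a = th r)) \<longleftrightarrow> matched \<pi>"
  proof -
    have "(\<forall>l. oper (\<sigma> ! r) = Rel l \<longrightarrow> (\<exists>a. match_of (subtrace \<pi>) (\<sigma> ! r) = Some a \<and> th a = th (\<sigma> ! r)))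
      \<longleftrightarrow> (oc r = 3 \<longrightarrow>
     (\<exists>a\<in>set \<pi>. oc a = 2 \<and> od a = od r \<and> pos \<pi> a < pos \<pi> r \<and> tn a = tn r \<and>
       (\<forall>b\<in>set \<pi>. pos \<pi> a < pos \<pi> b \<and> pos \<pi> b < pos \<pi> r \<longrightarrow> \<not> (oc b = 2 \<and> od b = od r))))"
      if r: "r \<in> set \<pi>" for r
    proof (cases "oc r = 3")
      case True
      have t: "tn a = tn r \<longleftrightarrow> th (\<sigma> ! a) = th (\<sigma> ! r)" if "a \<in> set \<pi>" for a
        using tn_eq_iff D(2)[OF that] D(2)[OF r] by simp
      show ?thesis
        using True t by (auto simp: match_of_release_subtrace[OF \<pi> r True] oper_ix)
    qed (simp add: oper_ix)
    then show ?thesis by (simp add: matched_def)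
  qed
  ultimately show ?thesis
    unfolding well_formed_def alternating_iff[OF \<pi>] by simp
qed

lemma alternating_trace: "alternating [0..<n]" and matched_trace: "matched [0..<n]"
  using well_formed_subtrace[OF sublist_ix_upt(1)] wf by (simp_all add: sublist_ix_upt)

lemma lock_alternates:
  assumes "i < j" "j < n" "2 \<le> oc i" "oc i = oc j" "od i = od j"
  obtains k where "i < k" "k < j" "2 \<le> oc k" "oc k \<noteq> oc i" "od k = od i"
  using alternating_trace[unfolded alternating_def, rule_format, of i j] assms
  by (auto simp: sublist_ix_upt(3))

text \<open>Defined by the lock alone, as in \<open>match_of\<close>; that both events lie in one
  thread is a consequence of well-formedness and is recovered in \<open>mt_thread\<close>.\<close>

definition mt :: "nat \<Rightarrow> nat \<Rightarrow> bool" where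
  "mt a r \<longleftrightarrow> a < r \<and> r < n \<and> oc a = 2 \<and> oc r = 3 \<and> od r = od a \<and>
     (\<forall>k. a < k \<and> k < r \<longrightarrow> \<not> (oc k = 3 \<and> od k = od a))"

lemma match_of_acquire:
  assumes "a < n" "oc a = 2"
  shows "match_of \<sigma> (\<sigma> ! a) = Some f \<longleftrightarrow> (\<exists>r. mt a r \<and> f = \<sigma> ! r)"
proof -
  have o: "oper (\<sigma> ! a) = Acq (od a)" using assms by (simp add: oper_ix)
  show ?thesis
    unfolding match_of_def o using assms
    by (auto simp: after_nth distinct_trace find_drop_iff oper_ix mt_def Suc_le_eq)
qed

text \<open>A further acquire in between would be separated from \<open>a\<close> by a release,
  although \<open>r\<close> is the first one.\<close>

lemma mt_between:
  assumes "mt a r" "a < k" "k < r" "2 \<le> oc k" shows "od k \<noteq> od a"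
proof
  assume d: "od k = od a"
  then have k: "oc k = 2" using assms oc_cases[of k] by (auto simp: mt_def)
  obtain k' where "a < k'" "k' < k" "2 \<le> oc k'" "oc k' \<noteq> oc a" "od k' = od a"
    using lock_alternates[of a k] assms k d by (auto simp: mt_def)
  then show False using assms oc_cases[of k'] by (auto simp: mt_def)
qed

lemma release_matched:
  assumes "r < n" "oc r = 3"
  obtains a where "mt a r"
proof -
  obtain a where a: "a < r" "oc a = 2" "od a = od r" "tn a = tn r"
    "\<And>b. a < b \<Longrightarrow> b < r \<Longrightarrow> \<not> (oc b = 2 \<and> od b = od r)"
    using matched_trace[unfolded matched_def, rule_format, of r] assms
    by (auto simp: sublist_ix_upt(3)) 
  have "\<not> (oc k = 3 \<and> od k = od a)" if k: "a < k" "k < r" for k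
  proof
    assume c: "oc k = 3 \<and> od k = od a"
    obtain k' where "k < k'" "k' < r" "2 \<le> oc k'" "oc k' \<noteq> 3" "od k' = od a"
      using lock_alternates[of k r] c k assms a by auto
    then show False using a k oc_cases[of k'] by auto
  qed
  then have "mt a r" using a assms by (auto simp: mt_def)
  then show thesis by (rule that)
qed

text \<open>Well-formedness provides the last acquire before \<open>r\<close>, and in the thread of
  \<open>r\<close>. Neither can it lie after \<open>a\<close>, by \<open>mt_between\<close>, nor
  before \<open>a\<close>, as it is the last one; so it is \<open>a\<close>.\<close>

lemma mt_thread: "mt a r \<Longrightarrow> tn a = tn r"
proof -
  assume m: "mt a r"
  then have r: "r < n" "oc r = 3" by (auto simp: mt_def)
  obtain a' where a: "a' < r" "oc a' = 2" "od a' = od r" "tn a' = tn r"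
    "\<And>b. a' < b \<Longrightarrow> b < r \<Longrightarrow> \<not> (oc b = 2 \<and> od b = od r)"
    using matched_trace[unfolded matched_def, rule_format, of r] r
    by (auto simp: sublist_ix_upt(3))
  have "\<not> a < a'" using mt_between[OF m, of a'] a m by (auto simp: mt_def)
  moreover have "\<not> a' < a" using a(5)[of a] m by (auto simp: mt_def)
  ultimately show ?thesis using a by (metis nat_neq_iff)
qed

lemma mt_unique_right: "mt a r \<Longrightarrow> mt a r' \<Longrightarrow> r = r'"
  unfolding mt_def by (metis nat_neq_iff)

lemma mt_order:
  assumes "mt a r" "a < b" "b < n" "2 \<le> oc b" "od b = od a" "b \<noteq> r"
  shows "r < b"
  using mt_between[OF assms(1), of b] assms by (metis nat_neq_iff)


section \<open>Dependency closures and the graph on a candidate set\<close>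

definition rfr :: "nat \<Rightarrow> nat \<Rightarrow> bool" where
  "rfr w r \<longleftrightarrow> w < r \<and> oc r = 0 \<and> oc w = 1 \<and> od w = od r \<and>
     (\<forall>k. w < k \<and> k < r \<longrightarrow> \<not> (oc k = 1 \<and> od k = od r))"

text \<open>A single step reaches every earlier event of the thread, so closure under
  \<open>dep\<close> is at once closure under thread order.\<close>

definition dep :: "nat \<Rightarrow> nat \<Rightarrow> bool" where
  "dep i j \<longleftrightarrow> i < j \<and> j < n \<and> (tn i = tn j \<or> rfr i j)"

definition dep_closed :: "nat set \<Rightarrow> bool" where
  "dep_closed S \<longleftrightarrow> S \<subseteq> {..<n} \<and> (\<forall>j\<in>S. \<forall>i. dep i j \<longrightarrow> i \<in> S)"

definition TRC :: "nat \<Rightarrow> nat set" where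
  "TRC j = {i. dep\<^sup>*\<^sup>* i j}"

definition cf :: "nat \<Rightarrow> nat \<Rightarrow> bool" where
  "cf i j \<longleftrightarrow> i \<noteq> j \<and> od i = od j \<and> oc i \<le> 1 \<and> oc j \<le> 1 \<and> (oc i = 1 \<or> oc j = 1)"

definition lock_closed :: "nat \<Rightarrow> nat \<Rightarrow> nat set \<Rightarrow> bool" where
  "lock_closed i1 i2 S \<longleftrightarrow> i1 \<notin> S \<and> i2 \<notin> S \<and>
     (\<forall>i<i1. tn i = tn i1 \<longrightarrow> i \<in> S) \<and> (\<forall>i<i2. tn i = tn i2 \<longrightarrow> i \<in> S) \<and>
     dep_closed S \<and>
     (\<forall>a\<in>S. \<forall>r. mt a r \<and> i1 \<notin> TRC r \<and> i2 \<notin> TRC r \<longrightarrow> r \<in> S)"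

text \<open>The release-acquire edges do not ask whether the acquire is matched in the set: if it
  is, completed critical sections keep their trace order; if it is not, the acquire must follow all
  releases of its lock anyway.\<close>

definition fwd :: "nat \<Rightarrow> nat \<Rightarrow> bool" where
  "fwd i j \<longleftrightarrow> i < j \<and> (tn i = tn j \<or> cf i j \<or> oc i = 3 \<and> oc j = 2 \<and> od i = od j)"

definition open_acq :: "nat set \<Rightarrow> nat \<Rightarrow> bool" where
  "open_acq S a \<longleftrightarrow> a \<in> S \<and> oc a = 2 \<and> (\<forall>r\<in>S. \<not> mt a r)"

definition fwd_edges :: "nat set \<Rightarrow> nat rel" where
  "fwd_edges S = {(i, j). i \<in> S \<and> j \<in> S \<and> fwd i j}"

text \<open>An open acquire holds its lock to the end, so every section of this lock that is
  completed within the set must come before it. Edges of this kind that happen to point forward are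
  also in \<open>fwd_edges\<close>.\<close>

definition back_edges :: "nat set \<Rightarrow> nat rel" where
  "back_edges S = {(r, b). r \<in> S \<and> oc r = 3 \<and> open_acq S b \<and> od r = od b}"

definition feasible :: "nat set \<Rightarrow> bool" where
  "feasible S \<longleftrightarrow>
     (\<forall>a b. open_acq S a \<and> open_acq S b \<and> od a = od b \<longrightarrow> a = b) \<and>
     acyclic (fwd_edges S \<union> back_edges S)"

lemma dep_closedD: "dep_closed S \<Longrightarrow> j \<in> S \<Longrightarrow> dep i j \<Longrightarrow> i \<in> S"
  by (auto simp: dep_closed_def)

lemma dep_closed_less: "dep_closed S \<Longrightarrow> i \<in> S \<Longrightarrow> i < n"
  by (auto simp: dep_closed_def)

lemma rf_ix: "r < n \<Longrightarrow> rf \<sigma> (\<sigma> ! r) = Some f \<longleftrightarrow> (\<exists>w. rfr w r \<and> f = \<sigma> ! w)"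
proof -
  assume r: "r < n"
  show ?thesis
  proof (cases "oc r = 0")
    case True
    then have o: "oper (\<sigma> ! r) = Read (od r)" by (simp add: oper_ix)
    show ?thesis
      unfolding rf_def o using True
      by (auto simp: find_before_ix[OF r] oper_ix rfr_def)
  next
    case False
    then have "\<forall>x. oper (\<sigma> ! r) \<noteq> Read x" by (simp add: oper_ix)
    then have "rf \<sigma> (\<sigma> ! r) = None" by (cases "oper (\<sigma> ! r)") (auto simp: rf_def)
    then show ?thesis using False by (simp add: rfr_def)
  qed
qed

lemma rf_subtrace:
  assumes "sublist_ix \<pi>" "r \<in> set \<pi>" "oc r = 0"
  shows "rf (subtrace \<pi>) (\<sigma> ! r) = Some f \<longleftrightarrow>
    (\<exists>w\<in>set \<pi>. f = \<sigma> ! w \<and> oc w = 1 \<and> od w = od r \<and> pos \<pi> w < pos \<pi> r \<and>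
       (\<forall>k\<in>set \<pi>. pos \<pi> w < pos \<pi> k \<and> pos \<pi> k < pos \<pi> r \<longrightarrow> \<not> (oc k = 1 \<and> od k = od r)))"
proof -
  have o: "oper (\<sigma> ! r) = Read (od r)" using assms by (simp add: oper_ix)
  show ?thesis
    unfolding rf_def o
    by (simp add: find_before_subtrace[OF assms(1,2)] oper_ix conj_assoc)
qed

lemma image_mem: "S \<subseteq> {..<n} \<Longrightarrow> i < n \<Longrightarrow> \<sigma> ! i \<in> (!) \<sigma> ` S \<longleftrightarrow> i \<in> S"
  by (auto simp: nth_inj subset_iff)

lemma subset_set_image:
  assumes "S \<subseteq> set \<sigma>"
  obtains I where "I \<subseteq> {..<n}" "S = (!) \<sigma> ` I"
proof
  show "{i. i < n \<and> \<sigma> ! i \<in> S} \<subseteq> {..<n}" by auto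
  show "S = (!) \<sigma> ` {i. i < n \<and> \<sigma> ! i \<in> S}"
    using assms by (auto simp: in_set_conv_nth subset_iff image_iff)
qed

lemma to_rf_closed_ix:
  assumes S: "S \<subseteq> {..<n}"
  shows "to_rf_closed \<sigma> ((!) \<sigma> ` S) \<longleftrightarrow> dep_closed S"
proof -
  have 1: "(!) \<sigma> ` S \<subseteq> set \<sigma>" using S by auto
  have tos: "e \<in> set \<sigma>" if "to_le \<sigma> e f" for e f
    using that by (auto simp: to_le_def tr_le_def)
  have "(\<forall>e f. f \<in> (!) \<sigma> ` S \<and> to_le \<sigma> e f \<longrightarrow> e \<in> (!) \<sigma> ` S) \<longleftrightarrow>
      (\<forall>j\<in>S. \<forall>i<j. tn i = tn j \<longrightarrow> i \<in> S)" (is "?l \<longleftrightarrow> ?r")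
  proof
    assume l: ?l
    show ?r
    proof (intro ballI allI impI)
      fix j i assume "j \<in> S" "i < j" "tn i = tn j"
      moreover from this S have "i < n" "j < n" by auto
      ultimately show "i \<in> S"
        using l[rule_format, of "\<sigma> ! j" "\<sigma> ! i"] S by (auto simp: to_le_ix image_mem)
    qed
  next
    assume r: ?r
    show ?l
    proof (intro allI impI, elim conjE imageE)
      fix e f j assume t: "to_le \<sigma> e f" and f: "f = \<sigma> ! j" and j: "j \<in> S"
      obtain i where i: "i < n" "e = \<sigma> ! i" using tos[OF t] by (auto simp: in_set_conv_nth)
      have "j < n" using j S by auto
      then have "i \<le> j" "tn i = tn j" using t i f by (auto simp: to_le_ix)
      then have "i \<in> S" using r j by (metis le_neq_implies_less)
      then show "e \<in> (!) \<sigma> ` S" using i by simp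
    qed
  qed
  moreover have "(\<forall>r \<in> (!) \<sigma> ` S. \<forall>w. rf \<sigma> r = Some w \<longrightarrow> w \<in> (!) \<sigma> ` S) \<longleftrightarrow>
      (\<forall>r\<in>S. \<forall>w. rfr w r \<longrightarrow> w \<in> S)"
  proof -
    have "(\<forall>w. rf \<sigma> (\<sigma> ! r) = Some w \<longrightarrow> w \<in> (!) \<sigma> ` S) \<longleftrightarrow> (\<forall>w. rfr w r \<longrightarrow> w \<in> S)" if "r \<in> S" for r
    proof -
      have r: "r < n" using that S by auto
      have "w < n" if "rfr w r" for w using that r by (simp add: rfr_def)
      then show ?thesis using r image_mem[OF S] by (simp add: rf_ix) blast
    qed
    then show ?thesis by simp
  qed
  moreover have "(\<forall>i. dep i j \<longrightarrow> i \<in> S) \<longleftrightarrow>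
      (\<forall>i<j. tn i = tn j \<longrightarrow> i \<in> S) \<and> (\<forall>w. rfr w j \<longrightarrow> w \<in> S)" if "j \<in> S" for j
  proof -
    have "j < n" using that S by auto
    moreover have "w < j" if "rfr w j" for w using that by (simp add: rfr_def)
    ultimately show ?thesis unfolding dep_def by blast
  qed
  ultimately show ?thesis
    unfolding to_rf_closed_def dep_closed_def using S 1 by simp blast
qed

lemma dep_less: "dep i j \<Longrightarrow> i < j" "dep i j \<Longrightarrow> j < n"
  by (auto simp: dep_def)

lemma TRC_refl: "j \<in> TRC j"
  by (simp add: TRC_def)

lemma TRC_subset:
  assumes "dep_closed S" "j \<in> S" shows "TRC j \<subseteq> S"
proof
  fix i assume "i \<in> TRC j"
  then have "dep\<^sup>*\<^sup>* i j" by (simp add: TRC_def)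
  then show "i \<in> S"
    by (induction rule: converse_rtranclp_induct) (use assms in \<open>auto dest: dep_closedD\<close>)
qed

lemma TRC_le: "i \<in> TRC j \<Longrightarrow> i \<le> j"
proof -
  assume "i \<in> TRC j"
  then have "dep\<^sup>*\<^sup>* i j" by (simp add: TRC_def)
  then show ?thesis
    by (induction rule: converse_rtranclp_induct) (auto dest: dep_less)
qed

lemma dep_closed_TRC: "j < n \<Longrightarrow> dep_closed (TRC j)"
  unfolding dep_closed_def
  using TRC_le by (auto simp: TRC_def intro: converse_rtranclp_into_rtranclp) fastforce

text \<open>As \<open>dep\<close> comes from smaller indices only, this equation computes the
  closures in trace order.\<close>

lemma TRC_Un: "TRC j = insert j (\<Union>i\<in>{i. dep i j}. TRC i)"
  by (auto simp: TRC_def elim: rtranclp.cases intro: rtranclp.rtrancl_into_rtrancl)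

text \<open>The intersection is attained: \<open>TRC r\<close> is itself closed, and it lies in
  every closed set that contains \<open>r\<close>.\<close>

lemma TRClosure_ix: "r < n \<Longrightarrow> TRClosure \<sigma> (\<sigma> ! r) = (!) \<sigma> ` TRC r"
proof -
  assume r: "r < n"
  have s: "TRC r \<subseteq> {..<n}" using dep_closed_TRC[OF r] by (simp add: dep_closed_def)
  show ?thesis
  proof
    show "TRClosure \<sigma> (\<sigma> ! r) \<subseteq> (!) \<sigma> ` TRC r"
      unfolding TRClosure_def
      using dep_closed_TRC[OF r] to_rf_closed_ix[OF s] TRC_refl[of r] by blast
    show "(!) \<sigma> ` TRC r \<subseteq> TRClosure \<sigma> (\<sigma> ! r)"
      unfolding TRClosure_def
    proof (intro Inter_greatest, elim CollectE conjE)
      fix S assume S: "to_rf_closed \<sigma> S" "\<sigma> ! r \<in> S"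
      have "S \<subseteq> set \<sigma>" using S(1) by (simp add: to_rf_closed_def)
      then obtain I where I: "I \<subseteq> {..<n}" "S = (!) \<sigma> ` I" by (rule subset_set_image)
      have "dep_closed I" "r \<in> I"
        using S to_rf_closed_ix[OF I(1)] image_mem[OF I(1) r] unfolding I(2) by simp_all
      then have "TRC r \<subseteq> I" by (rule TRC_subset)
      then show "(!) \<sigma> ` TRC r \<subseteq> S" unfolding I(2) by (rule image_mono)
    qed
  qed
qed

text \<open>In a closed set the immediate predecessor brings along all earlier events of its thread;
  it is the maximum of their indices.\<close>

lemma prev_ix:
  assumes "dep_closed S" and i: "i < n"
  shows "(\<forall>p. prev \<sigma> (\<sigma> ! i) = Some p \<longrightarrow> p \<in> (!) \<sigma> ` S) \<longleftrightarrow> (\<forall>j<i. tn j = tn i \<longrightarrow> j \<in> S)"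
proof -
  have S: "S \<subseteq> {..<n}" using assms by (simp add: dep_closed_def)
  have p: "prev \<sigma> (\<sigma> ! i) = Some p \<longleftrightarrow>
      (\<exists>a<i. p = \<sigma> ! a \<and> tn a = tn i \<and> (\<forall>b. a < b \<and> b < i \<longrightarrow> tn b \<noteq> tn i))" for p
    unfolding prev_def find_before_ix[OF i] using i by (auto simp: tn_eq_iff)
  show ?thesis
  proof
    assume l: "\<forall>p. prev \<sigma> (\<sigma> ! i) = Some p \<longrightarrow> p \<in> (!) \<sigma> ` S"
    show "\<forall>j<i. tn j = tn i \<longrightarrow> j \<in> S"
    proof (intro allI impI)
      fix j assume j: "j < i" "tn j = tn i"
      let ?A = "{a. a < i \<and> tn a = tn i}"
      have f: "finite ?A" "?A \<noteq> {}" using j by auto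
      have m: "Max ?A \<in> ?A" using f by (rule Max_in)
      have le: "b \<le> Max ?A" if "b < i" "tn b = tn i" for b using f that by (intro Max_ge) auto
      have "prev \<sigma> (\<sigma> ! i) = Some (\<sigma> ! Max ?A)"
        unfolding p using m le by (intro exI[of _ "Max ?A"]) fastforce
      then have "Max ?A \<in> S" using l m i image_mem[OF S, of "Max ?A"] by auto
      moreover have "j \<le> Max ?A" using le j by auto
      ultimately show "j \<in> S"
        using m j i dep_closedD[OF assms(1), of "Max ?A" j]
        by (cases "j = Max ?A") (auto simp: dep_def order_le_less)
    qed
  next
    assume "\<forall>j<i. tn j = tn i \<longrightarrow> j \<in> S"
    then show "\<forall>p. prev \<sigma> (\<sigma> ! i) = Some p \<longrightarrow> p \<in> (!) \<sigma> ` S" by (auto simp: p)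
  qed
qed

lemma opt_lock_closed_ix:
  assumes S: "S \<subseteq> {..<n}" and i: "i1 < n" "i2 < n"
  shows "opt_lock_closed \<sigma> (\<sigma> ! i1) (\<sigma> ! i2) ((!) \<sigma> ` S) \<longleftrightarrow> lock_closed i1 i2 S"
proof -
  have "(\<forall>l r. oper (\<sigma> ! a) = Acq l \<and> match_of \<sigma> (\<sigma> ! a) = Some r \<and>
        \<sigma> ! i1 \<notin> TRClosure \<sigma> r \<and> \<sigma> ! i2 \<notin> TRClosure \<sigma> r \<longrightarrow> r \<in> (!) \<sigma> ` S) \<longleftrightarrow>
     (\<forall>r. mt a r \<and> i1 \<notin> TRC r \<and> i2 \<notin> TRC r \<longrightarrow> r \<in> S)" if a: "a \<in> S" for a
  proof -
    have an: "a < n" using a S by auto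
    have t: "(\<sigma> ! i \<in> TRClosure \<sigma> (\<sigma> ! r)) \<longleftrightarrow> i \<in> TRC r" if "i < n" "r < n" for i r
      using that dep_closed_TRC[of r] by (simp add: TRClosure_ix image_mem dep_closed_def)
    have m: "r < n" "oc a = 2" if "mt a r" for r using that by (auto simp: mt_def)
    show ?thesis
    proof (cases "oc a = 2")
      case True
      have "(\<forall>l r. oper (\<sigma> ! a) = Acq l \<and> match_of \<sigma> (\<sigma> ! a) = Some r \<and>
          \<sigma> ! i1 \<notin> TRClosure \<sigma> r \<and> \<sigma> ! i2 \<notin> TRClosure \<sigma> r \<longrightarrow> r \<in> (!) \<sigma> ` S) \<longleftrightarrow>
        (\<forall>r. mt a r \<longrightarrow> \<sigma> ! i1 \<notin> TRClosure \<sigma> (\<sigma> ! r) \<longrightarrow> \<sigma> ! i2 \<notin> TRClosure \<sigma> (\<sigma> ! r) \<longrightarrow>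
           \<sigma> ! r \<in> (!) \<sigma> ` S)"
        using True an by (simp add: oper_ix match_of_acquire) blast
      also have "\<dots> \<longleftrightarrow> (\<forall>r. mt a r \<longrightarrow> i1 \<notin> TRC r \<longrightarrow> i2 \<notin> TRC r \<longrightarrow> r \<in> S)"
        using t i m(1) image_mem[OF S] by simp
      finally show ?thesis by blast
    next
      case False
      then have "\<not> mt a r" for r by (simp add: mt_def)
      then show ?thesis using False by (simp add: oper_ix)
    qed
  qed
  then show ?thesis
    unfolding opt_lock_closed_def lock_closed_def to_rf_closed_ix[OF S]
    using prev_ix[of S i1] prev_ix[of S i2] i image_mem[OF S] by (simp cong: conj_cong) blast
qed

lemma conflict_ix: "i < n \<Longrightarrow> j < n \<Longrightarrow> conflict (\<sigma> ! i) (\<sigma> ! j) \<longleftrightarrow> cf i j"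
  using oc_cases[of i] oc_cases[of j]
  by (auto simp: conflict_def cf_def nth_inj oper_ix)

section \<open>Reorderings and races in terms of indices\<close>

definition reorders :: "nat list \<Rightarrow> bool" where
  "reorders \<pi> \<longleftrightarrow> alternating \<pi> \<and> matched \<pi> \<and> dep_closed (set \<pi>) \<and>
     (\<forall>i\<in>set \<pi>. \<forall>j\<in>set \<pi>. i < j \<and> tn i = tn j \<longrightarrow> pos \<pi> i < pos \<pi> j) \<and>
     (\<forall>r\<in>set \<pi>. oc r = 0 \<longrightarrow> rf (subtrace \<pi>) (\<sigma> ! r) = rf \<sigma> (\<sigma> ! r)) \<and>
     (\<forall>i\<in>set \<pi>. \<forall>j\<in>set \<pi>. cf i j \<longrightarrow> (pos \<pi> i < pos \<pi> j \<longleftrightarrow> i < j)) \<and>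
     (\<forall>a\<in>set \<pi>. \<forall>b\<in>set \<pi>. \<forall>r\<in>set \<pi>. \<forall>s\<in>set \<pi>.
        a \<noteq> b \<and> od a = od b \<and> mt a r \<and> mt b s \<longrightarrow> (pos \<pi> a < pos \<pi> b \<longleftrightarrow> a < b))"

lemma opt_correct_reordering_ix:
  assumes \<pi>: "sublist_ix \<pi>"
  shows "opt_correct_reordering \<sigma> (subtrace \<pi>) \<longleftrightarrow> reorders \<pi>"
proof -
  note D = sublist_ixD[OF \<pi>]
  have S: "set \<pi> \<subseteq> {..<n}" using \<pi> by (simp add: sublist_ix_def)
  have sub: "set (subtrace \<pi>) \<subseteq> set \<sigma>" using D(2) by auto
  have le: "pos \<pi> i \<le> pos \<pi> j \<longleftrightarrow> pos \<pi> i < pos \<pi> j" if "i \<in> set \<pi>" "j \<in> set \<pi>" "i \<noteq> j" for i j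
    using pos_eq_iff[OF D(1) that(1,2)] that(3) by linarith
  have to: "to_le (subtrace \<pi>) (\<sigma> ! i) (\<sigma> ! j) \<longleftrightarrow> tn i = tn j \<and> pos \<pi> i \<le> pos \<pi> j"
    if "i \<in> set \<pi>" "j \<in> set \<pi>" for i j
    using that D(2) by (auto simp: to_le_def tr_le_subtrace[OF \<pi>] tn_eq_iff)
  have 1: "(\<forall>e \<in> set (subtrace \<pi>). \<forall>f \<in> set (subtrace \<pi>). to_le \<sigma> e f \<longrightarrow> to_le (subtrace \<pi>) e f) \<longleftrightarrow>
     (\<forall>i\<in>set \<pi>. \<forall>j\<in>set \<pi>. i < j \<and> tn i = tn j \<longrightarrow> pos \<pi> i < pos \<pi> j)"
  proof -
    have "(to_le \<sigma> (\<sigma> ! i) (\<sigma> ! j) \<longrightarrow> to_le (subtrace \<pi>) (\<sigma> ! i) (\<sigma> ! j)) \<longleftrightarrow>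
        (i < j \<and> tn i = tn j \<longrightarrow> pos \<pi> i < pos \<pi> j)" if "i \<in> set \<pi>" "j \<in> set \<pi>" for i j
      using that D(2) le[OF that] by (cases "i = j") (auto simp: to_le_ix to)
    then show ?thesis by simp
  qed
  have 2: "(\<forall>e \<in> set (subtrace \<pi>). \<forall>x. oper e = Read x \<longrightarrow> rf (subtrace \<pi>) e = rf \<sigma> e) \<longleftrightarrow>
      (\<forall>r\<in>set \<pi>. oc r = 0 \<longrightarrow> rf (subtrace \<pi>) (\<sigma> ! r) = rf \<sigma> (\<sigma> ! r))"
    by (simp add: oper_ix)
  have 3: "(\<forall>e \<in> set (subtrace \<pi>). \<forall>f \<in> set (subtrace \<pi>). conflict e f \<longrightarrow>
       (tr_le (subtrace \<pi>) e f \<longleftrightarrow> tr_le \<sigma> e f)) \<longleftrightarrow>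
     (\<forall>i\<in>set \<pi>. \<forall>j\<in>set \<pi>. cf i j \<longrightarrow> (pos \<pi> i < pos \<pi> j \<longleftrightarrow> i < j))"
  proof -
    have "(conflict (\<sigma> ! i) (\<sigma> ! j) \<longrightarrow> (tr_le (subtrace \<pi>) (\<sigma> ! i) (\<sigma> ! j) \<longleftrightarrow> tr_le \<sigma> (\<sigma> ! i) (\<sigma> ! j))) \<longleftrightarrow>
        (cf i j \<longrightarrow> (pos \<pi> i < pos \<pi> j \<longleftrightarrow> i < j))" if "i \<in> set \<pi>" "j \<in> set \<pi>" for i j
    proof (cases "i = j")
      case False
      then show ?thesis
        using that D(2) le[OF that] by (simp add: conflict_ix tr_le_subtrace[OF \<pi>] tr_le_ix le_less)
    qed (use that D(2) in \<open>simp add: conflict_ix cf_def\<close>)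
    then show ?thesis by simp
  qed
  have 4: "(\<forall>a \<in> set (subtrace \<pi>). \<forall>b \<in> set (subtrace \<pi>). \<forall>l r s.
        a \<noteq> b \<and> oper a = Acq l \<and> oper b = Acq l \<and>
        match_of \<sigma> a = Some r \<and> match_of \<sigma> b = Some s \<and> r \<in> set (subtrace \<pi>) \<and> s \<in> set (subtrace \<pi>) \<longrightarrow>
        (tr_le (subtrace \<pi>) a b \<longleftrightarrow> tr_le \<sigma> a b)) \<longleftrightarrow>
     (\<forall>a\<in>set \<pi>. \<forall>b\<in>set \<pi>. \<forall>r\<in>set \<pi>. \<forall>s\<in>set \<pi>.
        a \<noteq> b \<and> od a = od b \<and> mt a r \<and> mt b s \<longrightarrow> (pos \<pi> a < pos \<pi> b \<longleftrightarrow> a < b))"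
  proof -
    have "(\<forall>l r s. \<sigma> ! a \<noteq> \<sigma> ! b \<and> oper (\<sigma> ! a) = Acq l \<and> oper (\<sigma> ! b) = Acq l \<and>
        match_of \<sigma> (\<sigma> ! a) = Some r \<and> match_of \<sigma> (\<sigma> ! b) = Some s \<and>
        r \<in> set (subtrace \<pi>) \<and> s \<in> set (subtrace \<pi>) \<longrightarrow>
        (tr_le (subtrace \<pi>) (\<sigma> ! a) (\<sigma> ! b) \<longleftrightarrow> tr_le \<sigma> (\<sigma> ! a) (\<sigma> ! b))) \<longleftrightarrow>
      (\<forall>r\<in>set \<pi>. \<forall>s\<in>set \<pi>. a \<noteq> b \<and> od a = od b \<and> mt a r \<and> mt b s \<longrightarrow> (pos \<pi> a < pos \<pi> b \<longleftrightarrow> a < b))"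
      if ab: "a \<in> set \<pi>" "b \<in> set \<pi>" for a b
    proof (cases "a \<noteq> b \<and> od a = od b \<and> oc a = 2 \<and> oc b = 2")
      case True
      have an: "a < n" "b < n" using ab D(2) by auto
      have t: "tr_le (subtrace \<pi>) (\<sigma> ! a) (\<sigma> ! b) \<longleftrightarrow> pos \<pi> a < pos \<pi> b" "tr_le \<sigma> (\<sigma> ! a) (\<sigma> ! b) \<longleftrightarrow> a < b"
        using True ab le[OF ab] an by (auto simp: tr_le_subtrace[OF \<pi>] tr_le_ix)
      have mem: "\<sigma> ! r \<in> set (subtrace \<pi>) \<longleftrightarrow> r \<in> set \<pi>" if "mt c r" for c r
        using that image_mem[OF S, of r] by (simp add: mt_def)
      have ex: "(\<exists>f. match_of \<sigma> (\<sigma> ! c) = Some f \<and> f \<in> set (subtrace \<pi>)) \<longleftrightarrow> (\<exists>r\<in>set \<pi>. mt c r)"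
        if "c < n" "oc c = 2" for c
        unfolding match_of_acquire[OF that] using mem by blast
      have "(\<forall>l r s. \<sigma> ! a \<noteq> \<sigma> ! b \<and> oper (\<sigma> ! a) = Acq l \<and> oper (\<sigma> ! b) = Acq l \<and>
          match_of \<sigma> (\<sigma> ! a) = Some r \<and> match_of \<sigma> (\<sigma> ! b) = Some s \<and>
          r \<in> set (subtrace \<pi>) \<and> s \<in> set (subtrace \<pi>) \<longrightarrow>
          (tr_le (subtrace \<pi>) (\<sigma> ! a) (\<sigma> ! b) \<longleftrightarrow> tr_le \<sigma> (\<sigma> ! a) (\<sigma> ! b))) \<longleftrightarrow>
        ((\<exists>f. match_of \<sigma> (\<sigma> ! a) = Some f \<and> f \<in> set (subtrace \<pi>)) \<and>
         (\<exists>f. match_of \<sigma> (\<sigma> ! b) = Some f \<and> f \<in> set (subtrace \<pi>)) \<longrightarrow>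
         (pos \<pi> a < pos \<pi> b \<longleftrightarrow> a < b))"
        using True nth_inj[OF an] unfolding t oper_ix by blast
      also have "\<dots> \<longleftrightarrow> ((\<exists>r\<in>set \<pi>. mt a r) \<and> (\<exists>r\<in>set \<pi>. mt b r) \<longrightarrow> (pos \<pi> a < pos \<pi> b \<longleftrightarrow> a < b))"
        using ex an True by simp
      finally show ?thesis using True by blast
    next
      case False
      have an: "a < n" "b < n" using ab D(2) by auto
      have "oc c = 2" if "mt c r" for c r using that by (simp add: mt_def)
      then show ?thesis using False an by (auto simp: nth_inj oper_ix)
    qed
    then show ?thesis by simp
  qed
  show ?thesis
    unfolding opt_correct_reordering_def correct_reordering_def reorders_def 1 2 3 4
      well_formed_subtrace[OF \<pi>]
    using to_rf_closed_ix[OF S] sub by auto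
qed

lemma osr_race_reorders:
  assumes i: "i1 < n" "i2 < n"
  shows "osr_race \<sigma> (\<sigma> ! i1) (\<sigma> ! i2) \<longleftrightarrow>
    cf i1 i2 \<and> (\<exists>\<pi>. sublist_ix \<pi> \<and> reorders \<pi> \<and> lock_closed i1 i2 (set \<pi>))"
proof
  assume "osr_race \<sigma> (\<sigma> ! i1) (\<sigma> ! i2)"
  then obtain \<rho> where c: "conflict (\<sigma> ! i1) (\<sigma> ! i2)" and \<rho>: "opt_correct_reordering \<sigma> \<rho>"
    and l: "opt_lock_closed \<sigma> (\<sigma> ! i1) (\<sigma> ! i2) (set \<rho>)"
    by (auto simp: osr_race_def)
  have s: "set \<rho> \<subseteq> set \<sigma>" and d: "distinct \<rho>"
    using \<rho> by (auto simp: opt_correct_reordering_def correct_reordering_def well_formed_def distinct_map)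
  define \<pi> where "\<pi> = map (pos \<sigma>) \<rho>"
  have nth: "\<sigma> ! pos \<sigma> e = e" "pos \<sigma> e < n" if "e \<in> set \<rho>" for e
    using that s distinct_trace by (auto simp: nth_pos pos_less_length)
  have sub: "subtrace \<pi> = \<rho>"
    unfolding \<pi>_def by (simp add: comp_def nth map_idI)
  have "inj_on (pos \<sigma>) (set \<rho>)" using nth(1) by (metis inj_onI)
  then have \<pi>: "sublist_ix \<pi>"
    unfolding sublist_ix_def using d nth(2) by (auto simp: \<pi>_def distinct_map)
  have "set \<rho> = (!) \<sigma> ` set \<pi>" using sub by (metis set_map)
  then have "lock_closed i1 i2 (set \<pi>)"
    using opt_lock_closed_ix[OF _ i, of "set \<pi>"] l \<pi> by (simp add: sublist_ix_def)
  moreover have "reorders \<pi>" using opt_correct_reordering_ix[OF \<pi>] \<rho> sub by simp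
  ultimately show "cf i1 i2 \<and> (\<exists>\<pi>. sublist_ix \<pi> \<and> reorders \<pi> \<and> lock_closed i1 i2 (set \<pi>))"
    using \<pi> c i by (auto simp: conflict_ix)
next
  assume "cf i1 i2 \<and> (\<exists>\<pi>. sublist_ix \<pi> \<and> reorders \<pi> \<and> lock_closed i1 i2 (set \<pi>))"
  then obtain \<pi> where c: "cf i1 i2" and \<pi>: "sublist_ix \<pi>" "reorders \<pi>" and l: "lock_closed i1 i2 (set \<pi>)"
    by blast
  have S: "set \<pi> \<subseteq> {..<n}" using \<pi> by (simp add: sublist_ix_def)
  \<comment> \<open>Both events are enabled because \<open>lock_closed\<close> keeps them out of the
    set and puts everything before them in their threads into it.\<close>
  have en: "enabled_in \<sigma> (subtrace \<pi>) (\<sigma> ! i)"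
    if "i < n" "i \<notin> set \<pi>" "\<forall>j<i. tn j = tn i \<longrightarrow> j \<in> set \<pi>" for i
    unfolding enabled_in_def
  proof (intro conjI allI impI)
    show "\<sigma> ! i \<notin> set (subtrace \<pi>)" using that image_mem[OF S] by simp
    fix e' assume e: "e' \<noteq> \<sigma> ! i \<and> to_le \<sigma> e' (\<sigma> ! i)"
    then obtain j where j: "j < n" "e' = \<sigma> ! j"
      by (metis to_le_def tr_le_def le_less_trans)
    then have "j < i" "tn j = tn i" using e that(1) by (auto simp: to_le_ix le_less)
    then show "e' \<in> set (subtrace \<pi>)" using that(3) j by simp
  qed
  show "osr_race \<sigma> (\<sigma> ! i1) (\<sigma> ! i2)"
    unfolding osr_race_def
    using c i l en[of i1] en[of i2] opt_correct_reordering_ix[OF \<pi>(1)] \<pi>(2)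
      opt_lock_closed_ix[OF S i]
    by (auto simp: conflict_ix lock_closed_def intro!: exI[of _ "subtrace \<pi>"])
qed

end

section \<open>Races as an acyclicity condition\<close>

context indexed_trace
begin

lemma release_ex: "r < n \<Longrightarrow> oc r = 3 \<Longrightarrow> \<exists>a. mt a r"
  by (meson release_matched)

lemma mt_dep: "mt a r \<Longrightarrow> dep a r"
  using mt_thread by (auto simp: mt_def dep_def)

lemma mt_fwd: "mt a r \<Longrightarrow> fwd a r"
  using mt_thread by (auto simp: mt_def fwd_def)

text \<open>The positions in \<open>\<pi>\<close> increase along every edge of the graph, so it has
  no cycle. The work lies in the locks: no acquire falls inside another critical section of its
  lock, and an open acquire is the last acquire of its lock.\<close>

lemma feasible_if_reorders:
  assumes \<pi>: "sublist_ix \<pi>" and re: "reorders \<pi>"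
  shows "feasible (set \<pi>)"
proof -
  let ?S = "set \<pi>" and ?p = "pos \<pi>"
  note D = sublist_ixD[OF \<pi>]
  have alt: "alternating \<pi>" and mat: "matched \<pi>" and cl: "dep_closed ?S"
    and to: "\<And>i j. i \<in> ?S \<Longrightarrow> j \<in> ?S \<Longrightarrow> i < j \<Longrightarrow> tn i = tn j \<Longrightarrow> ?p i < ?p j"
    and cfo: "\<And>i j. i \<in> ?S \<Longrightarrow> j \<in> ?S \<Longrightarrow> cf i j \<Longrightarrow> ?p i < ?p j \<longleftrightarrow> i < j"
    and acq: "\<And>a b r s. a \<in> ?S \<Longrightarrow> b \<in> ?S \<Longrightarrow> r \<in> ?S \<Longrightarrow> s \<in> ?S \<Longrightarrow> a \<noteq> b \<Longrightarrow> od a = od b \<Longrightarrow>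
        mt a r \<Longrightarrow> mt b s \<Longrightarrow> ?p a < ?p b \<longleftrightarrow> a < b"
    using re unfolding reorders_def by blast+
  \<comment> \<open>The acquire that \<open>matched\<close> assigns to \<open>r\<close> in the
    reordering must be the original partner \<open>a\<close>; hence no other acquire of the lock is
    placed between them.\<close>
  have nb: "a \<in> ?S \<and> ?p a < ?p r \<and> (\<forall>b\<in>?S. oc b = 2 \<and> od b = od a \<and> b \<noteq> a \<longrightarrow> ?p b < ?p a \<or> ?p r < ?p b)"
    if m: "mt a r" and r: "r \<in> ?S" for a r
  proof -
    have a: "a \<in> ?S" using dep_closedD[OF cl r mt_dep[OF m]] .
    have ar: "?p a < ?p r" using to[OF a r] m mt_thread[OF m] by (simp add: mt_def)
    obtain a' where a': "a' \<in> ?S" "oc a' = 2" "od a' = od r" "?p a' < ?p r" "tn a' = tn r"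
      and no: "\<And>b. b \<in> ?S \<Longrightarrow> ?p a' < ?p b \<Longrightarrow> ?p b < ?p r \<Longrightarrow> \<not> (oc b = 2 \<and> od b = od r)"
      using mat r m unfolding matched_def mt_def by blast
    have "\<not> r < a'" using to[OF r a'(1)] a'(4,5) by auto
    moreover have "r \<noteq> a'" using a'(2) m by (auto simp: mt_def)
    ultimately have "\<not> a < a'" using mt_between[OF m, of a'] a' m by (auto simp: mt_def)
    moreover have "\<not> a' < a"
      using to[OF a'(1) a] no[OF a] ar m mt_thread[OF m] a'(5) by (auto simp: mt_def)
    ultimately have "a' = a" by simp
    have "?p b < ?p a \<or> ?p r < ?p b" if b: "b \<in> ?S" "oc b = 2" "od b = od a" "b \<noteq> a" for b
    proof -
      have "b \<noteq> r" "od b = od r" using b m by (auto simp: mt_def)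
      then have "?p b \<noteq> ?p a" "?p b \<noteq> ?p r"
        using pos_eq_iff[OF D(1) b(1)] a r b(4) by auto
      then show ?thesis using no[OF b(1)] b \<open>od b = od r\<close> \<open>a' = a\<close> by (metis nat_neq_iff)
    qed
    then show ?thesis using a ar by blast
  qed
  \<comment> \<open>Between the open \<open>b\<close> and a later acquire \<open>b'\<close> there
    would be a release. Its own acquire is not \<open>b\<close>, hence also lies after
    \<open>b\<close>, and it comes before \<open>b'\<close>: a smaller counterexample.\<close>
  have last: "\<not> ?p b < ?p b'" if "open_acq ?S b" "b' \<in> ?S" "oc b' = 2" "od b' = od b" for b b'
    using that
  proof (induction "?p b'" arbitrary: b' rule: less_induct)
    case less
    show ?case
    proof
      assume "?p b < ?p b'"
      then obtain k where k: "k \<in> ?S" "?p b < ?p k" "?p k < ?p b'" "oc k = 3" "od k = od b"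
        using alt[unfolded alternating_def, rule_format, of b b'] less.prems oc_cases
        unfolding open_acq_def by (metis One_nat_def Suc_1 Suc_n_not_le_n le_numeral_extra(3) not_numeral_le_zero order_refl)
      obtain a where a: "mt a k" using release_ex[of k] k D(2) by auto
      have "a \<noteq> b" using less.prems(1) k a by (auto simp: open_acq_def)
      then have "?p b < ?p a"
        using nb[OF a k(1)] k less.prems(1) a by (auto simp: open_acq_def mt_def)
      moreover have "a \<in> ?S" "?p a < ?p b'" using nb[OF a k(1)] k(3) by auto
      moreover have "oc a = 2" "od a = od b" using a k(5) by (auto simp: mt_def)
      ultimately show False using less.hyps[of a] less.prems(1) by blast
    qed
  qed
  have bk: "?p r < ?p b" if "r \<in> ?S" "oc r = 3" "open_acq ?S b" "od r = od b" for r b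
  proof -
    have "r < n" using that D(2) by blast
    then obtain a where a: "mt a r" using release_ex \<open>oc r = 3\<close> by blast
    have "a \<noteq> b" using that a by (auto simp: open_acq_def)
    moreover have "\<not> ?p b < ?p a" using last[OF that(3), of a] nb[OF a that(1)] a that by (auto simp: mt_def)
    ultimately show ?thesis using nb[OF a that(1)] that a by (auto simp: open_acq_def mt_def)
  qed
  have fw: "?p i < ?p j" if "i \<in> ?S" "j \<in> ?S" "fwd i j" for i j
  proof -
    from \<open>fwd i j\<close> consider "tn i = tn j" | "cf i j" | "oc i = 3" "oc j = 2" "od i = od j"
      by (auto simp: fwd_def)
    then show ?thesis
    proof cases
      case 3
      have "i < n" using that D(2) by blast
      then obtain a where a: "mt a i" using release_ex 3 by blast
      show ?thesis
      proof (cases "open_acq ?S j")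
        case True
        then show ?thesis using bk that 3 by blast
      next
        case False
        then obtain s where s: "s \<in> ?S" "mt j s"
          using \<open>j \<in> ?S\<close> 3 by (auto simp: open_acq_def)
        have aj: "a < j" "od a = od j" using a that(3) 3 by (auto simp: mt_def fwd_def)
        then have "?p a < ?p j" using acq[of a j i s] nb[OF a that(1)] that s a by auto
        then show ?thesis using nb[OF a that(1)] that(2) 3 aj by auto
      qed
    qed (use to cfo that in \<open>auto simp: fwd_def\<close>)
  qed
  have edge: "?p x < ?p y" if "(x, y) \<in> fwd_edges ?S \<union> back_edges ?S" for x y
    using that fw bk by (auto simp: fwd_edges_def back_edges_def)
  have "?p x < ?p y" if "(x, y) \<in> (fwd_edges ?S \<union> back_edges ?S)\<^sup>+" for x y
    using that by (induction rule: trancl_induct) (use edge in \<open>auto intro: less_trans\<close>)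
  then have "acyclic (fwd_edges ?S \<union> back_edges ?S)" unfolding acyclic_def by blast
  moreover have "a = b" if "open_acq ?S a" "open_acq ?S b" "od a = od b" for a b
  proof -
    have "a \<in> ?S" "b \<in> ?S" "oc a = 2" "oc b = 2" using that by (auto simp: open_acq_def)
    then show ?thesis using last[of a b] last[of b a] that pos_eq_iff[OF D(1), of a b] by fastforce
  qed
  ultimately show ?thesis unfolding feasible_def by blast
qed

text \<open>Any topological order of the graph is a witness: sections completed in \<open>S\<close>
  keep their trace order by the release-acquire edges, an open acquire comes after all releases of
  its lock, and conflicting events keep their order.\<close>

lemma reorders_if_feasible:
  assumes cl: "dep_closed S" and fe: "feasible S"
  obtains \<pi> where "sublist_ix \<pi>" "set \<pi> = S" "reorders \<pi>"
proof -
  have Sn: "S \<subseteq> {..<n}" using cl by (simp add: dep_closed_def)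
  have "finite S" using Sn finite_subset by blast
  moreover have "fwd_edges S \<union> back_edges S \<subseteq> S \<times> S"
    by (auto simp: fwd_edges_def back_edges_def open_acq_def)
  moreover have "acyclic (fwd_edges S \<union> back_edges S)" using fe by (simp add: feasible_def)
  ultimately obtain \<pi> where d: "distinct \<pi>" and S: "set \<pi> = S"
    and e: "\<And>x y. (x, y) \<in> fwd_edges S \<union> back_edges S \<Longrightarrow> pos \<pi> x < pos \<pi> y"
    using topological_sort[of S "fwd_edges S \<union> back_edges S"] by blast
  let ?p = "pos \<pi>"
  have \<pi>: "sublist_ix \<pi>" using d S Sn by (simp add: sublist_ix_def)
  have fw: "?p i < ?p j" if "i \<in> S" "j \<in> S" "fwd i j" for i j
    using that e by (auto simp: fwd_edges_def)
  have bk: "?p r < ?p b" if "r \<in> S" "oc r = 3" "open_acq S b" "od r = od b" for r b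
    using that e by (auto simp: back_edges_def)
  have uniq: "a = b" if "open_acq S a" "open_acq S b" "od a = od b" for a b
    using fe that by (auto simp: feasible_def)
  have mS: "a \<in> S" "?p a < ?p r" if "mt a r" "r \<in> S" for a r
  proof -
    show "a \<in> S" using dep_closedD[OF cl that(2) mt_dep[OF that(1)]] .
    then show "?p a < ?p r" using fw mt_fwd that by blast
  qed
  have less: "?p r < ?p b" if "mt a r" "mt b s" "r \<in> S" "b \<in> S" "a < b" "od a = od b" for a b r s
  proof -
    have "b \<noteq> r" using that by (auto simp: mt_def)
    then have "r < b" using mt_order[OF that(1,5)] that by (auto simp: mt_def)
    then have "fwd r b" using that by (auto simp: mt_def fwd_def)
    then show ?thesis using fw that by blast
  qed
  \<comment> \<open>An open acquire follows \<open>r\<close> by a back edge. Otherwise both sections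
    are completed in \<open>S\<close>, and the earlier one in the trace ends before the other
    begins.\<close>
  have nb: "?p b < ?p a \<or> ?p r < ?p b"
    if "mt a r" "r \<in> S" "b \<in> S" "oc b = 2" "od b = od a" "b \<noteq> a" for a b r
  proof (cases "open_acq S b")
    case True
    then show ?thesis using bk[of r b] that by (auto simp: mt_def)
  next
    case False
    then obtain s where s: "s \<in> S" "mt b s"
      using \<open>b \<in> S\<close> \<open>oc b = 2\<close> by (auto simp: open_acq_def)
    show ?thesis
    proof (cases "a < b")
      case True
      then show ?thesis using less[OF that(1) s(2)] that by auto
    next
      case False
      then have "?p s < ?p a" using less[OF s(2) that(1) s(1)] mS[OF that(1,2)] that by auto
      then show ?thesis using mS[OF s(2,1)] by simp
    qed
  qed
  have "alternating \<pi>"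
    unfolding alternating_def S
  proof (intro ballI impI, elim conjE)
    fix i j assume ij: "i \<in> S" "j \<in> S" "?p i < ?p j" "2 \<le> oc i" "oc i = oc j" "od i = od j"
    have "oc i = 2 \<or> oc i = 3" using ij(4) oc_cases[of i] by auto
    then show "\<exists>k\<in>S. ?p i < ?p k \<and> ?p k < ?p j \<and> 2 \<le> oc k \<and> oc k \<noteq> oc i \<and> od k = od i"
    proof
      assume c: "oc i = 2"
      have ne: "i \<noteq> j" using ij by auto
      show ?thesis
      proof (cases "open_acq S i")
        case True
        then have "\<not> open_acq S j" using uniq ne ij by blast
        then obtain s where s: "s \<in> S" "mt j s" using ij c by (auto simp: open_acq_def)
        have "?p s < ?p i" using bk[of s i] True s ij by (auto simp: mt_def)
        then show ?thesis using mS[OF s(2,1)] ij by simp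
      next
        case False
        then obtain r where r: "r \<in> S" "mt i r" using ij c by (auto simp: open_acq_def)
        have "?p r < ?p j" using nb[OF r(2,1) ij(2)] ne ij c by auto
        then show ?thesis using mS[OF r(2,1)] r by (intro bexI[of _ r]) (auto simp: mt_def)
      qed
    next
      assume c: "oc i = 3"
      obtain a where a: "mt a i" using release_ex[of i] c ij Sn by auto
      obtain b where b: "mt b j" using release_ex[of j] c ij Sn by auto
      have ne: "a \<noteq> b" using a b ij mt_unique_right by auto
      have o: "oc a = 2" "oc b = 2" "od a = od b" "od a = od i" using a b ij by (auto simp: mt_def)
      have ab: "a \<in> S" "b \<in> S" "?p a < ?p i" "?p b < ?p j" using mS a b ij by auto
      have "\<not> ?p b < ?p a" using nb[OF b ij(2) ab(1)] ne o ab ij by auto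
      then have "?p i < ?p b" using nb[OF a ij(1) ab(2)] ne o by auto
      then show ?thesis using ab o c by (intro bexI[of _ b]) auto
    qed
  qed
  moreover have "matched \<pi>"
    unfolding matched_def S
  proof (intro ballI impI)
    fix r assume r: "r \<in> S" "oc r = 3"
    obtain a where a: "mt a r" using release_ex[of r] r Sn by auto
    have "\<not> (oc b = 2 \<and> od b = od r)" if "b \<in> S" "?p a < ?p b" "?p b < ?p r" for b
      using nb[OF a r(1) that(1)] that a by (auto simp: mt_def)
    then show "\<exists>a\<in>S. oc a = 2 \<and> od a = od r \<and> ?p a < ?p r \<and> tn a = tn r \<and>
        (\<forall>b\<in>S. ?p a < ?p b \<and> ?p b < ?p r \<longrightarrow> \<not> (oc b = 2 \<and> od b = od r))"
      using mS[OF a r(1)] mt_thread[OF a] a by (intro bexI[of _ a]) (auto simp: mt_def)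
  qed
  moreover have to: "\<forall>i\<in>S. \<forall>j\<in>S. i < j \<and> tn i = tn j \<longrightarrow> ?p i < ?p j"
    using fw by (simp add: fwd_def)
  moreover have cfo: "\<forall>i\<in>S. \<forall>j\<in>S. cf i j \<longrightarrow> (?p i < ?p j \<longleftrightarrow> i < j)"
  proof (intro ballI impI)
    fix i j assume ij: "i \<in> S" "j \<in> S" and c: "cf i j"
    have "cf j i" "i \<noteq> j" using c by (auto simp: cf_def)
    then show "?p i < ?p j \<longleftrightarrow> i < j"
      using fw[of i j] fw[of j i] ij c by (cases i j rule: linorder_cases) (auto simp: fwd_def)
  qed
  moreover have "\<forall>a\<in>S. \<forall>b\<in>S. \<forall>r\<in>S. \<forall>s\<in>S.
        a \<noteq> b \<and> od a = od b \<and> mt a r \<and> mt b s \<longrightarrow> (?p a < ?p b \<longleftrightarrow> a < b)"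
  proof (intro ballI impI, elim conjE)
    fix a b r s assume s: "a \<in> S" "b \<in> S" "r \<in> S" "s \<in> S" "a \<noteq> b" "od a = od b" "mt a r" "mt b s"
    show "?p a < ?p b \<longleftrightarrow> a < b"
      using less[OF s(7,8)] less[OF s(8,7)] mS[OF s(7)] mS[OF s(8)] s
      by (metis nat_neq_iff less_trans)
  qed
  \<comment> \<open>The write read in \<sigma> belongs to \<open>S\<close> by closure. All writes on
    the variable conflict with each other and with the read, so their relative order, and with it
    the last write before the read, is the same in both orders.\<close>
  moreover have "rf (subtrace \<pi>) (\<sigma> ! r) = rf \<sigma> (\<sigma> ! r)" if r: "r \<in> S" "oc r = 0" for r
  proof -
    have rn: "r < n" using r Sn by auto
    have rs: "r \<in> set \<pi>" using r S by simp
    have cf: "cf w r" if "oc w = 1" "od w = od r" for w using r that by (auto simp: cf_def)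
    have wr: "?p w < ?p r \<longleftrightarrow> w < r" if "w \<in> S" "oc w = 1" "od w = od r" for w
      using cfo that r cf by blast
    have ww: "?p v < ?p w \<longleftrightarrow> v < w" if "v \<in> S" "w \<in> S" "oc w = 1" "od w = od r" "oc v = 1" "od v = od r" for v w
      using cfo that by (cases "v = w") (auto simp: cf_def)
    have "rf (subtrace \<pi>) (\<sigma> ! r) = Some f \<longleftrightarrow> rf \<sigma> (\<sigma> ! r) = Some f" for f
      unfolding rf_subtrace[OF \<pi> rs r(2)] rf_ix[OF rn] S
    proof
      assume "\<exists>w\<in>S. f = \<sigma> ! w \<and> oc w = 1 \<and> od w = od r \<and> ?p w < ?p r \<and>
         (\<forall>k\<in>S. ?p w < ?p k \<and> ?p k < ?p r \<longrightarrow> \<not> (oc k = 1 \<and> od k = od r))"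
      then obtain w where w: "w \<in> S" "f = \<sigma> ! w" "oc w = 1" "od w = od r" "?p w < ?p r"
        "\<And>k. k \<in> S \<Longrightarrow> ?p w < ?p k \<Longrightarrow> ?p k < ?p r \<Longrightarrow> \<not> (oc k = 1 \<and> od k = od r)" by blast
      have lt: "w < r" using wr w by blast
      let ?A = "{v. v < r \<and> oc v = 1 \<and> od v = od r}"
      have A: "finite ?A" "w \<in> ?A" using w lt by auto
      define v where "v = Max ?A"
      have v: "v \<in> ?A" unfolding v_def using A by (intro Max_in) auto
      have "k \<le> v" if "k \<in> ?A" for k unfolding v_def using A that by (intro Max_ge) auto
      then have "\<not> (oc k = 1 \<and> od k = od r)" if "v < k" "k < r" for k
        using that by (metis (mono_tags, lifting) mem_Collect_eq not_less)
      then have rv: "rfr v r" using v r by (auto simp: rfr_def)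
      have "w \<le> v" unfolding v_def using A by (intro Max_ge)
      then have vS: "v \<in> S" using dep_closedD[OF cl r(1), of v] rv v rn by (auto simp: dep_def)
      have "w = v"
      proof (rule ccontr)
        assume "w \<noteq> v"
        then have "?p w < ?p v" using ww[of w v] \<open>w \<le> v\<close> w v vS by auto
        moreover have "?p v < ?p r" using wr v vS by blast
        ultimately show False using w(6)[OF vS] v by blast
      qed
      then show "\<exists>w. rfr w r \<and> f = \<sigma> ! w" using rv w by blast
    next
      assume "\<exists>w. rfr w r \<and> f = \<sigma> ! w"
      then obtain w where w: "rfr w r" "f = \<sigma> ! w" by blast
      have wS: "w \<in> S" using dep_closedD[OF cl r(1), of w] w rn by (auto simp: dep_def rfr_def)
      have "\<not> (oc k = 1 \<and> od k = od r)" if "k \<in> S" "?p w < ?p k" "?p k < ?p r" for k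
      proof
        assume k: "oc k = 1 \<and> od k = od r"
        then have "w < k" "k < r" using that ww[of w k] wr[of k] w(1) wS by (auto simp: rfr_def)
        then show False using k w(1) by (auto simp: rfr_def)
      qed
      moreover have "oc w = 1" "od w = od r" "?p w < ?p r" using w(1) wr[OF wS] by (auto simp: rfr_def)
      ultimately show "\<exists>w\<in>S. f = \<sigma> ! w \<and> oc w = 1 \<and> od w = od r \<and> ?p w < ?p r \<and>
         (\<forall>k\<in>S. ?p w < ?p k \<and> ?p k < ?p r \<longrightarrow> \<not> (oc k = 1 \<and> od k = od r))"
        using w(2) wS by blast
    qed
    then show ?thesis by (metis option.exhaust)
  qed
  ultimately have "reorders \<pi>" unfolding reorders_def S using cl by blast
  then show thesis using that \<pi> S by blast
qed

section \<open>The least candidate set and the characterization of races\<close>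

inductive_set Cl :: "nat \<Rightarrow> nat \<Rightarrow> nat set" for i1 i2 where
  left: "i < i1 \<Longrightarrow> tn i = tn i1 \<Longrightarrow> i \<in> Cl i1 i2"
| right: "i < i2 \<Longrightarrow> tn i = tn i2 \<Longrightarrow> i \<in> Cl i1 i2"
| dep: "j \<in> Cl i1 i2 \<Longrightarrow> dep i j \<Longrightarrow> i \<in> Cl i1 i2"
| rel: "a \<in> Cl i1 i2 \<Longrightarrow> mt a r \<Longrightarrow> i1 \<notin> TRC r \<Longrightarrow> i2 \<notin> TRC r \<Longrightarrow> r \<in> Cl i1 i2"

lemma dep_closed_Cl:
  assumes "i1 < n" "i2 < n" shows "dep_closed (Cl i1 i2)"
proof -
  have "i < n" if "i \<in> Cl i1 i2" for i
    using that by (induction rule: Cl.induct) (use assms in \<open>auto simp: mt_def dest: dep_less\<close>)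
  then show ?thesis unfolding dep_closed_def by (auto intro: Cl.dep)
qed

text \<open>\<open>Cl i1 i2\<close> is generated without regard to whether it reaches
  \<open>i1\<close> or \<open>i2\<close>. If it does, so does every set with the required closure
  properties, and there is no race.\<close>

theorem osr_race_ix:
  assumes i: "i1 < n" "i2 < n"
  shows "osr_race \<sigma> (\<sigma> ! i1) (\<sigma> ! i2) \<longleftrightarrow>
    cf i1 i2 \<and> i1 \<notin> Cl i1 i2 \<and> i2 \<notin> Cl i1 i2 \<and> feasible (Cl i1 i2)"
proof
  assume "osr_race \<sigma> (\<sigma> ! i1) (\<sigma> ! i2)"
  then obtain \<pi> where c: "cf i1 i2" and \<pi>: "sublist_ix \<pi>" "reorders \<pi>" "lock_closed i1 i2 (set \<pi>)"
    using osr_race_reorders[OF i] by blast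
  define S where "S = set \<pi>"
  have l: "lock_closed i1 i2 S" and f: "feasible S"
    using \<pi> feasible_if_reorders by (auto simp: S_def)
  have sub: "Cl i1 i2 \<subseteq> S"
  proof
    fix x assume "x \<in> Cl i1 i2"
    then show "x \<in> S"
      by induction (use l in \<open>auto simp: lock_closed_def dest: dep_closedD\<close>)
  qed
  \<comment> \<open>If \<open>S\<close> contained the release \<open>r\<close> of \<open>b\<close>,
    it would contain \<open>TRC r\<close>, which then avoids \<open>i1\<close> and
    \<open>i2\<close>. So \<open>r\<close> is a forced release, and it would already be in
    \<open>Cl i1 i2\<close>.\<close>
  have op: "open_acq S b" if "open_acq (Cl i1 i2) b" for b
    unfolding open_acq_def
  proof (intro conjI ballI notI)
    show "b \<in> S" "oc b = 2" using that sub by (auto simp: open_acq_def)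
    fix r assume r: "r \<in> S" "mt b r"
    have "TRC r \<subseteq> S" using l r(1) by (intro TRC_subset) (auto simp: lock_closed_def)
    then have "i1 \<notin> TRC r" "i2 \<notin> TRC r" using l by (auto simp: lock_closed_def)
    then have "r \<in> Cl i1 i2" using that r Cl.rel by (auto simp: open_acq_def)
    then show False using that r by (auto simp: open_acq_def)
  qed
  have "fwd_edges (Cl i1 i2) \<union> back_edges (Cl i1 i2) \<subseteq> fwd_edges S \<union> back_edges S"
    using sub op by (auto simp: fwd_edges_def back_edges_def)
  then have "feasible (Cl i1 i2)"
    using f op unfolding feasible_def by (meson acyclic_subset)
  then show "cf i1 i2 \<and> i1 \<notin> Cl i1 i2 \<and> i2 \<notin> Cl i1 i2 \<and> feasible (Cl i1 i2)"
    using c l sub by (auto simp: lock_closed_def)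
next
  assume a: "cf i1 i2 \<and> i1 \<notin> Cl i1 i2 \<and> i2 \<notin> Cl i1 i2 \<and> feasible (Cl i1 i2)"
  obtain \<pi> where "sublist_ix \<pi>" "set \<pi> = Cl i1 i2" "reorders \<pi>"
    using reorders_if_feasible[OF dep_closed_Cl[OF i]] a by blast
  moreover have "lock_closed i1 i2 (Cl i1 i2)"
    unfolding lock_closed_def using a dep_closed_Cl[OF i] by (auto intro: Cl.intros)
  ultimately show "osr_race \<sigma> (\<sigma> ! i1) (\<sigma> ! i2)"
    using osr_race_reorders[OF i] a by metis
qed

theorem has_osr_race_ix:
  "has_osr_race \<sigma> \<longleftrightarrow> (\<exists>i1<n. \<exists>i2<n.
    cf i1 i2 \<and> i1 \<notin> Cl i1 i2 \<and> i2 \<notin> Cl i1 i2 \<and> feasible (Cl i1 i2))"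
proof -
  have "has_osr_race \<sigma> \<longleftrightarrow> (\<exists>i1<n. \<exists>i2<n. osr_race \<sigma> (\<sigma> ! i1) (\<sigma> ! i2))"
    unfolding has_osr_race_def
    by (metis in_set_conv_nth osr_race_def)
  then show ?thesis using osr_race_ix by auto
qed

end

section \<open>Weakest preconditions with running time\<close>

text \<open>Total correctness in which the postcondition also sees the exact number of steps. For
  loop-free commands the rules are equations, so straight-line code is handled by rewriting.\<close>

definition wp :: "com \<Rightarrow> (nat \<Rightarrow> store \<Rightarrow> bool) \<Rightarrow> store \<Rightarrow> bool" where
  "wp c Q s \<longleftrightarrow> (\<exists>t s'. run c s t s' \<and> Q t s')"

text \<open>A constant of its own, so that \<open>simp\<close> resolves an access by comparing array
  numbers first.\<close>

definition upd :: "store \<Rightarrow> nat \<Rightarrow> nat \<Rightarrow> nat \<Rightarrow> store" where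
  "upd s a i v = s(a := (s a)(i := v))"

lemma upd_same [simp]: "upd s a i v a = (s a)(i := v)"
  and upd_other [simp]: "b \<noteq> a \<Longrightarrow> upd s a i v b = s b"
  by (simp_all add: upd_def)

lemma run_Skip_iff: "run Skip s t s' \<longleftrightarrow> t = 1 \<and> s' = s"
  by (auto elim: run.cases intro: run.Skip[simplified])

lemma run_Store_iff:
  "run (Store a i e) s t s' \<longleftrightarrow> t = 1 + acost i + acost e \<and> s' = upd s a (aval i s) (aval e s)"
  unfolding upd_def by (auto elim: run.cases intro: run.Store[simplified])

lemma run_Seq_iff:
  "run (Seq c d) s t s' \<longleftrightarrow> (\<exists>t1 t2 s1. run c s t1 s1 \<and> run d s1 t2 s' \<and> t = t1 + t2)"
proof
  assume "run (Seq c d) s t s'"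
  then show "\<exists>t1 t2 s1. run c s t1 s1 \<and> run d s1 t2 s' \<and> t = t1 + t2" by cases blast+
qed (auto intro: run.Seq)

lemma run_If_iff:
  "run (If b c d) s t s' \<longleftrightarrow> (\<exists>u. run (if bval b s then c else d) s u s' \<and> t = 1 + bcost b + u)"
  by (auto elim: run.cases intro: run.IfTrue[simplified] run.IfFalse[simplified])

lemma wp_Skip [simp]: "wp Skip Q s \<longleftrightarrow> Q 1 s"
  unfolding wp_def run_Skip_iff by blast

lemma wp_Store [simp]:
  "wp (Store a i e) Q s \<longleftrightarrow> Q (1 + acost i + acost e) (upd s a (aval i s) (aval e s))"
  unfolding wp_def run_Store_iff by blast

lemma wp_Seq [simp]: "wp (Seq c d) Q s \<longleftrightarrow> wp c (\<lambda>t. wp d (\<lambda>u. Q (t + u))) s"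
  unfolding wp_def run_Seq_iff by blast

lemma wp_If [simp]:
  "wp (If b c d) Q s \<longleftrightarrow>
     (bval b s \<longrightarrow> wp c (\<lambda>t. Q (1 + bcost b + t)) s) \<and>
     (\<not> bval b s \<longrightarrow> wp d (\<lambda>t. Q (1 + bcost b + t)) s)"
  unfolding wp_def run_If_iff by (cases "bval b s") auto

fun mods :: "com \<Rightarrow> nat set" where
  "mods Skip = {}"
| "mods (Store a i e) = {a}"
| "mods (Seq c d) = mods c \<union> mods d"
| "mods (If b c d) = mods c \<union> mods d"
| "mods (While b c) = mods c"

text \<open>Frames consist of whole arrays. This is precise enough, as each scalar has an array of
  its own.\<close>

definition agree :: "nat set \<Rightarrow> store \<Rightarrow> store \<Rightarrow> bool" where
  "agree A s s' \<longleftrightarrow> (\<forall>a. a \<notin> A \<longrightarrow> s' a = s a)"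

lemma agreeD: "agree A s s' \<Longrightarrow> a \<notin> A \<Longrightarrow> s' a = s a"
  by (simp add: agree_def)

lemma agree_refl [simp]: "agree A s s"
  by (simp add: agree_def)

lemma agree_trans: "agree A s s' \<Longrightarrow> agree B s' s'' \<Longrightarrow> A \<union> B \<subseteq> C \<Longrightarrow> agree C s s''"
  unfolding agree_def by (metis UnI1 UnI2 subsetD)

lemma agree_upd [simp]: "a \<in> A \<Longrightarrow> agree A s (upd s' a i v) \<longleftrightarrow> agree A s s'"
  by (auto simp: agree_def upd_def)

lemma run_agree: "run c s t s' \<Longrightarrow> agree (mods c) s s'"
  by (induction rule: run.induct) (auto simp: agree_def)

text \<open>A consequence rule that supplies the frame as an extra fact; its uses read off from it
  which arrays a subprogram leaves alone.\<close>

lemma wp_use: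
  assumes "wp c P s" and "\<And>t s'. P t s' \<Longrightarrow> agree (mods c) s s' \<Longrightarrow> Q t s'"
  shows "wp c Q s"
  using assms run_agree unfolding wp_def by blast

text \<open>The potential \<open>\<Phi>\<close> is termination measure and time bound at once: it
  pays for guard and body of each iteration, and since an iteration takes at least one step, it
  strictly decreases.\<close>

lemma wp_While:
  assumes "I s"
    and "\<And>s. I s \<Longrightarrow> bval b s \<Longrightarrow> wp c (\<lambda>t s'. I s' \<and> 1 + bcost b + t + \<Phi> s' \<le> \<Phi> s) s"
  shows "wp (While b c) (\<lambda>t s'. I s' \<and> \<not> bval b s' \<and> t \<le> \<Phi> s + 1 + bcost b) s"
  using assms(1)
proof (induction "\<Phi> s" arbitrary: s rule: less_induct)
  case less
  show ?case
  proof (cases "bval b s")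
    case False
    then show ?thesis
      unfolding wp_def using less.prems run.WhileFalse by (intro exI[of _ "1 + bcost b"] exI[of _ s]) auto
  next
    case True
    obtain t s' where r: "run c s t s'" "I s'" "1 + bcost b + t + \<Phi> s' \<le> \<Phi> s"
      using assms(2)[OF less.prems True] by (auto simp: wp_def)
    then have "wp (While b c) (\<lambda>t s''. I s'' \<and> \<not> bval b s'' \<and> t \<le> \<Phi> s' + 1 + bcost b) s'"
      by (intro less.hyps) auto
    then obtain u s'' where "run (While b c) s' u s''" "I s''" "\<not> bval b s''" "u \<le> \<Phi> s' + 1 + bcost b"
      by (auto simp: wp_def)
    then show ?thesis
      unfolding wp_def using run.WhileTrue[OF True r(1)] r(3)
      by (intro exI[of _ "1 + bcost b + t + u"] exI[of _ s'']) auto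
  qed
qed

abbreviation V :: "nat \<Rightarrow> aexp" where "V x \<equiv> Load x (Const 0)"
abbreviation Set :: "nat \<Rightarrow> aexp \<Rightarrow> com" where "Set x e \<equiv> Store x (Const 0) e"

text \<open>The bound is evaluated again before every iteration; therefore \<open>wp_For\<close>
  asks that its value be \<open>N\<close> in all stores that the loop can reach.\<close>

definition For :: "nat \<Rightarrow> aexp \<Rightarrow> com \<Rightarrow> com" where
  "For v ub c = Seq (Set v (Const 0))
     (While (Less (V v) ub) (Seq c (Set v (Add (V v) (Const 1)))))"

lemma mods_For [simp]: "mods (For v ub c) = insert v (mods c)"
  by (auto simp: For_def)

text \<open>A bound of the form constant times size makes the sizes of nested loops multiply while
  their constants only add up.\<close>

lemma wp_For:
  fixes K X :: nat
  assumes v: "v \<notin> mods c"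
    and ub: "\<And>s. agree (insert v (mods c)) s0 s \<Longrightarrow> aval ub s = N"
    and init: "I 0 (upd s0 v 0 0)"
    and body: "\<And>k s. k < N \<Longrightarrow> I k s \<Longrightarrow> s v 0 = k \<Longrightarrow> agree (insert v (mods c)) s0 s \<Longrightarrow>
      wp c (\<lambda>t s'. I (Suc k) (upd s' v 0 (Suc k)) \<and> t \<le> K * X) s"
    and X: "1 \<le> X" and cost: "acost ub \<le> 8"
  shows "wp (For v ub c) (\<lambda>t s'. I N s' \<and> t \<le> (K + 20) * (Suc N * X)) s0"
proof -
  let ?J = "\<lambda>s. s v 0 \<le> N \<and> I (s v 0) s \<and> agree (insert v (mods c)) s0 s"
  \<comment> \<open>Besides the body, an iteration pays at most 12 steps for the guard, as
    \<open>ub\<close> costs at most 8, and 6 steps for the increment.\<close>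
  let ?\<Phi> = "\<lambda>s::store. (N - s v 0) * (K * X + 20)"
  have "wp (While (Less (V v) ub) (Seq c (Set v (Add (V v) (Const 1)))))
      (\<lambda>t s'. ?J s' \<and> \<not> bval (Less (V v) ub) s' \<and> t \<le> ?\<Phi> (upd s0 v 0 0) + 1 + bcost (Less (V v) ub))
      (upd s0 v 0 0)"
  proof (rule wp_While)
    show "?J (upd s0 v 0 0)" using init by simp
    fix s assume J: "?J s" and b: "bval (Less (V v) ub) s"
    have k: "s v 0 < N" using b ub[of s] J by simp
    have "wp c (\<lambda>t s'. I (Suc (s v 0)) (upd s' v 0 (Suc (s v 0))) \<and> t \<le> K * X) s"
      using body[OF k] J by simp
    then show "wp (Seq c (Set v (Add (V v) (Const 1))))
      (\<lambda>t s'. ?J s' \<and> 1 + bcost (Less (V v) ub) + t + ?\<Phi> s' \<le> ?\<Phi> s) s"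
      unfolding wp_Seq
    proof (rule wp_use)
      fix t s' assume p: "I (Suc (s v 0)) (upd s' v 0 (Suc (s v 0))) \<and> t \<le> K * X"
        and a: "agree (mods c) s s'"
      have sv: "s' v = s v" using agreeD[OF a v] .
      have a': "agree (insert v (mods c)) s0 s'"
        using agree_trans[OF _ a, of "insert v (mods c)" s0] J by auto
      have "N - s v 0 = Suc (N - Suc (s v 0))" using k by simp
      then have "?\<Phi> s = K * X + 20 + (N - Suc (s v 0)) * (K * X + 20)" by simp
      then show "wp (Set v (Add (V v) (Const 1))) (\<lambda>u s'. ?J s' \<and>
          1 + bcost (Less (V v) ub) + (t + u) + ?\<Phi> s' \<le> ?\<Phi> s) s'"
        using p a' sv k cost by simp
    qed
  qed
  then show ?thesis
    unfolding For_def wp_Seq wp_Store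
  proof (simp, elim wp_use, goal_cases)
    case (1 t s')
    then have "s' v 0 = N" using ub[of s'] by auto
    moreover have "N * (K * X + 20) + 25 \<le> (K + 20) * (Suc N * X) + 5"
      using X by (cases X) (auto simp: algebra_simps)
    ultimately show ?case using 1 cost by auto
  qed
qed

section \<open>Tables and search invariants\<close>

text \<open>Here \<open>k\<close> counts the positions scanned from the end. The recursion mirrors a
  loop that runs downwards and overwrites its result, so that the least hit remains;
  \<open>m\<close> means that there is none.\<close>

fun fmin :: "(nat \<Rightarrow> bool) \<Rightarrow> nat \<Rightarrow> nat \<Rightarrow> nat" where
  "fmin P m 0 = m"
| "fmin P m (Suc k) = (if P (m - Suc k) then m - Suc k else fmin P m k)"

text \<open>The counterpart for loops that run upwards, where the greatest hit remains. The result
  is shifted by one, so that the initial value 0 means none.\<close>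

fun flast :: "(nat \<Rightarrow> bool) \<Rightarrow> nat \<Rightarrow> nat" where
  "flast P 0 = 0"
| "flast P (Suc k) = (if P k then Suc k else flast P k)"

lemma fmin_sat: "fmin P m k < m \<Longrightarrow> P (fmin P m k)"
  by (induction k) (auto split: if_splits)

lemma fmin_least: "k \<le> m \<Longrightarrow> m - k \<le> r \<Longrightarrow> r < m \<Longrightarrow> P r \<Longrightarrow> fmin P m k \<le> r"
proof (induction k)
  case (Suc k)
  show ?case
  proof (cases "P (m - Suc k)")
    case False
    then have "r \<noteq> m - Suc k" using Suc.prems by auto
    then show ?thesis using Suc False by simp
  qed (use Suc in simp)
qed simp

lemma fmin_eq_iff:
  assumes "r < m"
  shows "fmin P m m = r \<longleftrightarrow> P r \<and> (\<forall>k<r. \<not> P k)"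
proof
  assume e: "fmin P m m = r"
  have "\<not> P k" if "k < r" for k
    using fmin_least[of m m k P] that e assms by auto
  then show "P r \<and> (\<forall>k<r. \<not> P k)" using fmin_sat[of P m m] e assms by auto
next
  assume a: "P r \<and> (\<forall>k<r. \<not> P k)"
  then have "fmin P m m \<le> r" using fmin_least[of m m r P] assms by auto
  moreover have "P (fmin P m m)" using fmin_sat[of P m m] calculation assms by auto
  ultimately show "fmin P m m = r" using a by (metis le_neq_implies_less)
qed

lemma flast_le: "flast P k \<le> k"
  by (induction k) auto

lemma flast_eq_Suc_iff: "flast P k = Suc a \<longleftrightarrow> a < k \<and> P a \<and> (\<forall>i. a < i \<and> i < k \<longrightarrow> \<not> P i)"
  by (induction k) (auto simp: less_Suc_eq)

lemma flast_less: "i < k \<Longrightarrow> P i \<Longrightarrow> i < flast P k"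
  by (induction k) (auto simp: less_Suc_eq)

text \<open>Threads and locks are now numbered consecutively. By \<open>T \<le> n\<close> and
  \<open>L \<le> n\<close> their numbers can serve as digits in base \<open>Suc n\<close>, which
  keeps the addresses of table cells apart.\<close>

locale coded_trace = indexed_trace +
  fixes lk :: "nat \<Rightarrow> nat" and T L :: nat
  assumes tn_less: "i < n \<Longrightarrow> tn i < T"
    and lk_less: "i < n \<Longrightarrow> 2 \<le> oc i \<Longrightarrow> lk i < L"
    and lk_eq_iff: "i < n \<Longrightarrow> j < n \<Longrightarrow> 2 \<le> oc i \<Longrightarrow> 2 \<le> oc j \<Longrightarrow> lk i = lk j \<longleftrightarrow> od i = od j"
    and T_le: "T \<le> n" and L_le: "L \<le> n"
begin

text \<open>In \<open>M\<close>, \<open>SU\<close> and \<open>RM\<close> the value \<open>n\<close> means that there is no such event; the values of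
  \<open>RF\<close>, \<open>LA\<close> and \<open>LR\<close> are shifted by 1, so that 0 means this.\<close>

definition M :: "nat \<Rightarrow> nat" where
  "M a = fmin (\<lambda>r. a < r \<and> oc a = 2 \<and> oc r = 3 \<and> od r = od a) n n"

definition RF :: "nat \<Rightarrow> nat" where
  "RF i = flast (\<lambda>j. oc i = 0 \<and> oc j = 1 \<and> od j = od i) i"

definition LA :: "nat \<Rightarrow> nat \<Rightarrow> nat \<Rightarrow> nat" where
  "LA q t l = flast (\<lambda>i. oc i = 2 \<and> tn i = t \<and> lk i = l) q"

definition LR :: "nat \<Rightarrow> nat \<Rightarrow> nat \<Rightarrow> nat" where
  "LR q t l = flast (\<lambda>i. oc i = 3 \<and> tn i = t \<and> lk i = l) q"

definition SU :: "nat \<Rightarrow> nat \<Rightarrow> nat" where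
  "SU i t = fmin (\<lambda>r. fwd i r \<and> tn r = t) n n"

text \<open>A running minimum of \<open>SU\<close> over the events of the thread of \<open>p\<close>
  from \<open>p\<close> up to but excluding \<open>q\<close>: one lookup covers all forward edges
  that leave a whole interval of a thread, and each new cell of a row takes constant work.\<close>

fun RM :: "nat \<Rightarrow> nat \<Rightarrow> nat \<Rightarrow> nat" where
  "RM p 0 t = n"
| "RM p (Suc q) t = (if p \<le> q \<and> tn q = tn p \<and> SU q t < RM p q t then SU q t else RM p q t)"

text \<open>The entries of a vector bound trace indices, they do not count events; hence a set has
  several vectors.\<close>

definition vec :: "(nat \<Rightarrow> nat) \<Rightarrow> nat set \<Rightarrow> bool" where
  "vec v S \<longleftrightarrow> S \<subseteq> {..<n} \<and> (\<forall>t<T. v t \<le> n) \<and> (\<forall>f<n. f \<in> S \<longleftrightarrow> f < v (tn f))"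

lemma vecD: "vec v S \<Longrightarrow> f < n \<Longrightarrow> f \<in> S \<longleftrightarrow> f < v (tn f)"
  by (simp add: vec_def)

lemma vec_le: "vec v S \<Longrightarrow> t < T \<Longrightarrow> v t \<le> n"
  by (simp add: vec_def)

lemma vec_Un: "vec v S \<Longrightarrow> vec w S' \<Longrightarrow> vec (\<lambda>t. max (v t) (w t)) (S \<union> S')"
  by (auto simp: vec_def)

lemma vec_cong: "vec v S \<Longrightarrow> (\<And>t. t < T \<Longrightarrow> w t = v t) \<Longrightarrow> vec w S"
  using tn_less by (auto simp: vec_def)

lemma vec_empty: "vec (\<lambda>t. 0) {}"
  by (simp add: vec_def)

lemma M_iff: "a < n \<Longrightarrow> mt a r \<longleftrightarrow> M a = r \<and> r < n"
proof (cases "r < n")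
  case True
  show ?thesis unfolding M_def using True by (auto simp: fmin_eq_iff mt_def)
qed (auto simp: mt_def)

lemma RF_iff: "rfr j i \<longleftrightarrow> RF i = Suc j"
  unfolding RF_def flast_eq_Suc_iff rfr_def by auto

lemma SU_le: "fwd i g \<Longrightarrow> g < n \<Longrightarrow> SU i (tn g) \<le> g"
  unfolding SU_def by (rule fmin_least) auto

lemma SU_sat: "SU i t < n \<Longrightarrow> fwd i (SU i t) \<and> tn (SU i t) = t"
  unfolding SU_def by (rule fmin_sat)

lemma RM_le: "p \<le> f \<Longrightarrow> f < q \<Longrightarrow> tn f = tn p \<Longrightarrow> RM p q t \<le> SU f t"
  by (induction q) (auto simp: less_Suc_eq not_less intro: order_trans)

lemma RM_cases: "RM p q t = n \<or> (\<exists>f. p \<le> f \<and> f < q \<and> tn f = tn p \<and> RM p q t = SU f t)"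
  by (induction q) (auto simp: less_Suc_eq)

lemma RM_le_n: "RM p q t \<le> n"
  by (induction q) auto

text \<open>Forward edges lead to strictly later events. In the search this plays the part of
  positive edge weights.\<close>

lemma RM_greater: "p < n \<Longrightarrow> p < RM p q t"
proof -
  assume p: "p < n"
  have "f < SU f t" if "p \<le> f" "SU f t < n" for f using SU_sat[OF that(2)] by (simp add: fwd_def)
  then show ?thesis using RM_cases[of p q t] p by (metis le_less_trans linorder_neqE_nat RM_le_n not_less)
qed

subsection \<open>The least candidate set\<close>

text \<open>The last conjunct asks for containment in the closures of all remaining second events of
  the thread, not only of the current one. This is what allows the set to be kept when
  \<open>j\<close> advances.\<close>

definition sweep :: "nat \<Rightarrow> nat \<Rightarrow> nat \<Rightarrow> nat set \<Rightarrow> bool" where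
  "sweep i1 t2 j S \<longleftrightarrow> dep_closed S \<and> (\<forall>i<i1. tn i = tn i1 \<longrightarrow> i \<in> S) \<and>
     (\<forall>i<j. tn i = t2 \<longrightarrow> i \<in> S) \<and> (\<forall>j'<n. j \<le> j' \<and> tn j' = t2 \<longrightarrow> S \<subseteq> Cl i1 j')"

lemma dep_closed_Un: "dep_closed S \<Longrightarrow> dep_closed S' \<Longrightarrow> dep_closed (S \<union> S')"
  by (auto simp: dep_closed_def)

lemma sweep_init:
  assumes "i1 < n" shows "sweep i1 t2 0 (\<Union>i\<in>{i. i < i1 \<and> tn i = tn i1}. TRC i)"
  unfolding sweep_def
proof (intro conjI allI impI)
  show "dep_closed (\<Union>i\<in>{i. i < i1 \<and> tn i = tn i1}. TRC i)"
    using assms dep_closed_TRC unfolding dep_closed_def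
    by (auto intro: less_trans)
  fix j' assume j': "j' < n" "0 \<le> j' \<and> tn j' = t2"
  have "TRC i \<subseteq> Cl i1 j'" if "i < i1" "tn i = tn i1" for i
    using that by (intro TRC_subset dep_closed_Cl assms j' Cl.left)
  then show "(\<Union>i\<in>{i. i < i1 \<and> tn i = tn i1}. TRC i) \<subseteq> Cl i1 j'" by blast
qed (use TRC_refl in auto)

text \<open>A release forced for \<open>j\<close> is forced for every later \<open>j'\<close> of the
  thread: if \<open>TRC r\<close> contained \<open>j'\<close>, it would contain \<open>j\<close> as
  well.\<close>

lemma sweep_add:
  assumes "sweep i1 t2 j S" "i1 < n" "j < n" "tn j = t2" "a \<in> S" "mt a r" "i1 \<notin> TRC r" "j \<notin> TRC r"
  shows "sweep i1 t2 j (S \<union> TRC r)"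
proof -
  have r: "r < n" using assms by (simp add: mt_def)
  have "TRC r \<subseteq> Cl i1 j'" if "j' < n" "j \<le> j'" "tn j' = t2" for j'
  proof -
    have "j' \<notin> TRC r"
    proof
      assume "j' \<in> TRC r"
      then have "j \<in> TRC r"
        using dep_closedD[OF dep_closed_TRC[OF r], of j' j] that assms
        by (cases "j = j'") (auto simp: dep_def)
      then show False using assms by simp
    qed
    then have "r \<in> Cl i1 j'" using that assms Cl.rel[of a i1 j' r] by (auto simp: sweep_def)
    then show ?thesis using TRC_subset dep_closed_Cl assms that by blast
  qed
  then show ?thesis
    using assms dep_closed_Un[OF _ dep_closed_TRC[OF r]] by (auto simp: sweep_def)
qed

lemma sweep_skip:
  assumes "sweep i1 t2 j S" "tn j \<noteq> t2"
  shows "sweep i1 t2 (Suc j) S"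
  using assms by (auto simp: sweep_def less_Suc_eq)

text \<open>The invariant places \<open>S\<close> inside \<open>Cl i1 j\<close>, and the absence of
  a missing forced release gives the other inclusion. For the later events of the thread
  \<open>j\<close> is a predecessor, so its closure may be added.\<close>

lemma sweep_done:
  assumes s: "sweep i1 t2 j S" and i: "i1 < n" "j < n" "tn j = t2"
    and no: "\<And>a r. a \<in> S \<Longrightarrow> mt a r \<Longrightarrow> i1 \<notin> TRC r \<Longrightarrow> j \<notin> TRC r \<Longrightarrow> r \<in> S"
  shows "S = Cl i1 j" and "sweep i1 t2 (Suc j) (S \<union> TRC j)"
proof -
  show "S = Cl i1 j"
  proof
    show "S \<subseteq> Cl i1 j" using s i by (auto simp: sweep_def)
    show "Cl i1 j \<subseteq> S"
    proof
      fix x assume "x \<in> Cl i1 j"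
      then show "x \<in> S"
        by induction (use s i no in \<open>auto simp: sweep_def dest: dep_closedD\<close>)
    qed
  qed
  have "TRC j \<subseteq> Cl i1 j'" if "j' < n" "Suc j \<le> j'" "tn j' = t2" for j'
    using that i by (intro TRC_subset dep_closed_Cl Cl.right) auto
  then show "sweep i1 t2 (Suc j) (S \<union> TRC j)"
    using s dep_closed_Un[OF _ dep_closed_TRC[OF i(2)]] TRC_refl[of j]
    by (auto simp: sweep_def less_Suc_eq)
qed

lemma LA_eq_Suc:
  "LA q t l = Suc a \<longleftrightarrow> a < q \<and> oc a = 2 \<and> tn a = t \<and> lk a = l \<and>
     (\<forall>i. a < i \<and> i < q \<longrightarrow> \<not> (oc i = 2 \<and> tn i = t \<and> lk i = l))"
  unfolding LA_def flast_eq_Suc_iff by simp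

lemma LR_eq_Suc:
  "LR q t l = Suc a \<longleftrightarrow> a < q \<and> oc a = 3 \<and> tn a = t \<and> lk a = l \<and>
     (\<forall>i. a < i \<and> i < q \<longrightarrow> \<not> (oc i = 3 \<and> tn i = t \<and> lk i = l))"
  unfolding LR_def flast_eq_Suc_iff by simp

text \<open>Hence looking up one acquire per thread and lock finds every missing release.\<close>

lemma LA_unmatched:
  assumes S: "vec v S" and cl: "dep_closed S" and a: "a \<in> S" "oc a = 2" "\<And>r. r \<in> S \<Longrightarrow> \<not> mt a r"
  shows "LA (v (tn a)) (tn a) (lk a) = Suc a"
proof -
  have an: "a < n" using cl a dep_closed_less by blast
  \<comment> \<open>If the thread acquired the lock again inside \<open>S\<close>, alternation would
    put a release in between. So the release of \<open>a\<close> exists, lies before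
    \<open>i\<close> in the same thread, and is in \<open>S\<close> by closure.\<close>
  have "\<not> (oc i = 2 \<and> tn i = tn a \<and> lk i = lk a)" if i: "a < i" "i < v (tn a)" for i
  proof
    assume o: "oc i = 2 \<and> tn i = tn a \<and> lk i = lk a"
    have "i < n" using i vec_le[OF S tn_less[OF an]] by simp
    then have d: "od i = od a" using lk_eq_iff[of i a] o a an by simp
    have iS: "i \<in> S" using vecD[OF S \<open>i < n\<close>] i o by simp
    obtain k where k: "a < k" "k < i" "2 \<le> oc k" "oc k \<noteq> oc a" "od k = od a"
      using lock_alternates[of a i] i d o a \<open>i < n\<close> by auto
    then have k3: "oc k = 3" using oc_cases[of k] a by auto
    define r where "r = M a"
    have "r \<le> k" unfolding r_def M_def
      using k k3 a \<open>i < n\<close> by (intro fmin_least) auto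
    then have r: "mt a r" using M_iff[OF an, of r] k \<open>i < n\<close> r_def by simp
    have "dep r i" using mt_thread[OF r] o \<open>r \<le> k\<close> k \<open>i < n\<close> by (simp add: dep_def)
    then have "r \<in> S" using dep_closedD[OF cl iS] by blast
    then show False using a(3) r by blast
  qed
  then show ?thesis
    unfolding LA_eq_Suc using vecD[OF S an] a by auto
qed

subsection \<open>Reachability along forward edges\<close>

definition reaches :: "nat set \<Rightarrow> nat \<Rightarrow> nat \<Rightarrow> bool" where
  "reaches C b g \<longleftrightarrow> (b, g) \<in> (fwd_edges C)\<^sup>*"

text \<open>Within a dependency-closed set, reachability passes to all later events of a thread, so
  one lower bound per thread describes it.\<close>

definition reach_vec :: "nat set \<Rightarrow> nat \<Rightarrow> (nat \<Rightarrow> nat) \<Rightarrow> bool" where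
  "reach_vec C b R \<longleftrightarrow> (\<forall>g\<in>C. reaches C b g \<longleftrightarrow> R (tn g) \<le> g)"

text \<open>\<open>D\<close> is the set of finished threads, and \<open>R t\<close> is the
  earliest event of thread \<open>t\<close> known to be reachable from \<open>b\<close>.\<close>

definition search :: "nat set \<Rightarrow> (nat \<Rightarrow> nat) \<Rightarrow> nat \<Rightarrow> (nat \<Rightarrow> nat) \<Rightarrow> nat set \<Rightarrow> bool" where
  "search C v b R D \<longleftrightarrow>
     (\<forall>t<T. R t \<le> n \<and> (R t < n \<longrightarrow> tn (R t) = t) \<and> (R t < v t \<longrightarrow> reaches C b (R t))) \<and>
     R (tn b) \<le> b \<and>
     (\<forall>t\<in>D. \<forall>t'<T. t' \<notin> D \<longrightarrow> R t \<le> R t') \<and>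
     (\<forall>t\<in>D. R t < v t \<longrightarrow> (\<forall>t'<T. R t' \<le> RM (R t) (v t) t')) \<and> D \<subseteq> {..<T}"

lemma search_init:
  assumes "vec v C" "b \<in> C"
  shows "search C v b (\<lambda>t. if t = tn b then b else n) {}"
proof -
  have "b < n" using assms by (auto simp: vec_def)
  moreover have "\<not> n < v t" if "t < T" for t using vec_le[OF assms(1) that] by simp
  ultimately show ?thesis using assms by (auto simp: search_def reaches_def)
qed

lemma reaches_thread:
  assumes C: "dep_closed C" and "f \<in> C" "p \<le> f" "tn p = tn f" shows "reaches C p f"
proof (cases "p = f")
  case False
  then have pf: "p < f" using assms by simp
  then have "dep p f" using assms dep_closed_less[OF C] by (simp add: dep_def)
  then have "p \<in> C" using dep_closedD[OF C] assms by blast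
  then show ?thesis using pf assms by (auto simp: reaches_def fwd_edges_def fwd_def intro!: r_into_rtrancl)
qed (simp add: reaches_def)

text \<open>The step of Dijkstra's algorithm, with threads as nodes and trace indices as distances.
  All edges leaving thread \<open>u\<close> from \<open>R u\<close> on are relaxed together through
  \<open>RM\<close>.\<close>

lemma search_step:
  assumes s: "search C v b R D" and C: "vec v C" "dep_closed C"
    and u: "u < T" "u \<notin> D" "\<And>t. t < T \<Longrightarrow> t \<notin> D \<Longrightarrow> R u \<le> R t"
    and R': "\<And>t. t < T \<Longrightarrow> R' t = (if R u < v u then min (R t) (RM (R u) (v u) t) else R t)"
    and b: "b \<in> C"
  shows "search C v b R' (insert u D)"
proof -
  have bn: "b < n" "tn b < T" using b C tn_less by (auto simp: vec_def)
  have DT: "D \<subseteq> {..<T}" using s by (simp add: search_def)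
  have gr: "R u < RM (R u) (v u) t" if "R u < v u" for t
    using RM_greater that vec_le[OF C(1) u(1)] by (meson less_le_trans)
  \<comment> \<open>Finished threads have bounds at most \<open>R u\<close>, while relaxation only
    offers values above \<open>R u\<close>.\<close>
  have same: "R' t = R t" if "t \<in> insert u D" for t
  proof -
    have "R t \<le> R u" "t < T" using that s u DT by (auto simp: search_def)
    then show ?thesis using R' gr[of t] by (auto simp: min_def)
  qed
  have le: "R' t \<le> R t" if "t < T" for t using R'[OF that] by auto
  have ok: "R' t \<le> n \<and> (R' t < n \<longrightarrow> tn (R' t) = t) \<and> (R' t < v t \<longrightarrow> reaches C b (R' t))" if t: "t < T" for t
  proof (cases "R' t = R t")
    case True
    then show ?thesis using s t by (simp add: search_def)
  next
    case False
    then have uv: "R u < v u" and e: "R' t = RM (R u) (v u) t" and lt: "R' t < R t"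
      using R'[OF t] by (auto simp: min_def split: if_splits)
    have Rn: "R t \<le> n" "R u \<le> n" using s t u by (auto simp: search_def)
    have un: "R u < n" using uv vec_le[OF C(1) u(1)] by simp
    have ru: "tn (R u) = u" "reaches C b (R u)" using s u un uv by (auto simp: search_def)
    obtain f where f: "R u \<le> f" "f < v u" "tn f = tn (R u)" "R' t = SU f t"
      using RM_cases[of "R u" "v u" t] e lt Rn by auto
    have fn: "f < n" using f vec_le[OF C(1) u(1)] by simp
    have fC: "f \<in> C" using vecD[OF C(1) fn] f ru by simp
    have g: "fwd f (R' t)" "tn (R' t) = t" using SU_sat[of f t] f lt Rn by auto
    have "reaches C b (R' t)" if "R' t < v t"
    proof -
      have "R' t \<in> C" using vecD[OF C(1), of "R' t"] g that lt Rn by simp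
      then have "reaches C f (R' t)" using g fC by (auto simp: reaches_def fwd_edges_def)
      moreover have "reaches C (R u) f" using reaches_thread[OF C(2) fC] f by simp
      ultimately show ?thesis using ru by (auto simp: reaches_def)
    qed
    then show ?thesis using g lt Rn by simp
  qed
  have "R' (tn b) \<le> b" using le[OF bn(2)] s by (simp add: search_def)
  moreover have "R' t \<le> R' t'" if "t \<in> insert u D" "t' < T" "t' \<notin> insert u D" for t t'
  proof -
    have "R t \<le> R u" "R u \<le> R t'" using that s u by (auto simp: search_def)
    then show ?thesis using same[OF that(1)] R'[OF that(2)] gr[of t'] by (auto simp: min_def)
  qed
  moreover have "R' t' \<le> RM (R' t) (v t) t'" if "t \<in> insert u D" "R' t < v t" "t' < T" for t t'
  proof (cases "t = u")
    case True
    then show ?thesis using same[OF that(1)] that R'[OF that(3)] by auto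
  next
    case False
    then have "R t' \<le> RM (R t) (v t) t'" using that same[OF that(1)] s by (auto simp: search_def)
    then show ?thesis using same[OF that(1)] le[OF that(3)] by simp
  qed
  ultimately show ?thesis using ok DT u unfolding search_def by blast
qed

text \<open>Along a path the bounds never exceed its events: if \<open>R (tn f) \<le> f\<close>,
  then \<open>f\<close> lies in the interval covered by \<open>RM\<close>, which therefore is at
  most the end of the next edge.\<close>

lemma search_done:
  assumes s: "search C v b R {..<T}" and C: "vec v C" "dep_closed C" and b: "b \<in> C"
  shows "reach_vec C b R"
  unfolding reach_vec_def
proof (intro ballI iffI)
  fix g assume g: "g \<in> C"
  have gn: "g < n" using C g by (auto simp: vec_def)
  {
    assume "reaches C b g"
    then have "(b, g) \<in> (fwd_edges C)\<^sup>*" by (simp add: reaches_def)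
    then show "R (tn g) \<le> g"
    proof induction
      case base
      then show ?case using s by (simp add: search_def)
    next
      case (step f g)
      then have f: "f \<in> C" "g \<in> C" "fwd f g" by (auto simp: fwd_edges_def)
      have fn: "f < n" "g < n" using f C by (auto simp: vec_def)
      have lt: "R (tn f) < v (tn f)" using step.IH vecD[OF C(1) fn(1)] f by simp
      have t: "tn (R (tn f)) = tn f"
        using s tn_less[OF fn(1)] step.IH fn by (auto simp: search_def)
      have "R (tn g) \<le> RM (R (tn f)) (v (tn f)) (tn g)"
        using s lt tn_less[OF fn(1)] tn_less[OF fn(2)] by (auto simp: search_def)
      also have "\<dots> \<le> SU f (tn g)" using RM_le step.IH t vecD[OF C(1) fn(1)] f by simp
      also have "\<dots> \<le> g" using SU_le f fn by simp
      finally show ?case .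
    qed
  }
  assume le: "R (tn g) \<le> g"
  then have "R (tn g) < v (tn g)" using vecD[OF C(1) gn] g by simp
  then have "reaches C b (R (tn g))" "tn (R (tn g)) = tn g"
    using s tn_less[OF gn] le gn by (auto simp: search_def)
  then show "reaches C b g"
    using reaches_thread[OF C(2) g le] by (auto simp: reaches_def)
qed

subsection \<open>The lock graph\<close>

text \<open>An edge to \<open>l'\<close> requires an open acquire of \<open>l'\<close>, as only open
  acquires are entered by back edges.\<close>

definition lock_graph :: "nat set \<Rightarrow> nat rel" where
  "lock_graph C = {(l, l'). \<exists>b b' r. open_acq C b \<and> lk b = l \<and> open_acq C b' \<and> lk b' = l' \<and>
     r \<in> C \<and> oc r = 3 \<and> lk r = l' \<and> reaches C b r}"

lemma trancl_Un_cases: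
  "(x, y) \<in> (A \<union> B)\<^sup>+ \<Longrightarrow> (x, y) \<in> A\<^sup>+ \<or> (\<exists>(r, b) \<in> B. (x, r) \<in> (A \<union> B)\<^sup>* \<and> (b, y) \<in> (A \<union> B)\<^sup>*)"
proof (induction rule: trancl_induct)
  case (base y)
  then show ?case by blast
next
  case (step y z)
  show ?case
  proof (cases "(y, z) \<in> B")
    case True
    then show ?thesis using step.hyps(1) trancl_into_rtrancl by fastforce
  next
    case False
    then have A: "(y, z) \<in> A" using step.hyps by blast
    from step.IH show ?thesis
    proof
      assume "(x, y) \<in> A\<^sup>+"
      then show ?thesis using A by (meson trancl.trancl_into_trancl)
    next
      assume "\<exists>(r, b) \<in> B. (x, r) \<in> (A \<union> B)\<^sup>* \<and> (b, y) \<in> (A \<union> B)\<^sup>*"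
      then show ?thesis using step.hyps(2) by (fastforce intro: rtrancl.rtrancl_into_rtrancl)
    qed
  qed
qed

text \<open>Forward edges increase the index, so every cycle uses a back edge and thereby visits an
  open acquire. Between two such visits the path corresponds to one edge of the lock graph.\<close>

lemma acyclic_lock_graph:
  assumes C: "dep_closed C"
    and uniq: "\<And>a b. open_acq C a \<Longrightarrow> open_acq C b \<Longrightarrow> lk a = lk b \<Longrightarrow> a = b"
  shows "acyclic (fwd_edges C \<union> back_edges C) \<longleftrightarrow> acyclic (lock_graph C)"
proof -
  let ?F = "fwd_edges C" and ?B = "back_edges C"
  have op: "b < n" "oc b = 2" "b \<in> C" if "open_acq C b" for b
    using that dep_closed_less[OF C] by (auto simp: open_acq_def)
  have bk: "(r, b) \<in> ?B \<longleftrightarrow> r \<in> C \<and> oc r = 3 \<and> open_acq C b \<and> lk r = lk b" for r b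
  proof (cases "r \<in> C \<and> oc r = 3 \<and> open_acq C b")
    case True
    then show ?thesis using lk_eq_iff[of r b] op[of b] dep_closed_less[OF C, of r] by (auto simp: back_edges_def)
  qed (auto simp: back_edges_def)
  have lg: "(l, l') \<in> lock_graph C \<Longrightarrow> \<exists>b b'. open_acq C b \<and> lk b = l \<and> open_acq C b' \<and> lk b' = l' \<and> (b, b') \<in> (?F \<union> ?B)\<^sup>+" for l l'
  proof -
    assume "(l, l') \<in> lock_graph C"
    then obtain b b' r where b: "open_acq C b" "lk b = l" "open_acq C b'" "lk b' = l'"
      and r: "r \<in> C" "oc r = 3" "lk r = l'" "reaches C b r" by (auto simp: lock_graph_def)
    have "(r, b') \<in> ?B" using bk b r by simp
    moreover have "(b, r) \<in> (?F \<union> ?B)\<^sup>*" using r(4) by (meson Un_upper1 in_mono reaches_def rtrancl_mono)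
    ultimately have "(b, b') \<in> (?F \<union> ?B)\<^sup>+" by (meson UnI2 rtrancl_into_trancl1)
    then show ?thesis using b by blast
  qed
  have lg2: "\<exists>b b'. open_acq C b \<and> lk b = l \<and> open_acq C b' \<and> lk b' = l' \<and> (b, b') \<in> (?F \<union> ?B)\<^sup>+"
    if "(l, l') \<in> (lock_graph C)\<^sup>+" for l l'
    using that
  proof induction
    case (base y)
    then show ?case using lg by blast
  next
    case (step y z)
    from step.IH obtain b b' where b: "open_acq C b" "lk b = l" "open_acq C b'" "lk b' = y"
      "(b, b') \<in> (?F \<union> ?B)\<^sup>+" by blast
    moreover obtain c c' where c: "open_acq C c" "lk c = y" "open_acq C c'" "lk c' = z"
      "(c, c') \<in> (?F \<union> ?B)\<^sup>+" using lg[OF step.hyps(2)] by blast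
    \<comment> \<open>Paths for consecutive lock edges can be joined because each lock has only one
      open acquire.\<close>
    moreover have "b' = c" using uniq b c by simp
    moreover from this have "(b, c') \<in> (?F \<union> ?B)\<^sup>+" using b(5) c(5) by (auto intro: trancl_trans)
    ultimately show ?case by blast
  qed
  \<comment> \<open>The path is cut at its last back edge: up to there it becomes a path of locks,
    and after it only forward edges remain.\<close>
  have path: "\<exists>c. open_acq C c \<and> (lk b, lk c) \<in> (lock_graph C)\<^sup>* \<and> reaches C c y"
    if "open_acq C b" "(b, y) \<in> (?F \<union> ?B)\<^sup>*" for b y
    using that(2)
  proof induction
    case base
    then show ?case using that(1) by (auto simp: reaches_def)
  next
    case (step y z)
    then obtain c where c: "open_acq C c" "(lk b, lk c) \<in> (lock_graph C)\<^sup>*" "reaches C c y" by blast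
    show ?case
    proof (cases "(y, z) \<in> ?F")
      case True
      then show ?thesis using c by (auto simp: reaches_def intro: rtrancl.rtrancl_into_rtrancl)
    next
      case False
      then have B: "(y, z) \<in> ?B" using step by blast
      then have "(lk c, lk z) \<in> lock_graph C" using c bk by (auto simp: lock_graph_def)
      then have "(lk b, lk z) \<in> (lock_graph C)\<^sup>*" using c(2) by simp
      moreover have "open_acq C z" using B bk by blast
      ultimately show ?thesis by (auto simp: reaches_def)
    qed
  qed
  have Facyc: "(x, y) \<in> ?F\<^sup>+ \<Longrightarrow> x < y" for x y
    by (induction rule: trancl_induct) (auto simp: fwd_edges_def fwd_def)
  show ?thesis
  proof
    assume a: "acyclic (?F \<union> ?B)"
    show "acyclic (lock_graph C)"
      unfolding acyclic_def
    proof (intro allI notI)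
      fix l assume "(l, l) \<in> (lock_graph C)\<^sup>+"
      then obtain b b' where "open_acq C b" "lk b = l" "open_acq C b'" "lk b' = l" "(b, b') \<in> (?F \<union> ?B)\<^sup>+"
        using lg2 by meson
      then show False using a uniq[of b b'] by (simp add: acyclic_def)
    qed
  next
    assume a: "acyclic (lock_graph C)"
    show "acyclic (?F \<union> ?B)"
      unfolding acyclic_def
    proof (intro allI notI)
      fix x assume "(x, x) \<in> (?F \<union> ?B)\<^sup>+"
      then obtain r b where rb: "(r, b) \<in> ?B" "(x, r) \<in> (?F \<union> ?B)\<^sup>*" "(b, x) \<in> (?F \<union> ?B)\<^sup>*"
        using trancl_Un_cases[of x x ?F ?B] Facyc by blast
      have b: "open_acq C b" using rb bk by blast
      have "(b, r) \<in> (?F \<union> ?B)\<^sup>*" using rb by (meson rtrancl_trans)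
      then obtain c where c: "open_acq C c" "(lk b, lk c) \<in> (lock_graph C)\<^sup>*" "reaches C c r"
        using path[OF b] by blast
      have "(lk c, lk b) \<in> lock_graph C" using c b rb bk by (auto simp: lock_graph_def)
      then have "(lk b, lk b) \<in> (lock_graph C)\<^sup>+" using c(2) by (meson rtrancl_into_trancl1)
      then show False using a by (simp add: acyclic_def)
    qed
  qed
qed

end

text \<open>A source lies on no cycle, since a cycle enters each of its elements. With the next
  lemma, this justifies testing acyclicity by removing sources one by one.\<close>

lemma acyclic_remove_source:
  assumes "\<And>y. y \<in> U \<Longrightarrow> (y, x) \<notin> A"
  shows "acyclic (A \<inter> U \<times> U) \<longleftrightarrow> acyclic (A \<inter> (U - {x}) \<times> (U - {x}))"
proof
  assume "acyclic (A \<inter> U \<times> U)"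
  then show "acyclic (A \<inter> (U - {x}) \<times> (U - {x}))" by (rule acyclic_subset) auto
next
  assume a: "acyclic (A \<inter> (U - {x}) \<times> (U - {x}))"
  have nx: "z \<noteq> x" if "(y, z) \<in> (A \<inter> U \<times> U)\<^sup>+" for y z
    using that assms by (auto elim: tranclE)
  have "(y, z) \<in> (A \<inter> (U - {x}) \<times> (U - {x}))\<^sup>+" if "(y, z) \<in> (A \<inter> U \<times> U)\<^sup>+" "y \<noteq> x" for y z
    using that
  proof (induction rule: trancl_induct)
    case (base z)
    then show ?case using assms by (intro r_into_trancl) auto
  next
    case (step w z)
    have "(w, z) \<in> A \<inter> (U - {x}) \<times> (U - {x})" using step nx assms by blast
    then show ?case using step by (meson trancl.trancl_into_trancl)
  qed
  then show "acyclic (A \<inter> U \<times> U)" using a nx unfolding acyclic_def by blast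
qed

text \<open>A finite acyclic relation is well-founded and would have a minimal element in
  \<open>U\<close>, that is, a source.\<close>

lemma not_acyclic_if_no_source:
  assumes "finite U" "U \<noteq> {}" "\<And>x. x \<in> U \<Longrightarrow> \<exists>y\<in>U. (y, x) \<in> A"
  shows "\<not> acyclic (A \<inter> U \<times> U)"
proof
  assume "acyclic (A \<inter> U \<times> U)"
  moreover have "finite (A \<inter> U \<times> U)" using assms(1) by simp
  ultimately have "wf (A \<inter> U \<times> U)" by (rule finite_acyclic_wf[rotated])
  moreover obtain u where "u \<in> U" using assms(2) by blast
  ultimately obtain z where "z \<in> U" "\<And>y. (y, z) \<in> A \<inter> U \<times> U \<Longrightarrow> y \<notin> U"
    by (rule wfE_min) blast+
  then show False using assms(3) by blast
qed

section \<open>Computing the tables\<close>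

text \<open>Memory layout. Array 5 holds the multiples of \<open>n + 1\<close>; as there is no multiplication, the
  cell \<open>(p, q)\<close> of a table is addressed through it as \<open>p * (n + 1) + q\<close>, and triples likewise.
  Arrays 7 and 10 hold the numbers of threads and locks, and 8 and 11 the consecutive numbers of
  the thread and of the lock of an event. The tables \<open>M\<close>, \<open>RF\<close>, \<open>TRC\<close>, \<open>LA\<close>, \<open>LR\<close>, \<open>SU\<close>, \<open>RM\<close>
  and \<open>Cl\<close> are in the arrays 12 to 19. Array 20 is the current vector, 21 the unmatched acquires
  by lock, 22 and 23 the search vector and its finished threads, 24 the lock graph, 25 and 26 the
  in-degrees and the removed locks. Arrays from 30 on are used at cell 0 only: 30 is the first event
  of the pair, 35 the answer, 40 the outcome of checking one pair.\<close>

definition ix2 :: "aexp \<Rightarrow> aexp \<Rightarrow> aexp" where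
  "ix2 p q = Add (Load 5 p) q"

definition ix3 :: "aexp \<Rightarrow> aexp \<Rightarrow> aexp \<Rightarrow> aexp" where
  "ix3 p q r = Add (Load 5 (Add (Load 5 p) q)) r"

lemma acost_ix [simp]:
  "acost (ix2 p q) = 2 + acost p + acost q"
  "acost (ix3 p q r) = 4 + acost p + acost q + acost r"
  by (simp_all add: ix2_def ix3_def)

definition Or :: "bexp \<Rightarrow> bexp \<Rightarrow> bexp" where
  "Or a b = Neg (Conj (Neg a) (Neg b))"

lemma Or_simps [simp]:
  "bval (Or a b) s \<longleftrightarrow> bval a s \<or> bval b s"
  "bcost (Or a b) = 4 + bcost a + bcost b"
  by (simp_all add: Or_def)

text \<open>Codes 0 and 1 are read and write, so for two codes below 2 a positive sum means that one
  of them is a write.\<close>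

definition conflictB :: "nat \<Rightarrow> nat \<Rightarrow> bexp" where
  "conflictB x y = Conj (Neg (Eq (V x) (V y))) (Conj (Eq (Load 4 (V x)) (Load 4 (V y)))
     (Conj (Less (Load 3 (V x)) (Const 2)) (Conj (Less (Load 3 (V y)) (Const 2))
     (Less (Const 0) (Add (Load 3 (V x)) (Load 3 (V y)))))))"

definition fwdB :: "nat \<Rightarrow> nat \<Rightarrow> bexp" where
  "fwdB x y = Conj (Less (V x) (V y)) (Or (Eq (Load 8 (V x)) (Load 8 (V y))) (Or (conflictB x y)
     (Conj (Eq (Load 3 (V x)) (Const 3)) (Conj (Eq (Load 3 (V y)) (Const 2))
       (Eq (Load 4 (V x)) (Load 4 (V y)))))))"

definition clear_v :: com where
  "clear_v = For 39 (V 7) (Store 20 (V 39) (Const 0))"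

definition copy_v :: "nat \<Rightarrow> aexp \<Rightarrow> com" where
  "copy_v d ix = For 39 (V 7) (Store d ix (Load 20 (V 39)))"

definition join_v :: "nat \<Rightarrow> com" where
  "join_v x = For 39 (V 7) (If (Less (Load 20 (V 39)) (Load 14 (ix2 (V x) (V 39))))
     (Store 20 (V 39) (Load 14 (ix2 (V x) (V 39)))) Skip)"

text \<open>Cell 32 runs through the trace backwards, so the earliest release is stored last. Such
  scans for every event are affordable, as the target is quadratic in the length.\<close>

definition match_row :: com where
  "match_row = For 31 (V 0) (Seq (Set 32 (Sub (V 0) (Add (V 31) (Const 1))))
     (If (Conj (Less (V 30) (V 32)) (Conj (Eq (Load 3 (V 30)) (Const 2))
          (Conj (Eq (Load 3 (V 32)) (Const 3)) (Eq (Load 4 (V 32)) (Load 4 (V 30))))))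
       (Store 12 (V 30) (V 32)) Skip))"

definition match_table :: com where
  "match_table = For 30 (V 0) (Seq (Store 12 (V 30) (V 0)) match_row)"

definition rf_row :: com where
  "rf_row = For 31 (V 30) (If (Conj (Eq (Load 3 (V 30)) (Const 0))
       (Conj (Eq (Load 3 (V 31)) (Const 1)) (Eq (Load 4 (V 31)) (Load 4 (V 30)))))
     (Store 13 (V 30) (Add (V 31) (Const 1))) Skip)"

definition rf_table :: com where
  "rf_table = For 30 (V 0) (Seq (Store 13 (V 30) (Const 0)) rf_row)"

definition closure_row :: com where
  "closure_row = For 31 (V 30) (If (Or (Eq (Load 8 (V 31)) (Load 8 (V 30)))
       (Eq (Load 13 (V 30)) (Add (V 31) (Const 1)))) (join_v 31) Skip)"

definition closure_table :: com where
  "closure_table = For 30 (V 0) (Seq clear_v (Seq (Store 20 (Load 8 (V 30)) (Add (V 30) (Const 1)))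
     (Seq closure_row (copy_v 14 (ix2 (V 30) (V 39))))))"

text \<open>Every prefix is scanned anew. Over all prefixes this takes \<open>O(N\<^sup>2)\<close>
  steps, without factors for threads and locks, since an event writes only the cell of its own
  thread and lock.\<close>

definition last_row :: com where
  "last_row = For 31 (V 30) (Seq
     (If (Eq (Load 3 (V 31)) (Const 2))
       (Store 15 (ix3 (V 30) (Load 8 (V 31)) (Load 11 (V 31))) (Add (V 31) (Const 1))) Skip)
     (If (Eq (Load 3 (V 31)) (Const 3))
       (Store 16 (ix3 (V 30) (Load 8 (V 31)) (Load 11 (V 31))) (Add (V 31) (Const 1))) Skip))"

definition last_table :: com where
  "last_table = For 30 (Add (V 0) (Const 1)) last_row"

definition succ_row :: com where
  "succ_row = For 31 (V 0) (Seq (Set 32 (Sub (V 0) (Add (V 31) (Const 1))))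
     (If (fwdB 30 32) (Store 17 (ix2 (V 30) (Load 8 (V 32))) (V 32)) Skip))"

definition succ_table :: com where
  "succ_table = For 30 (V 0) (Seq (For 39 (V 7) (Store 17 (ix2 (V 30) (V 39)) (V 0))) succ_row)"

definition range_cell :: com where
  "range_cell = For 39 (V 7)
     (If (Conj (Less (V 30) (Add (V 31) (Const 1))) (Conj (Eq (Load 8 (V 31)) (Load 8 (V 30)))
          (Less (Load 17 (ix2 (V 31) (V 39))) (Load 18 (ix3 (V 30) (V 31) (V 39))))))
       (Store 18 (ix3 (V 30) (Add (V 31) (Const 1)) (V 39)) (Load 17 (ix2 (V 31) (V 39))))
       (Store 18 (ix3 (V 30) (Add (V 31) (Const 1)) (V 39)) (Load 18 (ix3 (V 30) (V 31) (V 39)))))"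

definition range_row :: com where
  "range_row = Seq (For 39 (V 7) (Store 18 (ix3 (V 30) (Const 0) (V 39)) (V 0)))
     (For 31 (V 0) range_cell)"

definition range_table :: com where
  "range_table = For 30 (V 0) range_row"

lemmas table_defs = clear_v_def copy_v_def join_v_def match_row_def match_table_def rf_row_def
  rf_table_def closure_row_def closure_table_def last_row_def last_table_def succ_row_def
  succ_table_def range_cell_def range_row_def range_table_def

context coded_trace
begin

section \<open>Addresses of table cells and the fixed part of the memory\<close>

definition ad2 :: "nat \<Rightarrow> nat \<Rightarrow> nat" where
  "ad2 p q = p * Suc n + q"

definition ad3 :: "nat \<Rightarrow> nat \<Rightarrow> nat \<Rightarrow> nat" where
  "ad3 p q r = ad2 (ad2 p q) r"

lemma ad2_inj: "q \<le> n \<Longrightarrow> q' \<le> n \<Longrightarrow> ad2 p q = ad2 p' q' \<longleftrightarrow> p = p' \<and> q = q'"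
proof
  assume a: "ad2 p q = ad2 p' q'" and q: "q \<le> n" "q' \<le> n"
  have "ad2 p q div Suc n = p" "ad2 p q mod Suc n = q" "ad2 p' q' div Suc n = p'" "ad2 p' q' mod Suc n = q'"
    using q by (simp_all add: ad2_def del: mult_Suc_right)
  then show "p = p' \<and> q = q'" using a by metis
qed simp

lemma ad3_inj:
  "q \<le> n \<Longrightarrow> q' \<le> n \<Longrightarrow> r \<le> n \<Longrightarrow> r' \<le> n \<Longrightarrow> ad3 p q r = ad3 p' q' r' \<longleftrightarrow> p = p' \<and> q = q' \<and> r = r'"
  by (auto simp: ad3_def ad2_inj)

text \<open>What the table computations and all later phases read but preserve. The multiples reach
  up to \<open>Suc n * Suc n\<close> because a triple address looks up the entry
  \<open>p * Suc n + q\<close> with \<open>p\<close> and \<open>q\<close> at most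
  \<open>n\<close>.\<close>

definition base :: "store \<Rightarrow> bool" where
  "base s \<longleftrightarrow> s 0 0 = n \<and> (\<forall>i<n. s 3 i = oc i \<and> s 4 i = od i) \<and> (\<forall>k\<le>Suc n * Suc n. s 5 k = k * Suc n) \<and>
     s 7 0 = T \<and> (\<forall>i<n. s 8 i = tn i) \<and> s 10 0 = L \<and> (\<forall>i<n. 2 \<le> oc i \<longrightarrow> s 11 i = lk i)"

lemma base_agree:
  "base s \<Longrightarrow> agree A s s' \<Longrightarrow> A \<inter> {0, 3, 4, 5, 7, 8, 10, 11} = {} \<Longrightarrow> base s'"
  by (simp add: base_def agree_def)

lemma baseD:
  assumes "base s"
  shows "s 0 0 = n" "i < n \<Longrightarrow> s 3 i = oc i" "i < n \<Longrightarrow> s 4 i = od i" "s 7 0 = T"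
    "i < n \<Longrightarrow> s 8 i = tn i" "s 10 0 = L" "i < n \<Longrightarrow> 2 \<le> oc i \<Longrightarrow> s 11 i = lk i"
  using assms by (auto simp: base_def)

lemma aval_ix2: "base s \<Longrightarrow> aval p s \<le> n \<Longrightarrow> aval (ix2 p q) s = ad2 (aval p s) (aval q s)"
proof -
  assume b: "base s" and p: "aval p s \<le> n"
  have "aval p s \<le> Suc n * Suc n" using p by simp
  then show ?thesis using b unfolding base_def by (simp add: ix2_def ad2_def)
qed

lemma aval_ix3:
  assumes b: "base s" and p: "aval p s \<le> n" "aval q s \<le> n"
  shows "aval (ix3 p q r) s = ad3 (aval p s) (aval q s) (aval r s)"
proof -
  have 1: "aval p s \<le> Suc n * Suc n" using p by simp
  have "aval p s * Suc n + aval q s \<le> n * Suc n + n" using p by (intro add_mono mult_le_mono1)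
  also have "\<dots> \<le> Suc n * Suc n" by simp
  finally have "s 5 (aval p s * Suc n + aval q s) = (aval p s * Suc n + aval q s) * Suc n"
    using b unfolding base_def by blast
  moreover have "s 5 (aval p s) = aval p s * Suc n" using b 1 unfolding base_def by blast
  ultimately show ?thesis by (simp add: ix3_def ad3_def ad2_def)
qed

lemma bval_conflictB:
  assumes "base s" "s x 0 < n" "s y 0 < n"
  shows "bval (conflictB x y) s \<longleftrightarrow> cf (s x 0) (s y 0)"
  using assms by (auto simp: conflictB_def baseD cf_def)

lemma bval_fwdB:
  assumes "base s" "s x 0 < n" "s y 0 < n"
  shows "bval (fwdB x y) s \<longleftrightarrow> fwd (s x 0) (s y 0)"
  using assms bval_conflictB[OF assms] by (auto simp: fwdB_def baseD fwd_def)

lemma bcost_B [simp]: "bcost (conflictB x y) = 36" "bcost (fwdB x y) = 76"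
  by (simp_all add: conflictB_def fwdB_def)

lemma wp_clear_v:
  assumes b: "base s0"
  shows "wp clear_v (\<lambda>t s. (\<forall>t<T. s 20 t = 0) \<and> t \<le> 40 * Suc T) s0"
proof -
  \<comment> \<open>In bounds of this form the first summand bounds the loop body and the second is
    the overhead of \<open>wp_For\<close>. All constants are rounded up generously.\<close>
  have "wp clear_v (\<lambda>t s. (\<forall>t<T. s 20 t = 0) \<and> t \<le> (20 + 20) * (Suc T * 1)) s0"
    unfolding clear_v_def
  proof (rule wp_For[where I = "\<lambda>k s. \<forall>t<k. s 20 t = 0"], goal_cases)
    case (2 s)
    then show ?case using baseD(4)[OF b] by (simp add: agree_def)
  next
    case (4 k s)
    then show ?case by (auto simp: less_Suc_eq)
  qed auto
  then show ?thesis by simp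
qed

text \<open>The target address is abstracted to an injective \<open>f\<close>, so that the same loop
  serves for rows of the table \<open>TRC\<close>, addressed by pairs, and of \<open>Cl\<close>,
  addressed by triples.\<close>

lemma wp_copy_v:
  assumes b: "base s0"
    and ix: "\<And>s k. agree {39, d} s0 s \<Longrightarrow> k < T \<Longrightarrow> s 39 0 = k \<Longrightarrow> aval ix s = f k"
    and inj: "inj_on f {..<T}" and d: "d \<notin> {0, 7, 20, 39}" and cost: "acost ix \<le> 20"
  shows "wp (copy_v d ix) (\<lambda>t s. (\<forall>t<T. s d (f t) = s0 20 t) \<and> (\<forall>x. x \<notin> f ` {..<T} \<longrightarrow> s d x = s0 d x) \<and>
     t \<le> 60 * Suc T) s0"
proof -
  have "wp (copy_v d ix) (\<lambda>t s. ((\<forall>t<T. s d (f t) = s0 20 t) \<and> (\<forall>x. x \<notin> f ` {..<T} \<longrightarrow> s d x = s0 d x)) \<and>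
     t \<le> (40 + 20) * (Suc T * 1)) s0"
    unfolding copy_v_def
  proof (rule wp_For[where I = "\<lambda>k s. (\<forall>t<k. s d (f t) = s0 20 t) \<and>
      (\<forall>x. x \<notin> f ` {..<k} \<longrightarrow> s d x = s0 d x)"], goal_cases)
    case (2 s)
    then show ?case using baseD(4)[OF b] d by (simp add: agree_def)
  next
    case (4 k s)
    have "aval ix s = f k" using ix[of s k] 4 by simp
    moreover have "s 20 = s0 20" using 4(4) d by (auto simp: agree_def)
    moreover have "f t \<noteq> f k" if "t < k" for t using inj that 4(1) by (auto simp: inj_on_def)
    ultimately show ?case using 4 d cost by (auto simp: less_Suc_eq lessThan_Suc)
  qed (use d in auto)
  then show ?thesis by (simp add: conj_assoc)
qed

lemma wp_join_v:
  assumes b: "base s0" and x: "x \<notin> {20, 39}" "s0 x 0 = j" "j < n"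
    and w: "vec (\<lambda>t. s0 14 (ad2 j t)) S'" and v: "vec (s0 20) S"
  shows "wp (join_v x) (\<lambda>t s. vec (s 20) (S \<union> S') \<and> t \<le> 80 * Suc T) s0"
proof -
  let ?I = "\<lambda>k s. \<forall>t. s 20 t = (if t < k then max (s0 20 t) (s0 14 (ad2 j t)) else s0 20 t)"
  have "wp (join_v x) (\<lambda>t s. ?I T s \<and> t \<le> (60 + 20) * (Suc T * 1)) s0"
    unfolding join_v_def
  proof (rule wp_For[where I = ?I], goal_cases)
    case (2 s)
    then show ?case using baseD(4)[OF b] by (simp add: agree_def)
  next
    case (4 k s)
    have "base s" using base_agree[OF b 4(4)] x by simp
    moreover have "s x = s0 x" "s 14 = s0 14" using 4(4) x by (simp_all add: agree_def)
    ultimately show ?case using 4 x by (auto simp: aval_ix2 less_Suc_eq)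
  qed auto
  then show ?thesis
  proof (rule wp_use, goal_cases)
    case (1 t s)
    then have "vec (s 20) (S \<union> S')" by (intro vec_cong[OF vec_Un[OF v w]]) simp
    then show ?case using 1 by simp
  qed
qed


section \<open>Correctness and cost of the individual tables\<close>

lemma wp_match_table:
  assumes b: "base s0"
  shows "wp match_table (\<lambda>t s. (\<forall>a<n. s 12 a = M a) \<and> t \<le> 200 * (Suc n * Suc n)) s0"
proof -
  have row: "wp match_row (\<lambda>t s. (s 12 i = M i \<and> (\<forall>x. x \<noteq> i \<longrightarrow> s 12 x = s1 12 x)) \<and>
      t \<le> (80 + 20) * (Suc n * 1)) s1"
    if b1: "base s1" and i: "i < n" "s1 30 0 = i" "s1 12 i = n" for s1 i
    unfolding match_row_def M_def
  \<comment> \<open>The loop counter is the last argument of \<open>fmin\<close>, so an iteration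
    unfolds its recursion once.\<close>
  proof (rule wp_For[where I = "\<lambda>k s. s 12 i = fmin (\<lambda>r. i < r \<and> oc i = 2 \<and> oc r = 3 \<and> od r = od i) n k \<and>
      (\<forall>x. x \<noteq> i \<longrightarrow> s 12 x = s1 12 x)"], goal_cases)
    case (2 s)
    then show ?case using baseD(1)[OF b1] by (simp add: agree_def)
  next
    case (4 k s)
    have "base s" using base_agree[OF b1 4(4)] by simp
    moreover have "s 30 = s1 30" using 4(4) by (simp add: agree_def)
    ultimately show ?case using 4 i by (auto simp: baseD)
  qed (use i in auto)
  have "wp match_table (\<lambda>t s. (\<forall>a<n. s 12 a = M a) \<and> t \<le> (120 + 20) * (Suc n * Suc n)) s0"
    unfolding match_table_def
  proof (rule wp_For[where I = "\<lambda>k s. \<forall>a<k. s 12 a = M a"], goal_cases)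
    case (2 s)
    then show ?case using baseD(1)[OF b] by (simp add: agree_def match_row_def)
  next
    case (4 k s)
    have bs: "base s" using base_agree[OF b 4(4)] by (simp add: match_row_def)
    show ?case
      unfolding wp_Seq wp_Store
      by (rule wp_use[OF row[of _ k]])
        (use 4 bs base_agree[OF bs, of "{12}"] in \<open>auto simp: baseD less_Suc_eq\<close>)
  qed (auto simp: match_row_def)
  then show ?thesis by (rule wp_use) auto
qed

lemma wp_rf_table:
  assumes b: "base s0"
  shows "wp rf_table (\<lambda>t s. (\<forall>a<n. s 13 a = RF a) \<and> t \<le> 200 * (Suc n * Suc n)) s0"
proof -
  have row: "wp rf_row (\<lambda>t s. (s 13 i = RF i \<and> (\<forall>x. x \<noteq> i \<longrightarrow> s 13 x = s1 13 x)) \<and>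
      t \<le> (80 + 20) * (Suc i * 1)) s1"
    if b1: "base s1" and i: "i < n" "s1 30 0 = i" "s1 13 i = 0" for s1 i
    unfolding rf_row_def RF_def
  proof (rule wp_For[where I = "\<lambda>k s. s 13 i = flast (\<lambda>j. oc i = 0 \<and> oc j = 1 \<and> od j = od i) k \<and>
      (\<forall>x. x \<noteq> i \<longrightarrow> s 13 x = s1 13 x)"], goal_cases)
    case (2 s)
    then show ?case using i by (simp add: agree_def)
  next
    case (4 k s)
    have "base s" using base_agree[OF b1 4(4)] by simp
    moreover have "s 30 = s1 30" using 4(4) by (simp add: agree_def)
    ultimately show ?case using 4 i by (auto simp: baseD)
  qed (use i in auto)
  have "wp rf_table (\<lambda>t s. (\<forall>a<n. s 13 a = RF a) \<and> t \<le> (120 + 20) * (Suc n * Suc n)) s0"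
    unfolding rf_table_def
  proof (rule wp_For[where I = "\<lambda>k s. \<forall>a<k. s 13 a = RF a"], goal_cases)
    case (2 s)
    then show ?case using baseD(1)[OF b] by (simp add: agree_def rf_row_def)
  next
    case (4 k s)
    have bs: "base s" using base_agree[OF b 4(4)] by (simp add: rf_row_def)
    show ?case
      unfolding wp_Seq wp_Store
      by (rule wp_use[OF row[of _ k]])
        (use 4 bs base_agree[OF bs, of "{13}"] in \<open>auto simp: baseD less_Suc_eq\<close>)
  qed (auto simp: rf_row_def)
  then show ?thesis by (rule wp_use) auto
qed

text \<open>Storing \<open>i + 1\<close> in the entry of its own thread marks the whole thread
  prefix up to \<open>i\<close>; this says that such a start does not mark too much.\<close>

lemma TRC_thread: "i < n \<Longrightarrow> {f. f \<le> i \<and> tn f = tn i} \<subseteq> TRC i"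
  using dep_closedD[OF dep_closed_TRC TRC_refl, of i] TRC_refl[of i]
  by (auto simp: dep_def le_less)

lemma mods_v [simp]:
  "mods clear_v = {20, 39}" "mods (copy_v d ix) = {39, d}" "mods (join_v x) = {20, 39}"
  by (auto simp: clear_v_def copy_v_def join_v_def)

text \<open>Row \<open>i\<close> starts from its thread prefix and joins the rows of all direct
  predecessors, which are complete because they lie earlier. A join takes time linear in the number
  of threads.\<close>

lemma wp_closure_table:
  assumes b: "base s0" and rf: "\<And>i. i < n \<Longrightarrow> s0 13 i = RF i"
  shows "wp closure_table (\<lambda>t s. (\<forall>i<n. vec (\<lambda>t. s 14 (ad2 i t)) (TRC i)) \<and>
    t \<le> 500 * (Suc n * (Suc n * Suc T))) s0"
proof -
  let ?U = "\<lambda>i k. {f. f \<le> i \<and> tn f = tn i} \<union> (\<Union>j\<in>{j. j < k \<and> dep j i}. TRC j)"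
  have row: "wp closure_row (\<lambda>t s. vec (s 20) (TRC i) \<and> t \<le> 140 * (Suc n * Suc T)) s1"
    if b1: "base s1" and i: "i < n" "s1 30 0 = i" and rf: "\<And>i. i < n \<Longrightarrow> s1 13 i = RF i"
      and v: "vec (s1 20) {f. f \<le> i \<and> tn f = tn i}"
      and rows: "\<And>j. j < i \<Longrightarrow> vec (\<lambda>t. s1 14 (ad2 j t)) (TRC j)" for s1 i
  proof -
    have "wp closure_row (\<lambda>t s. vec (s 20) (?U i i) \<and> t \<le> (120 + 20) * (Suc i * Suc T)) s1"
      unfolding closure_row_def
    proof (rule wp_For[where I = "\<lambda>k s. vec (s 20) (?U i k)"], goal_cases)
      case (2 s)
      then show ?case using i by (simp add: agree_def)
    next
      case (4 k s)
      have bs: "base s" using base_agree[OF b1 4(4)] by simp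
      have e: "s 30 = s1 30" "s 13 = s1 13" "s 14 = s1 14" using 4(4) by (simp_all add: agree_def)
      have kn: "k < n" using 4 i by simp
      have c: "bval (Or (Eq (Load 8 (V 31)) (Load 8 (V 30))) (Eq (Load 13 (V 30)) (Add (V 31) (Const 1)))) s
          \<longleftrightarrow> dep k i"
        using 4 bs e i rf kn by (simp add: baseD dep_def RF_iff)
      have U: "?U i (Suc k) = (if dep k i then ?U i k \<union> TRC k else ?U i k)"
        by (auto simp: less_Suc_eq)
      have "wp (join_v 31) (\<lambda>t s. vec (s 20) (?U i k \<union> TRC k) \<and> t \<le> 80 * Suc T) s"
        by (rule wp_join_v[OF bs _ 4(3) kn]) (use 4 rows[of k] e in auto)
      then show ?case
        unfolding wp_If c by (auto simp: U 4 elim!: wp_use)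
    qed (use v in auto)
    moreover have "?U i i = TRC i"
      using TRC_thread[OF i(1)] TRC_Un[of i] dep_less(1)[of _ i] by auto
    moreover have "140 * (Suc i * Suc T) \<le> 140 * (Suc n * Suc T)" using i by (intro mult_le_mono) auto
    ultimately show ?thesis by (auto elim!: wp_use)
  qed
  have "wp closure_table (\<lambda>t s. (\<forall>i<n. vec (\<lambda>t. s 14 (ad2 i t)) (TRC i)) \<and>
     t \<le> (260 + 20) * (Suc n * (Suc n * Suc T))) s0"
    unfolding closure_table_def
  proof (rule wp_For[where I = "\<lambda>k s. \<forall>i<k. vec (\<lambda>t. s 14 (ad2 i t)) (TRC i)"], goal_cases)
    case (2 s)
    then show ?case using baseD(1)[OF b] by (simp add: agree_def closure_row_def)
  next
    case (4 k s)
    have bs: "base s" using base_agree[OF b 4(4)] by (simp add: closure_row_def)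
    have rfs: "\<And>i. i < n \<Longrightarrow> s 13 i = RF i" using 4(4) rf by (simp add: agree_def closure_row_def)
    have sT: "Suc T \<le> Suc n * Suc T" by simp
    show ?case
      unfolding wp_Seq wp_Store
    proof (rule wp_use[OF wp_clear_v[OF bs]], goal_cases)
      case (1 t1 s1)
      have b1: "base s1" using base_agree[OF bs 1(2)] by simp
      have e: "s1 30 = s 30" "s1 13 = s 13" "s1 14 = s 14" using 1(2) by (simp_all add: agree_def)
      let ?s = "upd s1 20 (aval (Load 8 (V 30)) s1) (aval (Add (V 30) (Const 1)) s1)"
      have b2: "base ?s" using base_agree[OF b1, of "{20}" ?s] by simp
      have v: "vec (?s 20) {f. f \<le> k \<and> tn f = tn k}"
        using 1(1) 4(1,3) tn_less[of k] e b1 tn_less by (auto simp: vec_def baseD less_Suc_eq_le)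
      show ?case
      proof (rule wp_use[OF row[OF b2 4(1) _ _ v]], goal_cases)
        case (4 t2 s2)
        have b3: "base s2" using base_agree[OF b2 4(2)] by (simp add: closure_row_def)
        have e2: "s2 30 = s 30" "s2 14 = s 14" using 4(2) e by (simp_all add: agree_def closure_row_def)
        have inj: "inj_on (ad2 k) {..<T}" using T_le by (auto simp: inj_on_def ad2_inj)
        show ?case
        proof (rule wp_use[OF wp_copy_v[OF b3, where f = "ad2 k"]], goal_cases)
          case (1 s' t)
          have "base s'" using base_agree[OF b3 1(1)] by simp
          moreover have "s' 30 0 = k" using 1(1) e2 \<open>s 30 0 = k\<close> by (simp add: agree_def)
          ultimately show ?case using 1 \<open>k < n\<close> by (simp add: aval_ix2)
        next
          case (5 t3 s3)
          have "vec (\<lambda>t. s3 14 (ad2 i t)) (TRC i)" if i: "i < Suc k" for i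
          proof (cases "i = k")
            case True
            then show ?thesis using 5(1) 4(1) by (auto intro: vec_cong)
          next
            case False
            have "ad2 i t \<notin> ad2 k ` {..<T}" if "t < T" for t
              using that False T_le by (auto simp: ad2_inj)
            then have "s3 14 (ad2 i t) = s 14 (ad2 i t)" if "t < T" for t using 5(1) e2 that by auto
            moreover have "vec (\<lambda>t. s 14 (ad2 i t)) (TRC i)"
              using \<open>\<forall>i<k. vec (\<lambda>t. s 14 (ad2 i t)) (TRC i)\<close> i False by auto
            ultimately show ?thesis by (auto intro: vec_cong)
          qed
          moreover have "t1 + (1 + acost (Load 8 (V 30)) + acost (Add (V 30) (Const 1)) + (t2 + t3)) \<le>
              260 * (Suc n * Suc T)"
            using 1(1) 4(1) 5(1) sT by simp
          ultimately show ?case by simp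
        qed (use inj in auto)
      qed (use 4 e rfs in auto)
    qed
  qed (auto simp: closure_row_def)
  then show ?thesis by (rule wp_use) auto
qed


text \<open>Cells that no event writes must already hold 0, the code for no such event. Arrays 15
  and 16 are zero in the input store, and no earlier phase touches them.\<close>

lemma wp_last_table:
  assumes b: "base s0" and z: "\<And>x. s0 15 x = 0" "\<And>x. s0 16 x = 0"
  shows "wp last_table (\<lambda>t s. (\<forall>q\<le>n. \<forall>t<T. \<forall>l<L. s 15 (ad3 q t l) = LA q t l \<and> s 16 (ad3 q t l) = LR q t l) \<and>
    t \<le> 400 * (Suc n * Suc n)) s0"
proof -
  let ?P = "\<lambda>c t l i. oc i = c \<and> tn i = t \<and> lk i = l"
  let ?I = "\<lambda>q k s. \<forall>t<T. \<forall>l<L. s 15 (ad3 q t l) = flast (?P 2 t l) k \<and> s 16 (ad3 q t l) = flast (?P 3 t l) k"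
  let ?J = "\<lambda>s1 q k s. ?I q k s \<and>
      (\<forall>q'. q' \<noteq> q \<longrightarrow> (\<forall>t<T. \<forall>l<L. s 15 (ad3 q' t l) = s1 15 (ad3 q' t l) \<and> s 16 (ad3 q' t l) = s1 16 (ad3 q' t l)))"
  have inj: "ad3 q t l = ad3 q' t' l' \<longleftrightarrow> q = q' \<and> t = t' \<and> l = l'" if "t < T" "t' < T" "l < L" "l' < L" for q q' t t' l l'
    using that T_le L_le by (intro ad3_inj) auto
  have row: "wp last_row (\<lambda>t s. ?J s1 q q s \<and> t \<le> (120 + 20) * (Suc q * 1)) s1"
    if b1: "base s1" and q: "q \<le> n" "s1 30 0 = q" and zq: "?I q 0 s1" for s1 q
    unfolding last_row_def
  proof (rule wp_For[where I = "?J s1 q"], goal_cases)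
    case (2 s)
    then show ?case using q by (simp add: agree_def)
  next
    case (4 k s)
    have bs: "base s" using base_agree[OF b1 4(4)] by simp
    have e: "s 30 = s1 30" using 4(4) by (simp add: agree_def)
    have k: "k < n" "tn k < T" using 4(1) q tn_less[of k] by auto
    have l: "2 \<le> oc k \<Longrightarrow> lk k < L" using lk_less k by simp
    have ad: "aval (ix3 (V 30) (Load 8 (V 31)) (Load 11 (V 31))) s = ad3 q (tn k) (lk k)" if "2 \<le> oc k"
      using bs e 4(3) k q T_le that by (subst aval_ix3) (auto simp: baseD)
    consider "oc k = 2" | "oc k = 3" | "oc k < 2" using oc_cases[of k] by force
    then show ?case
    proof cases
      case 1
      then show ?thesis
        using 4 bs k l ad by (auto simp: baseD inj)
    next
      case 2
      then show ?thesis
        using 4 bs k l ad by (auto simp: baseD inj)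
    next
      case 3
      then show ?thesis
        using 4 bs k by (auto simp: baseD)
    qed
  qed (use zq in auto)
  have "wp last_table (\<lambda>t s. ((\<forall>q<Suc n. ?I q q s) \<and> (\<forall>q\<ge>Suc n. ?I q 0 s)) \<and>
      t \<le> (140 + 20) * (Suc (Suc n) * Suc n)) s0"
    unfolding last_table_def
  proof (rule wp_For[where I = "\<lambda>k s. (\<forall>q<k. ?I q q s) \<and> (\<forall>q\<ge>k. ?I q 0 s)"], goal_cases)
    case (2 s)
    then show ?case using baseD(1)[OF b] by (simp add: agree_def last_row_def)
  next
    case (4 k s)
    have bs: "base s" using base_agree[OF b 4(4)] by (simp add: last_row_def)
    have z: "?I k 0 s" using 4(2) by blast
    have "wp last_row (\<lambda>t s'. ?J s k k s' \<and> t \<le> (120 + 20) * (Suc k * 1)) s"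
      by (rule row[OF bs _ 4(3) z]) (use 4(1) in simp)
    then show ?case
    proof (rule wp_use, goal_cases)
      case (1 t s')
      have "?I q q s'" if "q < Suc k" for q
        using 1(1) 4(2) that by (cases "q = k") auto
      moreover have "?I q 0 s'" if "q \<ge> Suc k" for q
        using 1(1) 4(2) that by auto
      moreover have "t \<le> 140 * Suc n" using 1(1) 4(1) by auto
      ultimately show ?case by simp
    qed
  qed (use z in \<open>auto simp: last_row_def\<close>)
  then show ?thesis
    by (rule wp_use) (auto simp: LA_def LR_def less_Suc_eq_le)
qed

lemma wp_succ_table:
  assumes b: "base s0"
  shows "wp succ_table (\<lambda>t s. (\<forall>i<n. \<forall>t<T. s 17 (ad2 i t) = SU i t) \<and> t \<le> 400 * (Suc n * Suc n)) s0"
proof -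
  let ?I = "\<lambda>i k s. \<forall>t<T. s 17 (ad2 i t) = fmin (\<lambda>r. fwd i r \<and> tn r = t) n k"
  let ?J = "\<lambda>s1 i s. \<forall>i'. i' \<noteq> i \<longrightarrow> (\<forall>t<T. s 17 (ad2 i' t) = s1 17 (ad2 i' t))"
  have inj: "ad2 i t = ad2 i' t' \<longleftrightarrow> i = i' \<and> t = t'" if "t < T" "t' < T" for i i' t t'
    using that T_le by (intro ad2_inj) auto
  have init: "wp (For 39 (V 7) (Store 17 (ix2 (V 30) (V 39)) (V 0))) (\<lambda>t s. (?I i 0 s \<and> ?J s1 i s) \<and>
      t \<le> (40 + 20) * (Suc T * 1)) s1"
    if b1: "base s1" and i: "i < n" "s1 30 0 = i" for s1 i
  proof (rule wp_For[where I = "\<lambda>k s. (\<forall>t<k. s 17 (ad2 i t) = fmin (\<lambda>r. fwd i r \<and> tn r = t) n 0) \<and> ?J s1 i s"], goal_cases)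
    case (2 s)
    then show ?case using baseD(4)[OF b1] by (simp add: agree_def)
  next
    case (4 k s)
    have bs: "base s" using base_agree[OF b1 4(4)] by simp
    have e: "s 30 = s1 30" using 4(4) by (simp add: agree_def)
    show ?case
      using 4 bs e i by (auto simp: aval_ix2 baseD inj less_Suc_eq)
  qed auto
  have row: "wp succ_row (\<lambda>t s. (?I i n s \<and> ?J s1 i s) \<and> t \<le> (150 + 20) * (Suc n * 1)) s1"
    if b1: "base s1" and i: "i < n" "s1 30 0 = i" and z: "?I i 0 s1" for s1 i
    unfolding succ_row_def
  proof (rule wp_For[where I = "\<lambda>k s. ?I i k s \<and> ?J s1 i s"], goal_cases)
    case (2 s)
    then show ?case using baseD(1)[OF b1] by (simp add: agree_def)
  next
    case (4 k s)
    let ?r = "n - Suc k"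
    let ?s = "upd s 32 0 ?r"
    have bs: "base s" using base_agree[OF b1 4(4)] by simp
    have b2: "base ?s" using base_agree[OF bs, of "{32}" ?s] by simp
    have e: "s 30 = s1 30" using 4(4) by (simp add: agree_def)
    have r: "?r < n" "tn ?r < T" using 4(1) tn_less[of ?r] by auto
    have c: "bval (fwdB 30 32) ?s \<longleftrightarrow> fwd i ?r"
      using bval_fwdB[OF b2, of 30 32] i e r by simp
    have ad: "aval (ix2 (V 30) (Load 8 (V 32))) ?s = ad2 i (tn ?r)"
      using aval_ix2[OF b2, of "V 30"] i e r by (simp add: baseD[OF b2, simplified])
    have x: "aval (Const 0) s = 0" "aval (Sub (V 0) (Add (V 31) (Const 1))) s = ?r"
      using 4(3) baseD(1)[OF bs] by simp_all
    show ?case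
      unfolding wp_Seq wp_Store wp_If x c ad using 4 r by (auto simp: inj)
  qed (use z in auto)
  have "wp succ_table (\<lambda>t s. (\<forall>i<n. \<forall>t<T. s 17 (ad2 i t) = SU i t) \<and> t \<le> (230 + 20) * (Suc n * Suc n)) s0"
    unfolding succ_table_def SU_def
  proof (rule wp_For[where I = "\<lambda>k s. \<forall>i<k. ?I i n s"], goal_cases)
    case (2 s)
    then show ?case using baseD(1)[OF b] by (simp add: agree_def succ_row_def)
  next
    case (4 k s)
    have bs: "base s" using base_agree[OF b 4(4)] by (simp add: succ_row_def)
    show ?case
      unfolding wp_Seq
    proof (rule wp_use[OF init[OF bs 4(1,3)]], goal_cases)
      case (1 t1 s1)
      have b1: "base s1" using base_agree[OF bs 1(2)] by simp
      have k: "s1 30 0 = k" using 1(2) 4(3) by (simp add: agree_def)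
      show ?case
      proof (rule wp_use[OF row[OF b1 4(1) k]], goal_cases)
        case (2 t2 s2)
        have "?I i n s2" if "i < Suc k" for i
          using 1(1) 2(1) 4(2) that by (cases "i = k") auto
        moreover have "t1 + t2 \<le> 230 * Suc n" using 1(1) 2(1) T_le by auto
        ultimately show ?case by auto
      qed (use 1 in blast)
    qed
  qed (auto simp: succ_row_def SU_def)
  then show ?thesis by (rule wp_use) (auto simp: SU_def)
qed

lemma wp_range_table:
  assumes b: "base s0" and su: "\<And>i t. i < n \<Longrightarrow> t < T \<Longrightarrow> s0 17 (ad2 i t) = SU i t"
  shows "wp range_table (\<lambda>t s. (\<forall>p<n. \<forall>q\<le>n. \<forall>t<T. s 18 (ad3 p q t) = RM p q t) \<and>
    t \<le> 500 * (Suc n * (Suc n * Suc T))) s0"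
proof -
  let ?J = "\<lambda>s1 p s. \<forall>p'. p' \<noteq> p \<longrightarrow> (\<forall>q\<le>n. \<forall>t<T. s 18 (ad3 p' q t) = s1 18 (ad3 p' q t))"
  let ?I = "\<lambda>p k s. \<forall>q<k. \<forall>t<T. s 18 (ad3 p q t) = RM p q t"
  have inj: "ad3 p q t = ad3 p' q' t' \<longleftrightarrow> p = p' \<and> q = q' \<and> t = t'"
    if "t < T" "t' < T" "q \<le> n" "q' \<le> n" for p p' q q' t t'
    using that T_le by (intro ad3_inj) auto
  have init: "wp (For 39 (V 7) (Store 18 (ix3 (V 30) (Const 0) (V 39)) (V 0))) (\<lambda>t s. (?I p (Suc 0) s \<and> ?J s1 p s) \<and>
      t \<le> (60 + 20) * (Suc T * 1)) s1"
    if b1: "base s1" and p: "p < n" "s1 30 0 = p" for s1 p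
    unfolding less_Suc0 simp_thms
  proof (rule wp_For[where I = "\<lambda>k s. (\<forall>t<k. s 18 (ad3 p 0 t) = RM p 0 t) \<and> ?J s1 p s"], goal_cases)
    case (2 s)
    then show ?case using baseD(4)[OF b1] by (simp add: agree_def)
  next
    case (4 k s)
    have bs: "base s" using base_agree[OF b1 4(4)] by simp
    have e: "s 30 = s1 30" using 4(4) by (simp add: agree_def)
    show ?case
      using 4 bs e p by (auto simp: aval_ix3 baseD inj less_Suc_eq)
  qed auto
  have cell: "wp range_cell (\<lambda>t s. (?I p (Suc (Suc q)) s \<and> ?J s1 p s) \<and> t \<le> (120 + 20) * (Suc T * 1)) s1"
    if b1: "base s1" and p: "p < n" "s1 30 0 = p" and q: "q < n" "s1 31 0 = q" and I: "?I p (Suc q) s1"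
      and su: "\<And>i t. i < n \<Longrightarrow> t < T \<Longrightarrow> s1 17 (ad2 i t) = SU i t" for s1 p q
  proof -
    have "wp range_cell (\<lambda>t s. (?I p (Suc q) s \<and> (\<forall>t<T. s 18 (ad3 p (Suc q) t) = RM p (Suc q) t) \<and> ?J s1 p s) \<and>
       t \<le> (120 + 20) * (Suc T * 1)) s1"
      unfolding range_cell_def
    proof (rule wp_For[where I = "\<lambda>k s. ?I p (Suc q) s \<and> (\<forall>t<k. s 18 (ad3 p (Suc q) t) = RM p (Suc q) t) \<and> ?J s1 p s"], goal_cases)
      case (2 s)
      then show ?case using baseD(4)[OF b1] by (simp add: agree_def)
    next
      case (4 k s)
      have bs: "base s" using base_agree[OF b1 4(4)] by simp
      have e: "s 30 = s1 30" "s 31 = s1 31" "s 17 = s1 17" using 4(4) by (simp_all add: agree_def)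
      have a: "aval (ix3 (V 30) (Add (V 31) (Const 1)) (V 39)) s = ad3 p (Suc q) k"
        "aval (ix3 (V 30) (V 31) (V 39)) s = ad3 p q k" "aval (ix2 (V 31) (V 39)) s = ad2 q k"
        using aval_ix3[OF bs] aval_ix2[OF bs] e p q 4(3) by simp_all
      have "s 18 (ad3 p q k) = RM p q k" using 4(1,2) by simp
      then show ?case
        unfolding wp_Store wp_If a
        using 4 e p q su a by (auto simp: inj less_Suc_eq baseD[OF bs])
    qed (use I in auto)
    then show ?thesis by (rule wp_use) (auto simp: less_Suc_eq)
  qed
  have row: "wp range_row (\<lambda>t s. (?I p (Suc n) s \<and> ?J s1 p s) \<and> t \<le> 260 * (Suc n * Suc T)) s1"
    if b1: "base s1" and p: "p < n" "s1 30 0 = p"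
      and su: "\<And>i t. i < n \<Longrightarrow> t < T \<Longrightarrow> s1 17 (ad2 i t) = SU i t" for s1 p
    unfolding range_row_def wp_Seq
  proof (rule wp_use[OF init[OF b1 p]], goal_cases)
    case (1 t2 s2)
    have b2: "base s2" using base_agree[OF b1 1(2)] by simp
    have e2: "s2 30 = s1 30" "s2 17 = s1 17" using 1(2) by (simp_all add: agree_def)
    have "wp (For 31 (V 0) range_cell) (\<lambda>t s. (?I p (Suc n) s \<and> ?J s1 p s) \<and> t \<le> (140 + 20) * (Suc n * Suc T)) s2"
    proof (rule wp_For[where I = "\<lambda>k s. ?I p (Suc k) s \<and> ?J s1 p s"], goal_cases)
      case (2 s)
      then show ?case using baseD(1)[OF b2] by (simp add: agree_def range_cell_def)
    next
      case (4 k s)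
      have bs: "base s" using base_agree[OF b2 4(4)] by (simp add: range_cell_def)
      have e: "s 30 0 = p" "\<And>i t. i < n \<Longrightarrow> t < T \<Longrightarrow> s 17 (ad2 i t) = SU i t"
        using 4(4) e2 p su by (simp_all add: agree_def range_cell_def)
      have "wp range_cell (\<lambda>t s'. (?I p (Suc (Suc k)) s' \<and> ?J s p s') \<and> t \<le> (120 + 20) * (Suc T * 1)) s"
        by (rule cell[OF bs p(1) e(1) 4(1,3)]) (use 4(2) e(2) in auto)
      then show ?case by (rule wp_use) (use 4(2) in auto)
    qed (use 1 in \<open>auto simp: range_cell_def\<close>)
    then show ?case
    proof (rule wp_use, goal_cases)
      case (1 t3 s3)
      define X where "X = Suc n * Suc T"
      have "Suc T \<le> X" by (simp add: X_def)
      moreover have "t3 \<le> 160 * X" using 1(1) by (simp add: X_def)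
      moreover have "t2 \<le> 80 * Suc T"
        using \<open>(?I p (Suc 0) s2 \<and> ?J s1 p s2) \<and> t2 \<le> (60 + 20) * (Suc T * 1)\<close> by simp
      ultimately have "t2 + t3 \<le> 260 * X" by simp
      then show ?case using 1(1) unfolding X_def by blast
    qed
  qed
  have "wp range_table (\<lambda>t s. (\<forall>p<n. ?I p (Suc n) s) \<and> t \<le> (260 + 20) * (Suc n * (Suc n * Suc T))) s0"
    unfolding range_table_def
  proof (rule wp_For[where I = "\<lambda>k s. \<forall>p<k. ?I p (Suc n) s"], goal_cases)
    case (2 s)
    then show ?case using baseD(1)[OF b] by (simp add: agree_def range_row_def range_cell_def)
  next
    case (4 k s)
    have bs: "base s" using base_agree[OF b 4(4)] by (simp add: range_row_def range_cell_def)
    have su': "\<And>i t. i < n \<Longrightarrow> t < T \<Longrightarrow> s 17 (ad2 i t) = SU i t"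
      using 4(4) su by (simp add: agree_def range_row_def range_cell_def)
    show ?case
    proof (rule wp_use[OF row[OF bs 4(1,3) su']], goal_cases)
      case (3 t s')
      have "?I p (Suc n) s'" if "p < Suc k" for p
        using 3(1) 4(2) that by (cases "p = k") auto
      then show ?case using 3(1) by simp
    qed auto
  qed (auto simp: range_row_def range_cell_def)
  then show ?thesis by (rule wp_use) (auto simp: less_Suc_eq_le)
qed

end

section \<open>Computing the least candidate sets\<close>

text \<open>If there is no acquire, cell 34 is 0 and the truncated subtraction makes the lookup read
  entry 0; the test of cell 34 discards the outcome. Likewise, if cell 36 holds \<open>n\<close>,
  the last tests read cells outside the table, but the conjunction is already false.\<close>

definition scan_cell :: com where
  "scan_cell = Seq (Set 34 (Load 15 (ix3 (Load 20 (V 38)) (V 38) (V 37))))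
     (Seq (Set 36 (Load 12 (Sub (V 34) (Const 1))))
     (If (Conj (Less (Const 0) (V 34)) (Conj (Less (V 36) (V 0)) (Conj (Neg (Less (V 36) (Load 20 (V 38))))
          (Conj (Neg (Less (V 30) (Load 14 (ix2 (V 36) (Load 8 (V 30))))))
                (Neg (Less (V 32) (Load 14 (ix2 (V 36) (Load 8 (V 32))))))))))
       (Set 33 (Add (V 36) (Const 1))) Skip))"

definition scan :: com where
  "scan = Seq (Set 33 (Const 0)) (For 38 (V 7) (For 37 (V 10) scan_cell))"

text \<open>An iteration either repairs one missing release or, if none is missing, stores the
  finished set and moves on. Events of other threads are passed over without a scan.\<close>

definition sweep_step :: com where
  "sweep_step = If (Eq (Load 8 (V 32)) (V 31))
     (Seq scan (If (Less (Const 0) (V 33))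
       (Seq (Set 33 (Sub (V 33) (Const 1))) (join_v 33))
       (Seq (copy_v 19 (ix3 (V 30) (V 32) (V 39))) (Seq (join_v 32) (Set 32 (Add (V 32) (Const 1)))))))
     (Set 32 (Add (V 32) (Const 1)))"

definition sweep_start :: com where
  "sweep_start = Seq clear_v
     (For 36 (V 30) (If (Eq (Load 8 (V 36)) (Load 8 (V 30))) (join_v 36) Skip))"

definition sweep_run :: com where
  "sweep_run = Seq sweep_start (Seq (Set 32 (Const 0)) (While (Less (V 32) (V 0)) sweep_step))"

definition sweep_all :: com where
  "sweep_all = For 30 (V 0) (For 31 (V 7) sweep_run)"

lemma mods_scan [simp]: "mods scan = {33, 34, 36, 37, 38}"
  by (auto simp: scan_def scan_cell_def)

context coded_trace
begin

definition tables :: "store \<Rightarrow> bool" where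
  "tables s \<longleftrightarrow> base s \<and> (\<forall>a<n. s 12 a = M a) \<and> (\<forall>i<n. vec (\<lambda>t. s 14 (ad2 i t)) (TRC i)) \<and>
     (\<forall>q\<le>n. \<forall>t<T. \<forall>l<L. s 15 (ad3 q t l) = LA q t l \<and> s 16 (ad3 q t l) = LR q t l) \<and>
     (\<forall>p<n. \<forall>q\<le>n. \<forall>t<T. s 18 (ad3 p q t) = RM p q t)"

lemma tables_agree:
  assumes "tables s" "agree A s s'" "A \<inter> {0, 3, 4, 5, 7, 8, 10, 11, 12, 14, 15, 16, 18} = {}"
  shows "tables s'"
proof -
  have "s' a = s a" if "a \<in> {0, 3, 4, 5, 7, 8, 10, 11, 12, 14, 15, 16, 18}" for a
    using assms(2,3) that by (auto simp: agree_def)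
  then show ?thesis using assms(1) by (simp add: tables_def base_def)
qed

lemma tables_base: "tables s \<Longrightarrow> base s"
  by (simp add: tables_def)

text \<open>As \<open>r\<close> lies in the same thread as its acquire, comparing it with the single
  entry \<open>v t\<close> decides whether it is absent.\<close>

definition missing :: "(nat \<Rightarrow> nat) \<Rightarrow> nat \<Rightarrow> nat \<Rightarrow> nat \<Rightarrow> nat \<Rightarrow> nat \<Rightarrow> bool" where
  "missing v i1 j t l r \<longleftrightarrow> (\<exists>a. LA (v t) t l = Suc a \<and> M a = r \<and> r < n \<and> \<not> r < v t \<and> i1 \<notin> TRC r \<and> j \<notin> TRC r)"

lemma missing_sound:
  assumes "vec v S" "missing v i1 j t l r" "t < T"
  obtains a where "a \<in> S" "mt a r" "r \<notin> S" "i1 \<notin> TRC r" "j \<notin> TRC r"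
proof -
  obtain a where a: "LA (v t) t l = Suc a" "M a = r" "r < n" "\<not> r < v t" "i1 \<notin> TRC r" "j \<notin> TRC r"
    using assms(2) by (auto simp: missing_def)
  then have "a < v t" "tn a = t" by (auto simp: LA_eq_Suc)
  then have "a < n" using vec_le[OF assms(1,3)] by simp
  then have "a \<in> S" "mt a r" using vecD[OF assms(1)] a M_iff \<open>a < v t\<close> \<open>tn a = t\<close> by auto
  moreover have "r \<notin> S" using mt_thread[OF \<open>mt a r\<close>] \<open>tn a = t\<close> a vecD[OF assms(1)] by simp
  ultimately show thesis using that a by blast
qed

lemma missing_complete:
  assumes S: "vec v S" "dep_closed S" and a: "a \<in> S" "mt a r" "r \<notin> S" "i1 \<notin> TRC r" "j \<notin> TRC r"
  shows "missing v i1 j (tn a) (lk a) r"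
proof -
  have an: "a < n" "oc a = 2" "r < n" using a(2) by (auto simp: mt_def)
  have "\<not> mt a r'" if "r' \<in> S" for r' using mt_unique_right[OF a(2)] that a(3) by blast
  then have "LA (v (tn a)) (tn a) (lk a) = Suc a" using LA_unmatched[OF S a(1) an(2)] by blast
  moreover have "\<not> r < v (tn a)" using vecD[OF S(1) an(3)] a(3) mt_thread[OF a(2)] by simp
  ultimately show ?thesis using a an M_iff by (auto simp: missing_def)
qed

text \<open>The scan does not stop at a hit; later hits overwrite cell 33, since any missing release
  will do. The stored value is shifted by one, so that 0 reports that nothing is missing.\<close>

lemma wp_scan:
  assumes tb: "tables s0" and v: "vec (s0 20) S" and cl: "dep_closed S"
    and i: "s0 30 0 = i1" "i1 < n" "s0 32 0 = j" "j < n"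
  shows "wp scan (\<lambda>t s. (s 33 0 = 0 \<and> (\<forall>a\<in>S. \<forall>r. mt a r \<and> i1 \<notin> TRC r \<and> j \<notin> TRC r \<longrightarrow> r \<in> S) \<or>
       (\<exists>a\<in>S. \<exists>r. mt a r \<and> r \<notin> S \<and> i1 \<notin> TRC r \<and> j \<notin> TRC r \<and> s 33 0 = Suc r)) \<and>
     t \<le> 200 * (Suc T * Suc L)) s0"
proof -
  let ?v = "s0 20"
  let ?G = "\<lambda>s. \<exists>t<T. \<exists>l. \<exists>r. missing ?v i1 j t l r \<and> s 33 0 = Suc r"
  let ?I = "\<lambda>k s. s 33 0 = 0 \<and> (\<forall>t<k. \<forall>l<L. \<forall>r. \<not> missing ?v i1 j t l r) \<or> ?G s"
  let ?J = "\<lambda>t k s. s 33 0 = 0 \<and> (\<forall>t'<t. \<forall>l<L. \<forall>r. \<not> missing ?v i1 j t' l r) \<and>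
      (\<forall>l<k. \<forall>r. \<not> missing ?v i1 j t l r) \<or> ?G s"
  have row: "wp (For 37 (V 10) scan_cell) (\<lambda>u s. ?J t L s \<and> u \<le> (120 + 20) * (Suc L * 1)) s1"
    if t: "t < T" "s1 38 0 = t" and ag: "agree {33, 34, 36, 37, 38} s0 s1" and I: "?I t s1" for s1 t
  proof (rule wp_For[where I = "?J t"], goal_cases)
    case (2 s)
    then show ?case using ag tables_base[OF tb] baseD(6) by (simp add: agree_def scan_cell_def)
  next
    case (4 k s)
    have ag': "agree {33, 34, 36, 37, 38} s0 s"
      using agree_trans[OF ag 4(4)] by (simp add: scan_cell_def)
    have ts: "tables s" by (rule tables_agree[OF tb ag']) simp
    have e: "s 20 = ?v" "s 30 0 = i1" "s 32 0 = j" using ag' i by (auto simp: agree_def)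
    have bs: "base s" using ts by (rule tables_base)
    have t38: "s 38 0 = t" using 4(4) t by (simp add: agree_def scan_cell_def)
    have vt: "?v t \<le> n" using vec_le[OF v t(1)] .
    let ?a = "LA (?v t) t k"
    have a: "aval (Load 15 (ix3 (Load 20 (V 38)) (V 38) (V 37))) s = ?a"
      using ts 4(1,3) t(1) t38 e vt T_le by (simp add: aval_ix3[OF bs] tables_def)
    define s2 where "s2 = upd s 34 0 ?a"
    have b2: "base s2" using base_agree[OF bs, of "{34}" s2] by (simp add: s2_def)
    \<comment> \<open>Even for \<open>?a = 0\<close> the lookup stays inside the table, because the
      trace contains \<open>i1\<close> and is not empty.\<close>
    have an: "?a - 1 < n"
    proof -
      have "?a \<le> n" using flast_le vt unfolding LA_def by (rule order_trans)
      then show ?thesis using i by linarith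
    qed
    have M: "aval (Load 12 (Sub (V 34) (Const 1))) s2 = M (?a - 1)"
      using ts an by (simp add: s2_def tables_def)
    define r where "r = M (?a - 1)"
    define s3 where "s3 = upd s2 36 0 r"
    have b3: "base s3" using base_agree[OF b2, of "{36}" s3] by (simp add: s3_def)
    have c: "bval (Conj (Less (Const 0) (V 34)) (Conj (Less (V 36) (V 0)) (Conj (Neg (Less (V 36) (Load 20 (V 38))))
          (Conj (Neg (Less (V 30) (Load 14 (ix2 (V 36) (Load 8 (V 30))))))
                (Neg (Less (V 32) (Load 14 (ix2 (V 36) (Load 8 (V 32)))))))))) s3 \<longleftrightarrow>
        missing ?v i1 j t k r" (is "?l \<longleftrightarrow> _")
    proof (cases "r < n")
      case True
      have vr: "vec (\<lambda>t. s3 14 (ad2 r t)) (TRC r)" using ts True by (simp add: s3_def s2_def tables_def)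
      have "i1 \<in> TRC r \<longleftrightarrow> i1 < s3 14 (ad2 r (tn i1))" "j \<in> TRC r \<longleftrightarrow> j < s3 14 (ad2 r (tn j))"
        using vecD[OF vr] i by auto
      moreover have "s3 30 0 = i1" "s3 32 0 = j" "s3 36 0 = r" "s3 34 0 = ?a" "s3 38 0 = t" "s3 20 = ?v"
        using e t38 by (simp_all add: s3_def s2_def)
      moreover have "missing ?v i1 j t k r \<longleftrightarrow> 0 < ?a \<and> \<not> r < ?v t \<and> i1 \<notin> TRC r \<and> j \<notin> TRC r"
        using True unfolding missing_def r_def by (cases ?a) auto
      ultimately show ?thesis using True i by (simp add: aval_ix2[OF b3] baseD[OF b3])
    next
      case False
      moreover have "s3 36 0 = r" by (simp add: s3_def)
      ultimately show ?thesis by (simp add: baseD[OF b3] missing_def)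
    qed
    have no: "\<not> missing ?v i1 j t k r'" if "\<not> missing ?v i1 j t k r" for r'
    proof
      assume m: "missing ?v i1 j t k r'"
      then have "r' = r" by (auto simp: missing_def r_def)
      then show False using m that by simp
    qed
    have s33: "s3 33 0 = s 33 0" by (simp add: s3_def s2_def)
    have J: "?J t (Suc k) s'" if "s' 33 0 = (if missing ?v i1 j t k r then Suc r else s 33 0)" for s' :: store
    proof (cases "missing ?v i1 j t k r")
      case True
      then have "?G s'" using that t(1) by auto
      then show ?thesis by blast
    next
      case False
      then have "s' 33 0 = s 33 0" using that by simp
      then show ?thesis using 4(2) no[OF False] by (auto simp: less_Suc_eq)
    qed
    have z: "aval (Const 0) s = 0" for s :: store by simp
    show ?case
      unfolding scan_cell_def wp_Seq wp_Store z a s2_def[symmetric] M r_def[symmetric] s3_def[symmetric] wp_If c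
    proof (intro conjI impI, goal_cases)
      case 1
      have x: "aval (Add (V 36) (Const 1)) s3 = Suc r" by (simp add: s3_def)
      have "?J t (Suc k) (upd (upd s3 33 0 (Suc r)) 37 0 (Suc k))" by (rule J) (use 1 in simp)
      then show ?case unfolding aval.simps(1) x .
    next
      case 3
      have "?J t (Suc k) (upd s3 37 0 (Suc k))" by (rule J) (use 3 s33 in simp)
      then show ?case unfolding wp_Skip by simp
    qed simp_all
  qed (use I in \<open>auto simp: scan_cell_def\<close>)
  have W: "wp (For 38 (V 7) (For 37 (V 10) scan_cell)) (\<lambda>u s. ?I T s \<and> u \<le> (140 + 20) * (Suc T * Suc L)) (upd s0 33 0 0)"
  proof (rule wp_For[where I = ?I], goal_cases)
    case (2 s)
    then show ?case using baseD(4)[OF tables_base[OF tb]] by (simp add: agree_def scan_cell_def)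
  next
    case (4 k s)
    have ag: "agree {33, 34, 36, 37, 38} s0 s"
      using agree_trans[OF _ 4(4), of "{33}" s0 "{33, 34, 36, 37, 38}"] by (simp add: scan_cell_def)
    show ?case
      by (rule wp_use[OF row[OF 4(1,3) ag 4(2)]]) (auto simp: less_Suc_eq)
  qed (auto simp: scan_cell_def)
  show ?thesis
    unfolding scan_def wp_Seq wp_Store aval.simps
  proof (rule wp_use[OF W], goal_cases)
    case (1 t s)
    have "(\<forall>a\<in>S. \<forall>r. mt a r \<and> i1 \<notin> TRC r \<and> j \<notin> TRC r \<longrightarrow> r \<in> S)" if "\<forall>t<T. \<forall>l<L. \<forall>r. \<not> missing ?v i1 j t l r"
    proof (intro ballI allI impI, elim conjE, rule ccontr)
      fix a r assume a: "a \<in> S" "mt a r" "i1 \<notin> TRC r" "j \<notin> TRC r" "r \<notin> S"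
      then have "missing ?v i1 j (tn a) (lk a) r" using missing_complete[OF v cl] by blast
      moreover have "tn a < T" "lk a < L" using a(2) tn_less lk_less by (auto simp: mt_def)
      ultimately show False using that by blast
    qed
    moreover have "\<exists>a\<in>S. \<exists>r. mt a r \<and> r \<notin> S \<and> i1 \<notin> TRC r \<and> j \<notin> TRC r \<and> s 33 0 = Suc r" if "?G s"
      using that missing_sound[OF v] by metis
    moreover have "t \<le> 160 * (Suc T * Suc L)" using 1(1) by simp
    moreover have "1 \<le> Suc T * Suc L" by simp
    ultimately show ?case using 1(1) by auto
  qed
qed

end

lemma mods_sweep_step [simp]: "mods sweep_step = {19, 20, 32, 33, 34, 36, 37, 38, 39}"
  by (auto simp: sweep_step_def clear_v_def copy_v_def join_v_def)

context coded_trace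
begin

text \<open>Recovers the set from its vector, so that a measure on stores can refer to its
  size.\<close>

definition set_of :: "(nat \<Rightarrow> nat) \<Rightarrow> nat set" where
  "set_of v = {f. f < n \<and> f < v (tn f)}"

lemma set_of_vec: "vec v S \<Longrightarrow> set_of v = S"
  by (auto simp: vec_def set_of_def)

lemma wp_sweep_start:
  assumes tb: "tables s0" and i: "s0 30 0 = i1" "i1 < n"
  shows "wp sweep_start (\<lambda>t s. vec (s 20) (\<Union>i\<in>{i. i < i1 \<and> tn i = tn i1}. TRC i) \<and>
    t \<le> 300 * (Suc n * Suc T)) s0"
  unfolding sweep_start_def wp_Seq
proof (rule wp_use[OF wp_clear_v[OF tables_base[OF tb]]], goal_cases)
  case (1 t1 s1)
  have t1: "tables s1" by (rule tables_agree[OF tb 1(2)]) simp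
  have i1: "s1 30 0 = i1" using 1(2) i by (simp add: agree_def)
  let ?U = "\<lambda>k. \<Union>i\<in>{i. i < k \<and> tn i = tn i1}. TRC i"
  have "wp (For 36 (V 30) (If (Eq (Load 8 (V 36)) (Load 8 (V 30))) (join_v 36) Skip))
     (\<lambda>t s. vec (s 20) (?U i1) \<and> t \<le> (120 + 20) * (Suc i1 * Suc T)) s1"
  proof (rule wp_For[where I = "\<lambda>k s. vec (s 20) (?U k)"], goal_cases)
    case (2 s)
    then show ?case using i1 by (simp add: agree_def)
  next
    case 3
    have "vec (s1 20) {}" using vec_empty 1(1) by (auto intro: vec_cong)
    then show ?case by simp
  next
    case (4 k s)
    have ts: "tables s" by (rule tables_agree[OF t1 4(4)]) simp
    have bs: "base s" using ts by (rule tables_base)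
    have kn: "k < n" using 4 i by simp
    have e: "s 30 0 = i1" using 4(4) i1 by (simp add: agree_def)
    have c: "bval (Eq (Load 8 (V 36)) (Load 8 (V 30))) s \<longleftrightarrow> tn k = tn i1"
      using e 4(3) kn i by (simp add: baseD[OF bs])
    have U: "?U (Suc k) = (if tn k = tn i1 then ?U k \<union> TRC k else ?U k)"
      by (auto simp: less_Suc_eq)
    have "wp (join_v 36) (\<lambda>t s. vec (s 20) (?U k \<union> TRC k) \<and> t \<le> 80 * Suc T) s"
      by (rule wp_join_v[OF bs _ 4(3) kn]) (use 4(2) kn ts in \<open>auto simp: tables_def\<close>)
    then show ?case
      unfolding wp_If c by (auto simp: U 4 elim!: wp_use)
  qed auto
  then show ?case
  proof (rule wp_use, goal_cases)
    case (1 t2 s2)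
    have "140 * (Suc i1 * Suc T) \<le> 140 * (Suc n * Suc T)" using i by (intro mult_le_mono) auto
    moreover have "40 * Suc T \<le> 40 * (Suc n * Suc T)" by simp
    moreover have "t1 \<le> 40 * Suc T" using \<open>(\<forall>t<T. s1 20 t = 0) \<and> t1 \<le> 40 * Suc T\<close> by blast
    moreover have "t2 \<le> 140 * (Suc i1 * Suc T)" using 1(1) by simp
    ultimately have "t1 + t2 \<le> 40 * (Suc n * Suc T) + 140 * (Suc n * Suc T)" by (meson add_mono order_trans)
    also have "\<dots> \<le> 300 * (Suc n * Suc T)" by simp
    finally show ?case using 1(1) by blast
  qed
qed

text \<open>The last conjunct protects the rows for other first events and other threads, which
  belong to separate sweeps.\<close>

definition sweep_inv :: "nat \<Rightarrow> nat \<Rightarrow> store \<Rightarrow> store \<Rightarrow> bool" where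
  "sweep_inv i1 t2 s0 s \<longleftrightarrow> agree {19, 20, 32, 33, 34, 36, 37, 38, 39} s0 s \<and> s 32 0 \<le> n \<and>
     (\<exists>S. sweep i1 t2 (s 32 0) S \<and> vec (s 20) S) \<and>
     (\<forall>j<s 32 0. tn j = t2 \<longrightarrow> vec (\<lambda>t. s 19 (ad3 i1 j t)) (Cl i1 j)) \<and>
     (\<forall>i j. j < n \<and> \<not> (i = i1 \<and> tn j = t2) \<longrightarrow> (\<forall>t<T. s 19 (ad3 i j t) = s0 19 (ad3 i j t)))"

text \<open>Second events still to come plus events still outside the set, hence at most
  \<open>2 * n\<close>. This amortizes the closure steps over a whole sweep.\<close>

definition sweep_measure :: "store \<Rightarrow> nat" where
  "sweep_measure s = (n - s 32 0) + (n - card (set_of (s 20)))"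

lemma sweep_closed: "sweep i1 t2 j S \<Longrightarrow> dep_closed S"
  by (simp add: sweep_def)

lemma card_le: "vec v S \<Longrightarrow> card S \<le> n"
  using card_mono[of "{..<n}" S] by (simp add: vec_def)

text \<open>Joining the closure of a missing release enlarges the set, since the release itself is
  new. In the other cases the second event advances, and the set never shrinks.\<close>

lemma wp_sweep_step:
  assumes tb: "tables s0" and i: "s0 30 0 = i1" "i1 < n" "s0 31 0 = t2"
    and J: "sweep_inv i1 t2 s0 s" and j: "s 32 0 < n"
  shows "wp sweep_step (\<lambda>t s'. (sweep_inv i1 t2 s0 s' \<and> sweep_measure s' < sweep_measure s) \<and>
    t \<le> 500 * (Suc T * Suc L)) s"
proof -
  define j where "j = s 32 0"
  have jn: "j < n" using j by (simp add: j_def)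
  have ag: "agree {19, 20, 32, 33, 34, 36, 37, 38, 39} s0 s"
    and rows: "\<And>j'. j' < j \<Longrightarrow> tn j' = t2 \<Longrightarrow> vec (\<lambda>t. s 19 (ad3 i1 j' t)) (Cl i1 j')"
    and other: "\<And>i j t. j < n \<Longrightarrow> \<not> (i = i1 \<and> tn j = t2) \<Longrightarrow> t < T \<Longrightarrow> s 19 (ad3 i j t) = s0 19 (ad3 i j t)"
    using J by (auto simp: sweep_inv_def j_def)
  obtain S where S: "sweep i1 t2 j S" "vec (s 20) S" using J by (auto simp: sweep_inv_def j_def)
  have ts: "tables s" by (rule tables_agree[OF tb ag]) simp
  have bs: "base s" using ts by (rule tables_base)
  have e: "s 30 0 = i1" "s 31 0 = t2" using ag i by (simp_all add: agree_def)
  have X: "Suc T \<le> Suc T * Suc L" "1 \<le> Suc T * Suc L" by simp_all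
  have c: "bval (Eq (Load 8 (V 32)) (V 31)) s \<longleftrightarrow> tn j = t2"
    using e jn j_def by (simp add: baseD[OF bs])
  show ?thesis
  proof (cases "tn j = t2")
    case False
    have "sweep i1 t2 (Suc j) S" using sweep_skip[OF S(1) False] .
    then have "sweep_inv i1 t2 s0 (upd s 32 0 (Suc j))"
      using ag rows other S(2) jn False unfolding sweep_inv_def
      by (auto simp: less_Suc_eq)
    moreover have "sweep_measure (upd s 32 0 (Suc j)) < sweep_measure s"
      using jn by (simp add: sweep_measure_def j_def)
    ultimately show ?thesis
      unfolding sweep_step_def wp_If c using False X(2) by (simp add: j_def)
  next
    case True
    show ?thesis
      unfolding sweep_step_def wp_If c wp_Seq
    proof (intro conjI impI, goal_cases)
      case 1
      show ?case
      proof (rule wp_use[OF wp_scan[OF ts S(2) sweep_closed[OF S(1)] e(1) i(2) j_def[symmetric] jn]], goal_cases)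
        case (1 u1 s1)
        have ag1: "agree {19, 20, 32, 33, 34, 36, 37, 38, 39} s0 s1"
          using agree_trans[OF ag 1(2)] by simp
        have ts1: "tables s1" by (rule tables_agree[OF ts 1(2)]) simp
        have e1: "s1 30 0 = i1" "s1 32 0 = j" "s1 20 = s 20" "s1 19 = s 19"
          using 1(2) e j_def by (simp_all add: agree_def)
        have u1: "u1 \<le> 200 * (Suc T * Suc L)" using 1(1) by blast
        show ?case
        proof (intro conjI impI, goal_cases)
          case 1
          then obtain a r where a: "a \<in> S" "mt a r" "r \<notin> S" "i1 \<notin> TRC r" "j \<notin> TRC r" "s1 33 0 = Suc r"
            using \<open>(_ \<or> _) \<and> u1 \<le> _\<close> by auto
          have r: "r < n" using a(2) by (simp add: mt_def)
          let ?s = "upd s1 33 0 r"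
          have ts2: "tables ?s" by (rule tables_agree[OF ts1, of "{33}"]) simp_all
          have "wp (join_v 33) (\<lambda>t s. vec (s 20) (S \<union> TRC r) \<and> t \<le> 80 * Suc T) ?s"
            by (rule wp_join_v[OF tables_base[OF ts2] _ _ r]) (use ts2 r e1 S(2) in \<open>auto simp: tables_def\<close>)
          then have "wp (join_v 33) (\<lambda>t s'. (sweep_inv i1 t2 s0 s' \<and> sweep_measure s' < sweep_measure s) \<and>
              t \<le> 80 * Suc T) ?s"
          proof (rule wp_use, goal_cases)
            case (1 u2 s2)
            have ag2: "agree {19, 20, 32, 33, 34, 36, 37, 38, 39} s0 s2"
              using agree_trans[OF _ 1(2), of "{19, 20, 32, 33, 34, 36, 37, 38, 39}" s0] ag1 by simp
            have e2: "s2 32 0 = j" "s2 19 = s 19" using 1(2) e1 by (simp_all add: agree_def)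
            have "sweep i1 t2 j (S \<union> TRC r)" using sweep_add[OF S(1) i(2) jn True a(1,2,4,5)] .
            then have "sweep_inv i1 t2 s0 s2"
              using 1(1) ag2 e2 rows other jn unfolding sweep_inv_def by auto
            moreover have "card S < card (S \<union> TRC r)"
              using 1(1) a(3) TRC_refl[of r]
              by (intro psubset_card_mono) (auto simp: vec_def dest: finite_subset)
            then have "sweep_measure s2 < sweep_measure s"
              using set_of_vec[OF S(2)] set_of_vec[of "s2 20" "S \<union> TRC r"] 1(1) e2 card_le[of "s2 20" "S \<union> TRC r"]
              by (simp add: sweep_measure_def j_def)
            ultimately show ?case using 1(1) by blast
          qed
          then show ?case
            unfolding wp_Store using a(6)
          proof (simp, elim wp_use, goal_cases)
            case (1 u2 s2)
            have "u2 \<le> 80 * (Suc T * Suc L)" using 1 by simp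
            then show ?case using 1 u1 X(2) by simp
          qed
        next
          case 2
          then have no: "r \<in> S" if "a \<in> S" "mt a r" "i1 \<notin> TRC r" "j \<notin> TRC r" for a r
            using \<open>(_ \<or> _) \<and> u1 \<le> _\<close> that by auto
          have C: "S = Cl i1 j" "sweep i1 t2 (Suc j) (S \<union> TRC j)"
            using sweep_done[OF S(1) i(2) jn True no] by auto
          have inj: "inj_on (ad3 i1 j) {..<T}" using T_le jn by (auto simp: inj_on_def ad3_inj)
          show ?case
          proof (rule wp_use[OF wp_copy_v[OF tables_base[OF ts1], where f = "ad3 i1 j"]], goal_cases)
            case (1 s' k)
            have "base s'" using base_agree[OF tables_base[OF ts1] 1(1)] by simp
            moreover have "s' 30 0 = i1" "s' 32 0 = j" using 1(1) e1 by (simp_all add: agree_def)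
            ultimately show ?case using 1 jn i by (simp add: aval_ix3)
          next
            case (5 u2 s2)
            have ag2: "agree {19, 20, 32, 33, 34, 36, 37, 38, 39} s0 s2"
              using agree_trans[OF ag1 5(2)] by simp
            have ts2: "tables s2" by (rule tables_agree[OF ts1 5(2)]) simp
            have e2: "s2 30 0 = i1" "s2 32 0 = j" "s2 20 = s 20"
              using 5(2) e1 by (simp_all add: agree_def)
            have new: "vec (\<lambda>t. s2 19 (ad3 i1 j t)) (Cl i1 j)"
              using S(2) 5(1) e1 C(1) by (auto intro: vec_cong)
            have old: "s2 19 (ad3 i' j' t) = s 19 (ad3 i' j' t)"
              if "j' < n" "i' \<noteq> i1 \<or> j' \<noteq> j" "t < T" for i' j' t
            proof -
              have "ad3 i' j' t \<notin> ad3 i1 j ` {..<T}" using that jn T_le by (auto simp: ad3_inj)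
              then show ?thesis using 5(1) e1 by simp
            qed
            have u2: "u2 \<le> 60 * Suc T" using 5(1) by blast
            have "wp (join_v 32) (\<lambda>t s. vec (s 20) (S \<union> TRC j) \<and> t \<le> 80 * Suc T) s2"
              by (rule wp_join_v[OF tables_base[OF ts2] _ e2(2) jn]) (use ts2 jn e2 S(2) in \<open>auto simp: tables_def\<close>)
            then show ?case
            proof (rule wp_use, goal_cases)
              case (1 u3 s3)
              have ag3: "agree {19, 20, 32, 33, 34, 36, 37, 38, 39} s0 s3"
                using agree_trans[OF ag2 1(2)] by simp
              have e3: "s3 32 0 = j" "s3 19 = s2 19" using 1(2) e2 by (simp_all add: agree_def)
              have "vec (\<lambda>t. s2 19 (ad3 i1 j' t)) (Cl i1 j')" if "j' < Suc j" "tn j' = t2" for j'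
              proof (cases "j' = j")
                case False
                then have "j' < j" using that by simp
                then show ?thesis using rows[of j'] that old[of j'] jn False by (auto intro: vec_cong)
              qed (use new in simp)
              moreover have "s2 19 (ad3 i' j' t) = s0 19 (ad3 i' j' t)"
                if "j' < n" "\<not> (i' = i1 \<and> tn j' = t2)" "t < T" for i' j' t
                using other[OF that] old[OF that(1) _ that(3), of i'] that True by auto
              ultimately have "sweep_inv i1 t2 s0 (upd s3 32 0 (Suc j))"
                unfolding sweep_inv_def using 1(1) ag3 e3 C(2) jn by auto
              moreover have "card S \<le> card (S \<union> TRC j)"
                using 1(1) by (intro card_mono) (auto simp: vec_def dest: finite_subset)
              then have "sweep_measure (upd s3 32 0 (Suc j)) < sweep_measure s"
                using set_of_vec[OF S(2)] set_of_vec[of "s3 20" "S \<union> TRC j"] 1(1) jn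
                by (simp add: sweep_measure_def j_def)
              moreover have "u3 \<le> 80 * Suc T" using 1(1) by blast
              moreover have "140 * Suc T \<le> 140 * (Suc T * Suc L)" by simp
              ultimately show ?case using e3 u1 u2 X(2) by simp
            qed
          qed (use inj in auto)
        qed
      qed
    qed (use True in simp)
  qed
qed

end

lemma mods_sweep_run [simp]:
  "mods sweep_run = {19, 20, 32, 33, 34, 36, 37, 38, 39}"
  "mods sweep_start = {20, 36, 39}"
  by (auto simp: sweep_run_def sweep_start_def clear_v_def join_v_def)

context coded_trace
begin

lemma wp_sweep_loop:
  assumes tb: "tables s0" and i: "s0 30 0 = i1" "i1 < n" "s0 31 0 = t2" "s0 32 0 = 0"
    and S: "sweep i1 t2 0 S" "vec (s0 20) S"
  shows "wp (While (Less (V 32) (V 0)) sweep_step) (\<lambda>t s. ((\<forall>j<n. tn j = t2 \<longrightarrow> vec (\<lambda>t. s 19 (ad3 i1 j t)) (Cl i1 j)) \<and>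
     (\<forall>i j. j < n \<and> \<not> (i = i1 \<and> tn j = t2) \<longrightarrow> (\<forall>t<T. s 19 (ad3 i j t) = s0 19 (ad3 i j t)))) \<and>
     t \<le> 1300 * (Suc n * (Suc T * Suc L))) s0"
proof -
  define X where "X = Suc T * Suc L"
  have X1: "1 \<le> X" by (simp add: X_def)
  have "wp (While (Less (V 32) (V 0)) sweep_step)
      (\<lambda>t s. sweep_inv i1 t2 s0 s \<and> \<not> bval (Less (V 32) (V 0)) s \<and>
        t \<le> sweep_measure s0 * (600 * X) + 1 + bcost (Less (V 32) (V 0))) s0"
  proof (rule wp_While)
    show "sweep_inv i1 t2 s0 s0" using S i by (auto simp: sweep_inv_def)
    fix s assume J: "sweep_inv i1 t2 s0 s" and b: "bval (Less (V 32) (V 0)) s"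
    have "s 0 = s0 0" using J by (simp add: sweep_inv_def agree_def)
    then have "s 32 0 < n" using b baseD(1)[OF tables_base[OF tb]] by simp
    from wp_sweep_step[OF tb i(1,2,3) J this]
    show "wp sweep_step (\<lambda>t s'. sweep_inv i1 t2 s0 s' \<and>
        1 + bcost (Less (V 32) (V 0)) + t + sweep_measure s' * (600 * X) \<le> sweep_measure s * (600 * X)) s"
    proof (rule wp_use, goal_cases)
      case (1 t s')
      \<comment> \<open>Each unit of the measure is worth \<open>600 * X\<close>: at most
        \<open>500 * X\<close> for the body, and the rest covers the guard.\<close>
      have "Suc (sweep_measure s') * (600 * X) \<le> sweep_measure s * (600 * X)"
        using 1(1) by (intro mult_le_mono1) simp
      moreover have "t \<le> 500 * X" using 1(1) by (simp add: X_def)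
      ultimately show ?case using 1(1) X1 by simp
    qed
  qed
  then show ?thesis
  proof (rule wp_use, goal_cases)
    case (1 t s)
    have "s 0 = s0 0" "s 32 0 \<le> n" using 1(1) by (simp_all add: sweep_inv_def agree_def)
    then have "s 32 0 = n" using 1(1) baseD(1)[OF tables_base[OF tb]] by simp
    moreover have "t \<le> 1300 * (Suc n * X)"
    proof -
      have "sweep_measure s0 * (600 * X) \<le> (2 * n) * (600 * X)"
        by (intro mult_le_mono1) (simp add: sweep_measure_def)
      moreover have "t \<le> sweep_measure s0 * (600 * X) + 6" using 1(1) by simp
      ultimately have "t \<le> (2 * n) * (600 * X) + 6" by linarith
      then show ?thesis using X1 by simp
    qed
    ultimately show ?case using 1(1) by (auto simp: sweep_inv_def X_def)
  qed
qed

lemma wp_sweep_run: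
  assumes tb: "tables s0" and i: "s0 30 0 = i1" "i1 < n" "s0 31 0 = t2"
  shows "wp sweep_run (\<lambda>t s. ((\<forall>j<n. tn j = t2 \<longrightarrow> vec (\<lambda>t. s 19 (ad3 i1 j t)) (Cl i1 j)) \<and>
     (\<forall>i j. j < n \<and> \<not> (i = i1 \<and> tn j = t2) \<longrightarrow> (\<forall>t<T. s 19 (ad3 i j t) = s0 19 (ad3 i j t)))) \<and>
     t \<le> 1700 * (Suc n * (Suc T * Suc L))) s0"
  unfolding sweep_run_def wp_Seq
proof (rule wp_use[OF wp_sweep_start[OF tb i(1,2)]], goal_cases)
  case (1 t1 s1)
  let ?s = "upd s1 32 0 0"
  have ag: "agree {20, 32, 36, 39} s0 ?s" using agree_trans[OF 1(2), of "{32}" ?s] by simp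
  have ts: "tables ?s" by (rule tables_agree[OF tb ag]) simp
  have e: "?s 30 0 = i1" "?s 31 0 = t2" "?s 32 0 = 0" "?s 19 = s0 19"
    using i 1(2) by (simp_all add: agree_def)
  have v: "vec (?s 20) (\<Union>i\<in>{i. i < i1 \<and> tn i = tn i1}. TRC i)" using 1(1) by simp
  show ?case
    unfolding wp_Store aval.simps
  proof (rule wp_use[OF wp_sweep_loop[OF ts e(1) i(2) e(2,3) sweep_init[OF i(2)] v]], goal_cases)
    case (1 t2 s2)
    define X where "X = Suc n * (Suc T * Suc L)"
    have "Suc n * Suc T \<le> X" unfolding X_def by (intro mult_le_mono2) simp
    moreover have "t1 \<le> 300 * (Suc n * Suc T)" using \<open>vec (s1 20) _ \<and> _\<close> by blast
    moreover have "t2 \<le> 1300 * X" using 1(1) unfolding X_def by blast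
    moreover have "1 \<le> X" by (simp add: X_def)
    ultimately have "t1 + (1 + acost (Const 0) + acost (Const 0) + t2) \<le> 1700 * X" by simp
    then show ?case using 1(1) e(4) unfolding X_def by metis
  qed
qed

text \<open>Every second event is treated in the sweep of its own thread, so the sweeps over all
  threads cover all pairs. Separate sweeps cost a factor \<open>T\<close>, but within each of them
  the sets are monotone.\<close>

lemma wp_sweep_all:
  assumes tb: "tables s0"
  shows "wp sweep_all (\<lambda>t s. (\<forall>i<n. \<forall>j<n. vec (\<lambda>t. s 19 (ad3 i j t)) (Cl i j)) \<and>
    t \<le> 2000 * (Suc n * (Suc T * (Suc n * (Suc T * Suc L))))) s0"
proof -
  let ?R = "\<lambda>i k s. \<forall>j<n. tn j < k \<longrightarrow> vec (\<lambda>t. s 19 (ad3 i j t)) (Cl i j)"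
  let ?O = "\<lambda>s1 i s. \<forall>i' j. j < n \<and> i' \<noteq> i \<longrightarrow> (\<forall>t<T. s 19 (ad3 i' j t) = s1 19 (ad3 i' j t))"
  have row: "wp (For 31 (V 7) sweep_run) (\<lambda>t s. (?R i T s \<and> ?O s1 i s) \<and>
      t \<le> (1700 + 20) * (Suc T * (Suc n * (Suc T * Suc L)))) s1"
    if ts1: "tables s1" and i: "s1 30 0 = i" "i < n" for s1 i
  proof (rule wp_For[where I = "\<lambda>k s. ?R i k s \<and> ?O s1 i s"], goal_cases)
    case (2 s)
    then show ?case using baseD(4)[OF tables_base[OF ts1]] by (simp add: agree_def)
  next
    case (4 k s)
    have ts: "tables s" by (rule tables_agree[OF ts1 4(4)]) simp
    have e: "s 30 0 = i" using 4(4) i by (simp add: agree_def)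
    show ?case
    proof (rule wp_use[OF wp_sweep_run[OF ts e i(2) 4(3)]], goal_cases)
      case (1 t s')
      have "vec (\<lambda>t. s' 19 (ad3 i j t)) (Cl i j)" if "j < n" "tn j < Suc k" for j
      proof (cases "tn j = k")
        case False
        then have "vec (\<lambda>t. s 19 (ad3 i j t)) (Cl i j)" using that 4(2) by simp
        then show ?thesis using 1(1) that False by (auto intro: vec_cong)
      qed (use 1 that in blast)
      then show ?case using 1(1) 4(2) by auto
    qed
  qed auto
  have "wp sweep_all (\<lambda>t s. (\<forall>i<n. ?R i T s) \<and>
      t \<le> (1720 + 20) * (Suc n * (Suc T * (Suc n * (Suc T * Suc L))))) s0"
    unfolding sweep_all_def
  proof (rule wp_For[where I = "\<lambda>k s. \<forall>i<k. ?R i T s"], goal_cases)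
    case (2 s)
    then show ?case using baseD(1)[OF tables_base[OF tb]] by (simp add: agree_def)
  next
    case (4 k s)
    have ts: "tables s" by (rule tables_agree[OF tb 4(4)]) simp
    show ?case
    proof (rule wp_use[OF row[OF ts 4(3,1)]], goal_cases)
      case (1 t s')
      have "?R i T s'" if "i < Suc k" for i
      proof (cases "i = k")
        case False
        then have "?R i T s" using that 4(2) by simp
        then show ?thesis using 1(1) False by (auto intro: vec_cong)
      qed (use 1 in blast)
      then show ?case using 1(1) by (simp del: mult_Suc mult_Suc_right)
    qed
  qed auto
  then show ?thesis
    by (rule wp_use) (use tn_less in \<open>auto intro: order_trans\<close>)
qed

end

section \<open>Checking one pair of events\<close>

definition load_v :: com where
  "load_v = For 39 (V 7) (Store 20 (V 39) (Load 19 (ix3 (V 30) (V 31) (V 39))))"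

text \<open>A nonzero entry for the lock means that a previously scanned thread has an open acquire
  of it too, which violates uniqueness.\<close>

definition open_cell :: com where
  "open_cell = Seq (Set 46 (Load 15 (ix3 (Load 20 (V 43)) (V 43) (V 41))))
     (If (Conj (Less (Const 0) (V 46)) (Neg (Less (Load 12 (Sub (V 46) (Const 1))) (Load 20 (V 43)))))
       (Seq (If (Less (Const 0) (Load 21 (V 41))) (Set 40 (Const 0)) Skip) (Store 21 (V 41) (V 46))) Skip)"

definition open_scan :: com where
  "open_scan = For 41 (V 10) (Seq (Store 21 (V 41) (Const 0)) (For 43 (V 7) open_cell))"

definition search_start :: com where
  "search_start = Seq (For 43 (V 7) (Seq (Store 22 (V 43) (V 0)) (Store 23 (V 43) (Const 0))))
     (Store 22 (Load 8 (Sub (Load 21 (V 41)) (Const 1))) (Sub (Load 21 (V 41)) (Const 1)))"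

definition search_pick :: com where
  "search_pick = Seq (Set 46 (Const 0)) (For 43 (V 7)
     (If (Conj (Eq (Load 23 (V 43)) (Const 0))
          (Or (Eq (V 46) (Const 0)) (Less (Load 22 (V 43)) (Load 22 (Sub (V 46) (Const 1))))))
       (Set 46 (Add (V 43) (Const 1))) Skip))"

definition search_relax :: com where
  "search_relax = For 43 (V 7) (If (Less (Load 18 (ix3 (V 47) (Load 20 (V 46)) (V 43))) (Load 22 (V 43)))
     (Store 22 (V 43) (Load 18 (ix3 (V 47) (Load 20 (V 46)) (V 43)))) Skip)"

definition search_round :: com where
  "search_round = Seq search_pick (Seq (Set 46 (Sub (V 46) (Const 1))) (Seq (Store 23 (V 46) (Const 1))
     (If (Less (Load 22 (V 46)) (Load 20 (V 46)))
       (Seq (Set 47 (Load 22 (V 46))) search_relax) Skip)))"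

text \<open>A linear scan selects the next thread; with one round per thread a search stays within
  \<open>O(T\<^sup>2)\<close>.\<close>

definition search_run :: com where
  "search_run = Seq search_start (For 44 (V 7) search_round)"

lemma mods_search [simp]:
  "mods load_v = {20, 39}"
  "mods open_cell = {21, 40, 46}"
  "mods open_scan = {21, 40, 41, 43, 46}"
  "mods search_start = {22, 23, 43}"
  "mods search_pick = {43, 46}"
  "mods search_relax = {22, 43}"
  "mods search_round = {22, 23, 43, 46, 47}"
  "mods search_run = {22, 23, 43, 44, 46, 47}"
  by (auto simp: load_v_def open_cell_def open_scan_def search_start_def search_pick_def
      search_relax_def search_round_def search_run_def)

context coded_trace
begin

lemma wp_load_v:
  assumes tb: "tables s0" and i: "s0 30 0 = i" "i < n" "s0 31 0 = j" "j < n"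
    and v: "vec (\<lambda>t. s0 19 (ad3 i j t)) C"
  shows "wp load_v (\<lambda>t s. vec (s 20) C \<and> t \<le> 60 * Suc T) s0"
proof -
  have "wp load_v (\<lambda>t s. (\<forall>t<T. s 20 t = s0 19 (ad3 i j t)) \<and> t \<le> (40 + 20) * (Suc T * 1)) s0"
    unfolding load_v_def
  proof (rule wp_For[where I = "\<lambda>k s. \<forall>t<k. s 20 t = s0 19 (ad3 i j t)"], goal_cases)
    case (2 s)
    then show ?case using baseD(4)[OF tables_base[OF tb]] by (simp add: agree_def)
  next
    case (4 k s)
    have bs: "base s" using base_agree[OF tables_base[OF tb] 4(4)] by simp
    have "s 30 0 = i" "s 31 0 = j" "s 19 = s0 19" using 4(4) i by (simp_all add: agree_def)
    then show ?case using 4 i by (auto simp: aval_ix3[OF bs] less_Suc_eq)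
  qed auto
  then show ?thesis by (rule wp_use) (use v in \<open>auto intro: vec_cong\<close>)
qed

definition opn :: "(nat \<Rightarrow> nat) \<Rightarrow> nat \<Rightarrow> nat \<Rightarrow> nat \<Rightarrow> bool" where
  "opn v t l a \<longleftrightarrow> LA (v t) t l = Suc a \<and> \<not> M a < v t"

text \<open>Only the last acquire of a thread on a lock within the set can be open, since an earlier
  one is released before the thread acquires the lock again.\<close>

lemma opn_iff:
  assumes v: "vec v C" and cl: "dep_closed C" and t: "t < T"
  shows "opn v t l a \<longleftrightarrow> open_acq C a \<and> tn a = t \<and> lk a = l"
proof
  assume o: "opn v t l a"
  then have a: "a < v t" "oc a = 2" "tn a = t" "lk a = l" by (auto simp: opn_def LA_eq_Suc)
  have an: "a < n" using a vec_le[OF v t] by simp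
  have "\<not> mt a r" if "r \<in> C" for r
    using that o a an M_iff[of a r] mt_thread[of a r] vecD[OF v, of r] by (auto simp: opn_def)
  then show "open_acq C a \<and> tn a = t \<and> lk a = l"
    using a vecD[OF v an] by (auto simp: open_acq_def)
next
  assume o: "open_acq C a \<and> tn a = t \<and> lk a = l"
  then have a: "a \<in> C" "oc a = 2" "\<And>r. r \<in> C \<Longrightarrow> \<not> mt a r" by (auto simp: open_acq_def)
  have an: "a < n" using dep_closed_less[OF cl a(1)] .
  have "\<not> M a < v t"
  proof
    assume lt: "M a < v t"
    then have "M a < n" using vec_le[OF v t] by simp
    then have m: "mt a (M a)" using M_iff[OF an] by simp
    then have "M a \<in> C" using vecD[OF v \<open>M a < n\<close>] mt_thread[OF m] o lt by simp
    then show False using a(3) m by blast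
  qed
  then show "opn v t l a" using LA_unmatched[OF v cl a] o by (auto simp: opn_def)
qed

definition open_found :: "nat set \<Rightarrow> store \<Rightarrow> bool" where
  "open_found C s \<longleftrightarrow> (\<forall>l<L. (s 21 l = 0 \<longrightarrow> (\<forall>a. open_acq C a \<longrightarrow> lk a \<noteq> l)) \<and>
     (\<forall>a. s 21 l = Suc a \<longrightarrow> open_acq C a \<and> lk a = l))"

text \<open>\<open>LA\<close> yields at most one acquire per thread and lock, so two open acquires
  of a lock lie in different threads; uniqueness fails exactly if a second thread contributes
  one.\<close>

lemma wp_open_scan:
  assumes tb: "tables s0" and v: "vec (s0 20) C" and cl: "dep_closed C" and ok: "s0 40 0 = 1"
  shows "wp open_scan (\<lambda>t s. open_found C s \<and>
     (s 40 0 = 1 \<longleftrightarrow> (\<forall>a b. open_acq C a \<and> open_acq C b \<and> lk a = lk b \<longrightarrow> a = b)) \<and>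
     t \<le> 300 * (Suc L * Suc T)) s0"
proof -
  let ?o = "opn (s0 20)"
  let ?U = "\<lambda>l k. \<forall>t<k. \<forall>t'<k. \<forall>a a'. ?o t l a \<and> ?o t' l a' \<longrightarrow> t = t'"
  let ?F = "\<lambda>l k s. s 21 l = 0 \<and> (\<forall>t<k. \<forall>a. \<not> ?o t l a) \<or> (\<exists>t<k. \<exists>a. ?o t l a \<and> s 21 l = Suc a)"
  let ?J = "\<lambda>s1 l k s. ?F l k s \<and> (s 40 0 = 1 \<longleftrightarrow> s1 40 0 = 1 \<and> ?U l k) \<and>
      (\<forall>l'. l' \<noteq> l \<longrightarrow> s 21 l' = s1 21 l')"
  have row: "wp (For 43 (V 7) open_cell) (\<lambda>t s. ?J s1 l T s \<and> t \<le> (120 + 20) * (Suc T * 1)) s1"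
    if ag: "agree {21, 40, 41, 43, 46} s0 s1" and l: "s1 41 0 = l" "l < L" "s1 21 l = 0" for s1 l
  proof (rule wp_For[where I = "?J s1 l"], goal_cases)
    case (2 s)
    then show ?case using ag baseD(4)[OF tables_base[OF tb]] by (simp add: agree_def)
  next
    case (4 k s)
    have ag': "agree {21, 40, 41, 43, 46} s0 s" using agree_trans[OF ag 4(4)] by simp
    have ts: "tables s" by (rule tables_agree[OF tb ag']) simp
    have bs: "base s" using ts by (rule tables_base)
    have e: "s 20 = s0 20" using ag' by (simp add: agree_def)
    have e41: "s 41 0 = l" using 4(4) l by (simp add: agree_def)
    have vk: "s0 20 k \<le> n" using vec_le[OF v 4(1)] .
    let ?a = "LA (s0 20 k) k l"
    have a: "aval (Load 15 (ix3 (Load 20 (V 43)) (V 43) (V 41))) s = ?a"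
      using ts 4(1,3) l e e41 vk T_le by (simp add: aval_ix3[OF bs] tables_def)
    define s2 where "s2 = upd s 46 0 ?a"
    have an: "?a - 1 < n"
    proof -
      have "?a \<le> n" using flast_le vk unfolding LA_def by (rule order_trans)
      then show ?thesis using 4(1) T_le by linarith
    qed
    have c: "bval (Conj (Less (Const 0) (V 46)) (Neg (Less (Load 12 (Sub (V 46) (Const 1))) (Load 20 (V 43))))) s2
        \<longleftrightarrow> (\<exists>a. ?o k l a)"
      using ts an 4(3) e unfolding opn_def by (cases ?a) (auto simp: s2_def tables_def)
    have z: "aval (Const 0) s = 0" for s :: store by simp
    have U: "?U l (Suc k) \<longleftrightarrow> ?U l k \<and> ((\<exists>a. ?o k l a) \<longrightarrow> (\<forall>t<k. \<forall>a. \<not> ?o t l a))"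
    proof (intro iffI conjI)
      assume U: "?U l (Suc k)"
      then show "?U l k" by (meson less_SucI)
      show "(\<exists>a. ?o k l a) \<longrightarrow> (\<forall>t<k. \<forall>a. \<not> ?o t l a)"
      proof (intro impI allI notI, elim exE)
        fix t a a' assume o: "t < k" "?o t l a" "?o k l a'"
        have "t < Suc k" "k < Suc k" using o(1) by simp_all
        then have "t = k" using U o(2,3) by blast
        then show False using o(1) by simp
      qed
    next
      assume U: "?U l k \<and> ((\<exists>a. ?o k l a) \<longrightarrow> (\<forall>t<k. \<forall>a. \<not> ?o t l a))"
      show "?U l (Suc k)"
      proof (intro allI impI, elim conjE)
        fix t t' a a' assume o: "t < Suc k" "t' < Suc k" "?o t l a" "?o t' l a'"
        show "t = t'"
        proof (cases "t = k \<or> t' = k")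
          case True
          have "t < k \<or> t = k" "t' < k \<or> t' = k" using o(1,2) by auto
          then show ?thesis using True U o(3,4) by blast
        next
          case False
          then have "t < k" "t' < k" using o(1,2) by auto
          then show ?thesis using U o(3,4) by blast
        qed
      qed
    qed
    show ?case
    proof (cases "\<exists>a. ?o k l a")
      case True
      then obtain a where o: "?o k l a" by blast
      then have la: "?a = Suc a" by (simp add: opn_def)
      show ?thesis
        unfolding open_cell_def wp_Seq wp_Store z a s2_def[symmetric] wp_If c
        using 4(2) o e41 la U l(2) by (auto simp: s2_def less_Suc_eq)
    next
      case False
      then show ?thesis
        unfolding open_cell_def wp_Seq wp_Store z a s2_def[symmetric] wp_If c
        using 4(2) U by (auto simp: s2_def less_Suc_eq)
    qed
  qed (use l in auto)
  have "wp open_scan (\<lambda>t s. ((\<forall>l<L. ?F l T s) \<and> (s 40 0 = 1 \<longleftrightarrow> (\<forall>l<L. ?U l T))) \<and>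
      t \<le> (180 + 20) * (Suc L * Suc T)) s0"
    unfolding open_scan_def
  proof (rule wp_For[where I = "\<lambda>k s. (\<forall>l<k. ?F l T s) \<and> (s 40 0 = 1 \<longleftrightarrow> (\<forall>l<k. ?U l T))"], goal_cases)
    case (2 s)
    then show ?case using baseD(6)[OF tables_base[OF tb]] by (simp add: agree_def)
  next
    case (4 k s)
    let ?s = "upd s 21 k 0"
    have ag: "agree {21, 40, 41, 43, 46} s0 ?s" using 4(4) by (auto simp: agree_def)
    have e: "aval (V 41) s = k" "aval (Const 0) s = 0" "?s 41 0 = k" "?s 21 k = 0" using 4(3) by simp_all
    show ?case
      unfolding wp_Seq wp_Store e(1,2)
    proof (rule wp_use[OF row[OF ag e(3) 4(1) e(4)]], goal_cases)
      case (1 t s')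
      have "?F l T s'" if "l < Suc k" for l
        using 1(1) 4(2) that by (cases "l = k") auto
      moreover have "s' 40 0 = 1 \<longleftrightarrow> (\<forall>l<Suc k. ?U l T)"
      proof -
        have a: "s' 40 0 = 1 \<longleftrightarrow> ?s 40 0 = 1 \<and> ?U k T" using 1(1) by blast
        have b: "?s 40 0 = s 40 0" by simp
        have c: "s 40 0 = 1 \<longleftrightarrow> (\<forall>l<k. ?U l T)" using 4(2) by (rule conjunct2)
        show ?thesis unfolding a b c All_less_Suc by (rule conj_commute)
      qed
      moreover have "t \<le> (120 + 20) * (Suc T * 1)" using 1(1) by (rule conjunct2)
      ultimately show ?case by simp
    qed
  qed (use ok in auto)
  then show ?thesis
  proof (rule wp_use, goal_cases)
    case (1 t s)
    have lt: "tn a < T" "lk a < L" if "open_acq C a" for a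
      using that tn_less lk_less dep_closed_less[OF cl] by (auto simp: open_acq_def)
    note oi = opn_iff[OF v cl]
    have "open_found C s"
      unfolding open_found_def
    proof (intro allI impI conjI)
      fix l assume l: "l < L"
      { fix a assume "s 21 l = 0" "open_acq C a"
        then show "lk a \<noteq> l" using 1(1) l lt oi[of "tn a" l a] by fastforce }
      { fix a assume "s 21 l = Suc a"
        then have "\<exists>t<T. ?o t l a" using 1(1) l by fastforce
        then show "open_acq C a" "lk a = l" using oi by auto }
    qed
    moreover have "(\<forall>l<L. ?U l T) \<longleftrightarrow> (\<forall>a b. open_acq C a \<and> open_acq C b \<and> lk a = lk b \<longrightarrow> a = b)"
    proof
      assume U: "\<forall>l<L. ?U l T"
      show "\<forall>a b. open_acq C a \<and> open_acq C b \<and> lk a = lk b \<longrightarrow> a = b"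
      proof (intro allI impI, elim conjE)
        fix a b assume ab: "open_acq C a" "open_acq C b" "lk a = lk b"
        then have o: "?o (tn a) (lk a) a" "?o (tn b) (lk a) b" using oi lt by auto
        then have "tn a = tn b" using U lt ab by blast
        then show "a = b" using o by (simp add: opn_def)
      qed
    next
      assume U: "\<forall>a b. open_acq C a \<and> open_acq C b \<and> lk a = lk b \<longrightarrow> a = b"
      show "\<forall>l<L. ?U l T"
      proof (intro allI impI, elim conjE)
        fix l t t' a a' assume "l < L" "t < T" "t' < T" "?o t l a" "?o t' l a'"
        then show "t = t'" using U oi by metis
      qed
    qed
    ultimately show ?case using 1(1) by simp
  qed
qed

lemma wp_search_run:
  assumes tb: "tables s0" and v: "vec (s0 20) C" and cl: "dep_closed C"
    and l: "s0 41 0 = l" "s0 21 l = Suc b" and b: "b \<in> C"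
  shows "wp search_run (\<lambda>t s. reach_vec C b (s 22) \<and> t \<le> 600 * (Suc T * Suc T)) s0"
proof -
  let ?v = "s0 20"
  have bn: "b < n" "tn b < T" using b v tn_less by (auto simp: vec_def)
  let ?A = "{22, 23, 43, 44, 46, 47}"
  \<comment> \<open>The finished threads are those with a nonzero mark; their number counts the
    rounds.\<close>
  let ?D = "\<lambda>s. {t. t < T \<and> s 23 t \<noteq> 0}"
  have start: "wp search_start (\<lambda>t s. (search C ?v b (s 22) {} \<and> (\<forall>t<T. s 23 t = 0)) \<and> t \<le> 120 * Suc T) s0"
  proof -
    have "wp (For 43 (V 7) (Seq (Store 22 (V 43) (V 0)) (Store 23 (V 43) (Const 0))))
        (\<lambda>t s. (\<forall>t<T. s 22 t = n \<and> s 23 t = 0) \<and> t \<le> (60 + 20) * (Suc T * 1)) s0"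
    proof (rule wp_For[where I = "\<lambda>k s. \<forall>t<k. s 22 t = n \<and> s 23 t = 0"], goal_cases)
      case (2 s)
      then show ?case using baseD(4)[OF tables_base[OF tb]] by (simp add: agree_def)
    next
      case (4 k s)
      have "s 0 0 = n" using 4(4) baseD(1)[OF tables_base[OF tb]] by (simp add: agree_def)
      then show ?case using 4 by (auto simp: less_Suc_eq)
    qed auto
    then show ?thesis
      unfolding search_start_def wp_Seq
    proof (rule wp_use, goal_cases)
      case (1 t s)
      have e: "s 41 0 = l" "s 21 l = Suc b" "s 8 b = tn b"
        using 1(2) l baseD(5)[OF tables_base[OF tb] bn(1)] by (simp_all add: agree_def)
      have "search C ?v b ((s 22)(tn b := b)) {}"
        using search_init[OF v b] 1(1) unfolding search_def by (auto split: if_splits)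
      then show ?case using 1(1) e by simp
    qed
  qed
  have pick: "wp search_pick (\<lambda>t s. (\<exists>u<T. s 46 0 = Suc u \<and> s1 23 u = 0 \<and>
        (\<forall>t<T. s1 23 t = 0 \<longrightarrow> s1 22 u \<le> s1 22 t)) \<and> t \<le> 120 * Suc T) s1"
    if ag: "agree ?A s0 s1" and ne: "t0 < T" "s1 23 t0 = 0" for s1 t0
  proof -
    let ?I = "\<lambda>k s. s 46 0 = 0 \<and> (\<forall>t<k. s1 23 t \<noteq> 0) \<or> (\<exists>u<k. s 46 0 = Suc u \<and> s1 23 u = 0 \<and>
        (\<forall>t<k. s1 23 t = 0 \<longrightarrow> s1 22 u \<le> s1 22 t))"
    have "wp (For 43 (V 7) (If (Conj (Eq (Load 23 (V 43)) (Const 0))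
          (Or (Eq (V 46) (Const 0)) (Less (Load 22 (V 43)) (Load 22 (Sub (V 46) (Const 1))))))
       (Set 46 (Add (V 43) (Const 1))) Skip)) (\<lambda>t s. ?I T s \<and> t \<le> (60 + 20) * (Suc T * 1)) (upd s1 46 0 0)"
    proof (rule wp_For[where I = ?I], goal_cases)
      case (2 s)
      then show ?case using ag baseD(4)[OF tables_base[OF tb]] by (simp add: agree_def)
    next
      case (4 k s)
      have e: "s 22 = s1 22" "s 23 = s1 23" using 4(4) by (simp_all add: agree_def)
      from 4(2) show ?case
      proof (elim disjE exE conjE)
        assume "s 46 0 = 0" "\<forall>t<k. s1 23 t \<noteq> 0"
        then show ?thesis using 4(3) e by (auto simp: less_Suc_eq)
      next
        fix u assume u: "u < k" "s 46 0 = Suc u" "s1 23 u = 0" "\<forall>t<k. s1 23 t = 0 \<longrightarrow> s1 22 u \<le> s1 22 t"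
        show ?thesis
        proof (cases "s1 23 k = 0 \<and> s1 22 k < s1 22 u")
          case True
          then have "\<forall>t<Suc k. s1 23 t = 0 \<longrightarrow> s1 22 k \<le> s1 22 t"
            using u(4) by (auto simp: less_Suc_eq)
          then show ?thesis using 4(3) e u True by auto
        next
          case False
          then have "\<forall>t<Suc k. s1 23 t = 0 \<longrightarrow> s1 22 u \<le> s1 22 t"
            using u(4) by (auto simp: less_Suc_eq)
          then show ?thesis using 4(3) e u False by auto
        qed
      qed
    qed auto
    then show ?thesis
      unfolding search_pick_def wp_Seq wp_Store aval.simps
      by (rule wp_use) (use ne in auto)
  qed
  have round: "wp search_round (\<lambda>t s. (search C ?v b (s 22) (?D s) \<and> card (?D s) = Suc k) \<and>
      t \<le> 300 * Suc T) s1"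
    if ag: "agree ?A s0 s1" and I: "search C ?v b (s1 22) (?D s1)" "card (?D s1) = k" and k: "k < T" for s1 k
  proof -
    \<comment> \<open>Fewer than \<open>T\<close> threads are finished, so there is one left to be
      chosen.\<close>
    have "\<exists>t0<T. s1 23 t0 = 0"
    proof (rule ccontr)
      assume "\<not> (\<exists>t0<T. s1 23 t0 = 0)"
      then have "?D s1 = {..<T}" by auto
      then show False using I(2) k by simp
    qed
    then obtain t0 where t0: "t0 < T" "s1 23 t0 = 0" by blast
    show ?thesis
      unfolding search_round_def wp_Seq
    proof (rule wp_use[OF pick[OF ag t0]], goal_cases)
      case (1 t2 s2)
      then obtain u where u: "u < T" "s2 46 0 = Suc u" "s1 23 u = 0"
        "\<And>t. t < T \<Longrightarrow> s1 23 t = 0 \<Longrightarrow> s1 22 u \<le> s1 22 t" by blast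
      have t2: "t2 \<le> 120 * Suc T" using 1(1) by blast
      have e2: "s2 22 = s1 22" "s2 23 = s1 23" "s2 20 = ?v"
        using 1(2) ag by (simp_all add: agree_def)
      have ag2: "agree ?A s0 s2" using agree_trans[OF ag 1(2)] by simp
      have D: "insert u (?D s1) = {t. t < T \<and> ((s1 23)(u := 1)) t \<noteq> 0}" using u(1) by auto
      have cD: "card (insert u (?D s1)) = Suc k" using I(2) u(3) by simp
      have st: "search C ?v b R' (insert u (?D s1))"
        if "\<And>t. t < T \<Longrightarrow> R' t = (if s1 22 u < ?v u then min (s1 22 t) (RM (s1 22 u) (?v u) t) else s1 22 t)" for R'
        by (rule search_step[OF I(1) v cl u(1) _ _ that b]) (use u in auto)
      let ?s = "upd (upd s2 46 0 u) 23 u 1"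
      have x: "aval (Sub (V 46) (Const 1)) s2 = u" "aval (V 46) (upd s2 46 0 u) = u" using u(2) by simp_all
      have c: "bval (Less (Load 22 (V 46)) (Load 20 (V 46))) ?s \<longleftrightarrow> s1 22 u < ?v u"
        using e2 by simp
      show ?case
        unfolding wp_Store wp_If x aval.simps(1) c
      proof (intro conjI impI, goal_cases)
        case 1
        let ?s3 = "upd ?s 47 0 (s1 22 u)"
        have x3: "aval (Load 22 (V 46)) ?s = s1 22 u" using e2 by simp
        have ag3: "agree ?A s0 ?s3" using ag2 by (auto simp: agree_def)
        have un: "s1 22 u < n" using 1 vec_le[OF v u(1)] by simp
        have "wp search_relax (\<lambda>t s. (\<forall>t. s 22 t = (if t < T then min (s1 22 t) (RM (s1 22 u) (?v u) t) else s1 22 t)) \<and>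
            t \<le> (70 + 20) * (Suc T * 1)) ?s3"
          unfolding search_relax_def
        proof (rule wp_For[where I = "\<lambda>k s. \<forall>t. s 22 t = (if t < k then min (s1 22 t) (RM (s1 22 u) (?v u) t) else s1 22 t)"], goal_cases)
          case (2 s)
          then show ?case using ag3 baseD(4)[OF tables_base[OF tb]] by (simp add: agree_def)
        next
          case (4 k s)
          have ag4: "agree ?A s0 s" using agree_trans[OF ag3 4(4)] by simp
          have ts: "tables s" by (rule tables_agree[OF tb ag4]) simp
          have e4: "s 46 0 = u" "s 47 0 = s1 22 u" "s 20 = ?v" using 4(4) e2 by (simp_all add: agree_def)
          have a: "aval (Load 18 (ix3 (V 47) (Load 20 (V 46)) (V 43))) s = RM (s1 22 u) (?v u) k"
            using ts 4(1,3) e4 un vec_le[OF v u(1)] by (simp add: aval_ix3[OF tables_base[OF ts]] tables_def)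
          have sk: "s 22 k = s1 22 k" using 4(2) by simp
          have x4: "aval (V 43) s = k" "aval (Load 22 (V 43)) s = s1 22 k" using 4(3) sk by simp_all
          show ?case
            unfolding wp_If wp_Store wp_Skip bval.simps a x4
            using 4(2) sk by (auto simp: less_Suc_eq)
        qed (use e2 in auto)
        then show ?case
          unfolding wp_Seq wp_Store x3 aval.simps(1)
        proof (rule wp_use, goal_cases)
          case (1 t4 s4)
          have e4: "s4 23 = (s1 23)(u := 1)" using agreeD[OF 1(2), of 23] e2 by (simp add: fun_upd_def)
          have "search C ?v b (s4 22) (insert u (?D s1))" by (rule st) (use 1(1) \<open>s1 22 u < ?v u\<close> in simp)
          then show ?case using 1(1) t2 cD D e4 by simp
        qed
      next
        case 2
        have "search C ?v b (s1 22) (insert u (?D s1))" by (rule st) (use 2 in simp)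
        then show ?case using t2 cD D e2 by simp
      qed
    qed
  qed
  show ?thesis
    unfolding search_run_def wp_Seq
  proof (rule wp_use[OF start], goal_cases)
    case (1 t1 s1)
    have ag1: "agree ?A s0 s1" using 1(2) by (auto simp: agree_def)
    have D0: "?D s1 = {}" using 1(1) by auto
    have "wp (For 44 (V 7) search_round) (\<lambda>t s. (search C ?v b (s 22) (?D s) \<and> card (?D s) = T) \<and>
        t \<le> (300 + 20) * (Suc T * Suc T)) s1"
    proof (rule wp_For[where I = "\<lambda>k s. search C ?v b (s 22) (?D s) \<and> card (?D s) = k"], goal_cases)
      case (2 s)
      then show ?case using ag1 baseD(4)[OF tables_base[OF tb]] by (simp add: agree_def)
    next
      case 3
      have "?D (upd s1 44 0 0) = {}" using D0 by simp
      then show ?case using 1(1) by (simp only:) simp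
    next
      case (4 k s)
      have ag: "agree ?A s0 s" using agree_trans[OF ag1 4(4)] by simp
      show ?case
        by (rule wp_use[OF round[OF ag _ _ 4(1)]]) (use 4(2) in auto)
    qed auto
    then show ?case
    proof (rule wp_use, goal_cases)
      case (1 t s)
      have "?D s = {..<T}" using 1(1) by (intro card_subset_eq) auto
      then have "reach_vec C b (s 22)" using search_done[OF _ v cl b] 1(1) by simp
      moreover have "120 * Suc T \<le> 120 * (Suc T * Suc T)" by simp
      moreover have "t1 \<le> 120 * Suc T" using \<open>_ \<and> t1 \<le> _\<close> by blast
      ultimately show ?case using 1(1) by simp
    qed
  qed
qed

end

section \<open>The lock graph and the test for acyclicity\<close>

definition graph_cell :: com where
  "graph_cell = Seq (Store 24 (ix2 (V 41) (V 42)) (Const 0)) (If (Less (Const 0) (Load 21 (V 42)))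
     (For 43 (V 7) (If (Less (Load 22 (V 43)) (Load 16 (ix3 (Load 20 (V 43)) (V 43) (V 42))))
       (Store 24 (ix2 (V 41) (V 42)) (Const 1)) Skip)) Skip)"

definition graph_row :: com where
  "graph_row = If (Less (Const 0) (Load 21 (V 41)))
     (Seq search_run (For 42 (V 10) graph_cell))
     (For 42 (V 10) (Store 24 (ix2 (V 41) (V 42)) (Const 0)))"

definition graph :: com where
  "graph = For 41 (V 10) graph_row"

lemma mods_graph [simp]:
  "mods graph_cell = {24, 43}"
  "mods graph_row = {22, 23, 24, 42, 43, 44, 46, 47}"
  "mods graph = {22, 23, 24, 41, 42, 43, 44, 46, 47}"
  by (auto simp: graph_cell_def graph_row_def graph_def)

definition count_col :: com where
  "count_col = Seq (Store 25 (V 42) (Const 0)) (Seq (Store 26 (V 42) (Const 0))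
     (For 41 (V 10) (Store 25 (V 42) (Add (Load 25 (V 42)) (Load 24 (ix2 (V 41) (V 42)))))))"

definition pick_source :: com where
  "pick_source = Seq (Set 46 (Const 0)) (For 41 (V 10)
     (If (Conj (Eq (Load 26 (V 41)) (Const 0)) (Eq (Load 25 (V 41)) (Const 0)))
       (Set 46 (Add (V 41) (Const 1))) Skip))"

definition remove_source :: com where
  "remove_source = Seq (Set 46 (Sub (V 46) (Const 1))) (Seq (Store 26 (V 46) (Const 1))
     (For 42 (V 10) (Store 25 (V 42) (Sub (Load 25 (V 42)) (Load 24 (ix2 (V 46) (V 42)))))))"

text \<open>Without a source the round changes neither in-degrees nor marks, so the number of rounds
  can be fixed to the number of locks.\<close>

definition peel_round :: com where
  "peel_round = Seq pick_source (If (Less (Const 0) (V 46)) remove_source Skip)"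

definition peel :: com where
  "peel = Seq (For 42 (V 10) count_col) (Seq (For 44 (V 10) peel_round)
     (For 41 (V 10) (If (Eq (Load 26 (V 41)) (Const 0)) (Set 40 (Const 0)) Skip)))"

lemma mods_peel [simp]:
  "mods count_col = {25, 26, 41}"
  "mods pick_source = {41, 46}"
  "mods remove_source = {25, 26, 42, 46}"
  "mods peel_round = {25, 26, 41, 42, 46}"
  "mods peel = {25, 26, 40, 41, 42, 44, 46}"
  by (auto simp: count_col_def pick_source_def remove_source_def peel_round_def peel_def)

context coded_trace
begin

text \<open>The reachable part of a thread is a suffix of its events in the set, so a release of the
  lock is reachable in it if and only if the last one is. As \<open>LR\<close> is shifted by one,
  \<open>\<le>\<close> turns into \<open><\<close>.\<close>

lemma LR_reach:
  assumes v: "vec v C" and cl: "dep_closed C" and R: "reach_vec C b R"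
  shows "(\<exists>t<T. R t < LR (v t) t l) \<longleftrightarrow> (\<exists>r\<in>C. oc r = 3 \<and> lk r = l \<and> reaches C b r)"
proof
  assume "\<exists>t<T. R t < LR (v t) t l"
  then obtain t where t: "t < T" "R t < LR (v t) t l" by blast
  then obtain r where r: "LR (v t) t l = Suc r" by (cases "LR (v t) t l") auto
  then have r': "r < v t" "oc r = 3" "tn r = t" "lk r = l" by (auto simp: LR_eq_Suc)
  have "r < n" using r' vec_le[OF v t(1)] by simp
  then have "r \<in> C" using vecD[OF v] r' by simp
  moreover have "reaches C b r" using R \<open>r \<in> C\<close> t r r' by (simp add: reach_vec_def)
  ultimately show "\<exists>r\<in>C. oc r = 3 \<and> lk r = l \<and> reaches C b r" using r' by blast
next
  assume "\<exists>r\<in>C. oc r = 3 \<and> lk r = l \<and> reaches C b r"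
  then obtain r where r: "r \<in> C" "oc r = 3" "lk r = l" "reaches C b r" by blast
  have rn: "r < n" using dep_closed_less[OF cl r(1)] .
  have "R (tn r) \<le> r" using R r by (simp add: reach_vec_def)
  also have "r < LR (v (tn r)) (tn r) l"
    unfolding LR_def using vecD[OF v rn] r by (intro flast_less) auto
  finally show "\<exists>t<T. R t < LR (v t) t l" using tn_less[OF rn] by blast
qed

text \<open>One search per lock and one comparison per thread for each pair of locks give the two
  terms of the bound.\<close>

lemma wp_graph:
  assumes tb: "tables s0" and v: "vec (s0 20) C" and cl: "dep_closed C" and op: "open_found C s0"
    and uniq: "\<And>a b. open_acq C a \<Longrightarrow> open_acq C b \<Longrightarrow> lk a = lk b \<Longrightarrow> a = b"
  shows "wp graph (\<lambda>t s. (\<forall>l<L. \<forall>l'<L. s 24 (ad2 l l') = of_bool ((l, l') \<in> lock_graph C)) \<and>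
    t \<le> 1000 * (Suc L * (Suc T * Suc T + Suc L * Suc T))) s0"
proof -
  let ?A = "{22, 23, 24, 41, 42, 43, 44, 46, 47}"
  let ?g = "\<lambda>l l'. (l, l') \<in> lock_graph C"
  have inj: "ad2 l k = ad2 l' k' \<longleftrightarrow> l = l' \<and> k = k'" if "k < L" "k' < L" for l l' k k'
    using that L_le by (intro ad2_inj) auto
  have g0: "\<not> ?g l l'" if "s0 21 l = 0 \<or> s0 21 l' = 0" "l < L" "l' < L" for l l'
    using op that by (auto simp: open_found_def lock_graph_def)
  \<comment> \<open>By uniqueness, the open acquires in the definition of \<open>lock_graph\<close>
    are the ones that the scan has found.\<close>
  have g1: "?g l l' \<longleftrightarrow> (\<exists>r\<in>C. oc r = 3 \<and> lk r = l' \<and> reaches C b r)"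
    if "s0 21 l = Suc b" "s0 21 l' = Suc b'" "l < L" "l' < L" for l l' b b'
  proof -
    have "open_acq C b" "lk b = l" "open_acq C b'" "lk b' = l'" using op that by (auto simp: open_found_def)
    then show ?thesis using uniq unfolding lock_graph_def by blast
  qed
  let ?J = "\<lambda>l s s'. \<forall>k. k \<noteq> l \<longrightarrow> (\<forall>l'<L. s' 24 (ad2 k l') = s 24 (ad2 k l'))"
  have cell: "wp graph_cell (\<lambda>t s. (s 24 (ad2 l l') = of_bool (?g l l') \<and>
        (\<forall>x. x \<noteq> ad2 l l' \<longrightarrow> s 24 x = s1 24 x)) \<and> t \<le> 150 * Suc T) s1"
    if ag: "agree ?A s0 s1" and l: "s1 41 0 = l" "l < L" "s1 42 0 = l'" "l' < L"
      and b: "s0 21 l = Suc b" and R: "reach_vec C b (s1 22)" for s1 l l' b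
  proof -
    have ts: "tables s1" by (rule tables_agree[OF tb ag]) simp
    have bs: "base s1" using ts by (rule tables_base)
    have x: "aval (ix2 (V 41) (V 42)) s1 = ad2 l l'" using aval_ix2[OF bs, of "V 41"] l L_le by simp
    let ?s = "upd s1 24 (ad2 l l') 0"
    have ag': "agree ?A s0 ?s" using ag by simp
    have e: "?s 21 = s0 21" "?s 42 0 = l'" using ag l by (simp_all add: agree_def)
    show ?thesis
      unfolding graph_cell_def wp_Seq wp_Store x aval.simps(1) wp_If
    proof (intro conjI impI, goal_cases)
      case 1
      then obtain b' where b': "s0 21 l' = Suc b'" using e by (cases "s0 21 l'") auto
      let ?P = "\<lambda>t. s1 22 t < LR (s0 20 t) t l'"
      have "wp (For 43 (V 7) (If (Less (Load 22 (V 43)) (Load 16 (ix3 (Load 20 (V 43)) (V 43) (V 42))))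
          (Store 24 (ix2 (V 41) (V 42)) (Const 1)) Skip))
         (\<lambda>t s. (s 24 (ad2 l l') = of_bool (\<exists>t<T. ?P t) \<and> (\<forall>x. x \<noteq> ad2 l l' \<longrightarrow> s 24 x = s1 24 x)) \<and>
           t \<le> (80 + 20) * (Suc T * 1)) ?s"
      proof (rule wp_For[where I = "\<lambda>k s. s 24 (ad2 l l') = of_bool (\<exists>t<k. ?P t) \<and>
          (\<forall>x. x \<noteq> ad2 l l' \<longrightarrow> s 24 x = s1 24 x)"], goal_cases)
        case (2 s)
        then show ?case using ag' baseD(4)[OF tables_base[OF tb]] by (simp add: agree_def)
      next
        case (4 k s)
        have ag4: "agree ?A s0 s" using agree_trans[OF ag' 4(4)] by simp
        have ts4: "tables s" by (rule tables_agree[OF tb ag4]) simp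
        have e4: "s 20 = s0 20" "s 41 0 = l" "s 42 0 = l'" "s 22 = s1 22"
          using 4(4) ag l by (simp_all add: agree_def)
        have y: "aval (ix2 (V 41) (V 42)) s = ad2 l l'"
          using aval_ix2[OF tables_base[OF ts4], of "V 41"] l e4 L_le by simp
        have z: "aval (Load 16 (ix3 (Load 20 (V 43)) (V 43) (V 42))) s = LR (s0 20 k) k l'"
          using ts4 4(1,3) l e4 vec_le[OF v 4(1)] T_le by (simp add: aval_ix3[OF tables_base[OF ts4]] tables_def)
        have c: "aval (Load 22 (V 43)) s = s1 22 k" using 4(3) e4 by simp
        have ex: "(\<exists>t<Suc k. ?P t) \<longleftrightarrow> ?P k \<or> (\<exists>t<k. ?P t)" by (auto simp: less_Suc_eq)
        show ?case
          unfolding wp_If wp_Store wp_Skip bval.simps y z c aval.simps(1) ex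
          using 4(2) by simp
      qed auto
      then show ?case
      proof (rule wp_use, goal_cases)
        case (1 t s)
        have "of_bool (\<exists>t<T. ?P t) = (of_bool (?g l l') :: nat)"
          unfolding g1[OF b b' l(2,4)] LR_reach[OF v cl R] ..
        then show ?case using 1(1) by simp
      qed
    next
      case 2
      then have "\<not> ?g l l'" using g0 e l by simp
      then show ?case by simp
    qed
  qed
  have row: "wp graph_row (\<lambda>t s. ((\<forall>l'<L. s 24 (ad2 l l') = of_bool (?g l l')) \<and> ?J l s1 s) \<and>
      t \<le> 800 * (Suc T * Suc T + Suc L * Suc T)) s1"
    if ag: "agree ?A s0 s1" and l: "s1 41 0 = l" "l < L" for s1 l
  proof -
    have e: "s1 21 = s0 21" "s1 20 = s0 20" using ag by (simp_all add: agree_def)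
    have ts: "tables s1" by (rule tables_agree[OF tb ag]) simp
    show ?thesis
      unfolding graph_row_def wp_If
    proof (intro conjI impI, goal_cases)
      case 1
      then obtain b where b: "s0 21 l = Suc b" using e l by (cases "s0 21 l") auto
      then have bC: "b \<in> C" using op l by (auto simp: open_found_def open_acq_def)
      have v1: "vec (s1 20) C" "s1 21 l = Suc b" using v b e by simp_all
      show ?case
        unfolding wp_Seq
      proof (rule wp_use[OF wp_search_run[OF ts v1(1) cl l(1) v1(2) bC]], goal_cases)
        case (1 t2 s2)
        have ag2: "agree ?A s0 s2" using agree_trans[OF ag 1(2)] by simp
        have e2: "s2 41 0 = l" "s2 24 = s1 24" using 1(2) l by (simp_all add: agree_def)
        have "wp (For 42 (V 10) graph_cell) (\<lambda>t s. ((\<forall>l'<L. s 24 (ad2 l l') = of_bool (?g l l')) \<and> ?J l s1 s) \<and>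
            t \<le> (150 + 20) * (Suc L * Suc T)) s2"
        proof (rule wp_For[where I = "\<lambda>k s. (\<forall>l'<k. s 24 (ad2 l l') = of_bool (?g l l')) \<and> ?J l s1 s"], goal_cases)
          case (2 s)
          then show ?case using ag2 baseD(6)[OF tables_base[OF tb]] by (simp add: agree_def)
        next
          case (4 k s)
          have ag4: "agree ?A s0 s" using agree_trans[OF ag2 4(4)] by simp
          have e4: "s 41 0 = l" "s 22 = s2 22" using 4(4) e2 by (simp_all add: agree_def)
          have R: "reach_vec C b (s 22)" using 1(1) e4 by simp
          show ?case
          proof (rule wp_use[OF cell[OF ag4 e4(1) l(2) 4(3,1) b R]], goal_cases)
            case (1 t5 s5)
            have "s5 24 (ad2 l l') = of_bool (?g l l')" if "l' < Suc k" for l'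
              using 1(1) 4(1,2) that inj[of l' k l l] by (cases "l' = k") auto
            moreover have "?J l s1 s5" using 1(1) 4(1,2) inj by auto
            ultimately show ?case using 1(1) by simp
          qed
        qed (use e2 in auto)
        then show ?case
        proof (rule wp_use, goal_cases)
          case (1 t3 s3)
          have "t2 \<le> 600 * (Suc T * Suc T)" using \<open>_ \<and> t2 \<le> _\<close> by blast
          then show ?case using 1(1) by simp
        qed
      qed
    next
      case 2
      then have z: "s0 21 l = 0" using e l by simp
      have "wp (For 42 (V 10) (Store 24 (ix2 (V 41) (V 42)) (Const 0)))
         (\<lambda>t s. ((\<forall>l'<L. s 24 (ad2 l l') = of_bool (?g l l')) \<and> ?J l s1 s) \<and> t \<le> (40 + 20) * (Suc L * 1)) s1"
      proof (rule wp_For[where I = "\<lambda>k s. (\<forall>l'<k. s 24 (ad2 l l') = of_bool (?g l l')) \<and> ?J l s1 s"], goal_cases)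
        case (2 s)
        then show ?case using baseD(6)[OF tables_base[OF ts]] by (simp add: agree_def)
      next
        case (4 k s)
        have bs: "base s" using base_agree[OF tables_base[OF ts] 4(4)] by simp
        have x: "aval (ix2 (V 41) (V 42)) s = ad2 l k"
          using aval_ix2[OF bs, of "V 41"] 4 l L_le by (simp add: agree_def)
        show ?case
          unfolding wp_Store x using 4(1,2) g0[of l k] z l by (auto simp: inj less_Suc_eq)
      qed auto
      then show ?case by (rule wp_use) auto
    qed
  qed
  have "wp graph (\<lambda>t s. (\<forall>l<L. \<forall>l'<L. s 24 (ad2 l l') = of_bool (?g l l')) \<and>
    t \<le> (800 + 20) * (Suc L * (Suc T * Suc T + Suc L * Suc T))) s0"
    unfolding graph_def
  proof (rule wp_For[where I = "\<lambda>k s. \<forall>l<k. \<forall>l'<L. s 24 (ad2 l l') = of_bool (?g l l')"], goal_cases)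
    case (2 s)
    then show ?case using baseD(6)[OF tables_base[OF tb]] by (simp add: agree_def)
  next
    case (4 k s)
    have ag: "agree ?A s0 s" using 4(4) by (auto simp: agree_def)
    show ?case
    proof (rule wp_use[OF row[OF ag 4(3,1)]], goal_cases)
      case (1 t s')
      have "s' 24 (ad2 l l') = of_bool (?g l l')" if "l < Suc k" "l' < L" for l l'
        using 1(1) 4(2) that by (cases "l = k") auto
      then show ?case using 1(1) by simp
    qed
  qed auto
  then show ?thesis by (rule wp_use) (auto intro: order_trans)
qed

end

section \<open>From the check of one pair to all pairs\<close>

definition race_check :: com where
  "race_check = Seq load_v (Seq (Set 40 (Const 1)) (Seq open_scan
     (Seq (If (Eq (V 40) (Const 1)) (Seq graph peel) Skip)
       (If (Eq (V 40) (Const 1)) (Set 35 (Const 1)) Skip))))"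

definition pair_cell :: com where
  "pair_cell = If (Conj (conflictB 30 31)
     (Conj (Neg (Less (V 30) (Load 19 (ix3 (V 30) (V 31) (Load 8 (V 30))))))
       (Neg (Less (V 31) (Load 19 (ix3 (V 30) (V 31) (Load 8 (V 31))))))))
     race_check Skip"

definition pairs :: com where
  "pairs = Seq (Set 35 (Const 0)) (For 30 (V 0) (For 31 (V 0) pair_cell))"

lemma mods_pairs [simp]:
  "mods race_check = {20, 21, 22, 23, 24, 25, 26, 35, 39, 40, 41, 42, 43, 44, 46, 47}"
  "mods pair_cell = {20, 21, 22, 23, 24, 25, 26, 35, 39, 40, 41, 42, 43, 44, 46, 47}"
  by (auto simp: race_check_def pair_cell_def)

context coded_trace
begin

lemma wp_peel:
  assumes b: "base s0" and A: "\<And>l l'. l < L \<Longrightarrow> l' < L \<Longrightarrow> s0 24 (ad2 l l') = of_bool ((l, l') \<in> A)"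
    and sub: "A \<subseteq> {..<L} \<times> {..<L}" and ok: "s0 40 0 = 1"
  shows "wp peel (\<lambda>t s. (s 40 0 = 1 \<longleftrightarrow> acyclic A) \<and> t \<le> 800 * (Suc L * Suc L)) s0"
proof -
  let ?M = "{25, 26, 40, 41, 42, 44, 46}"
  let ?U = "\<lambda>s::store. {l. l < L \<and> s 26 l = 0}"
  let ?C = "\<lambda>s. \<forall>l'<L. s 25 l' = card {l \<in> ?U s. (l, l') \<in> A}"
  have bM: "base s" if "agree ?M s0 s" for s by (rule base_agree[OF b that]) simp
  have AM: "s 24 (ad2 l l') = of_bool ((l, l') \<in> A)" if "agree ?M s0 s" "l < L" "l' < L" for s l l'
    using A that by (simp add: agree_def)
  have col: "wp count_col (\<lambda>t s. (s 25 l' = card {l. l < L \<and> (l, l') \<in> A} \<and> s 26 l' = 0 \<and>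
      (\<forall>x. x \<noteq> l' \<longrightarrow> s 25 x = s1 25 x \<and> s 26 x = s1 26 x)) \<and> t \<le> 120 * Suc L) s1"
    if ag: "agree ?M s0 s1" and l: "s1 42 0 = l'" "l' < L" for s1 l'
  proof -
    let ?s = "upd (upd s1 25 l' 0) 26 l' 0"
    have ag': "agree ?M s0 ?s" using ag by simp
    have W: "wp (For 41 (V 10) (Store 25 (V 42) (Add (Load 25 (V 42)) (Load 24 (ix2 (V 41) (V 42))))))
      (\<lambda>t s. (s 25 l' = card {l. l < L \<and> (l, l') \<in> A} \<and> (\<forall>x. x \<noteq> l' \<longrightarrow> s 25 x = s1 25 x)) \<and> t \<le> (60 + 20) * (Suc L * 1)) ?s"
    proof (rule wp_For[where I = "\<lambda>k s. s 25 l' = card {l. l < k \<and> (l, l') \<in> A} \<and> (\<forall>x. x \<noteq> l' \<longrightarrow> s 25 x = s1 25 x)"], goal_cases)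
      case (2 s)
      then show ?case using ag' baseD(6)[OF b] by (simp add: agree_def)
    next
      case (4 k s)
      have ag4: "agree ?M s0 s" using agree_trans[OF ag' 4(4)] by simp
      have e: "s 42 0 = l'" using 4(4) l by (simp add: agree_def)
      have "aval (ix2 (V 41) (V 42)) s = ad2 k l'"
        using aval_ix2[OF bM[OF ag4], of "V 41"] 4(1,3) e L_le by simp
      moreover have "card {l. l < Suc k \<and> (l, l') \<in> A} = card {l. l < k \<and> (l, l') \<in> A} + of_bool ((k, l') \<in> A)"
      proof -
        have "{l. l < Suc k \<and> (l, l') \<in> A} = (if (k, l') \<in> A then insert k {l. l < k \<and> (l, l') \<in> A}
            else {l. l < k \<and> (l, l') \<in> A})" by (auto simp: less_Suc_eq)
        then show ?thesis by simp
      qed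
      ultimately show ?case using 4(1,2) AM[OF ag4 4(1) l(2)] e by simp
    qed auto
    have e: "aval (V 42) s1 = l'" "aval (V 42) (upd s1 25 l' 0) = l'" using l by simp_all
    show ?thesis
      unfolding count_col_def wp_Seq wp_Store e aval.simps(1)
    proof (rule wp_use[OF W], goal_cases)
      case (1 t s)
      have "s 26 = (s1 26)(l' := 0)" using agreeD[OF 1(2), of 26] by (simp add: fun_upd_def)
      then show ?case using 1(1) by auto
    qed
  qed
  have count: "wp (For 42 (V 10) count_col) (\<lambda>t s. (\<forall>l'<L. s 25 l' = card {l. l < L \<and> (l, l') \<in> A} \<and> s 26 l' = 0) \<and>
      t \<le> (120 + 20) * (Suc L * Suc L)) s0"
  proof (rule wp_For[where I = "\<lambda>k s. \<forall>l'<k. s 25 l' = card {l. l < L \<and> (l, l') \<in> A} \<and> s 26 l' = 0"], goal_cases)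
    case (2 s)
    then show ?case using baseD(6)[OF b] by (simp add: agree_def)
  next
    case (4 k s)
    have ag: "agree ?M s0 s" using 4(4) by (auto simp: agree_def)
    show ?case
      by (rule wp_use[OF col[OF ag 4(3,1)]]) (use 4(2) in \<open>auto simp: less_Suc_eq\<close>)
  qed auto
  have pick: "wp pick_source (\<lambda>t s. (s 46 0 = 0 \<and> (\<forall>l\<in>?U s1. s1 25 l \<noteq> 0) \<or>
      (\<exists>x\<in>?U s1. s 46 0 = Suc x \<and> s1 25 x = 0)) \<and> t \<le> 100 * Suc L) s1"
    if ag: "agree ?M s0 s1" for s1
  proof -
    have "wp (For 41 (V 10) (If (Conj (Eq (Load 26 (V 41)) (Const 0)) (Eq (Load 25 (V 41)) (Const 0)))
       (Set 46 (Add (V 41) (Const 1))) Skip)) (\<lambda>t s. (s 46 0 = 0 \<and> (\<forall>l<L. l \<in> ?U s1 \<longrightarrow> s1 25 l \<noteq> 0) \<or>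
        (\<exists>x\<in>?U s1. s 46 0 = Suc x \<and> s1 25 x = 0)) \<and> t \<le> (60 + 20) * (Suc L * 1)) (upd s1 46 0 0)"
    proof (rule wp_For[where I = "\<lambda>k s. s 46 0 = 0 \<and> (\<forall>l<k. l \<in> ?U s1 \<longrightarrow> s1 25 l \<noteq> 0) \<or>
        (\<exists>x\<in>?U s1. s 46 0 = Suc x \<and> s1 25 x = 0)"], goal_cases)
      case (2 s)
      then show ?case using ag baseD(6)[OF b] by (simp add: agree_def)
    next
      case (4 k s)
      have e: "s 25 = s1 25" "s 26 = s1 26" using 4(4) by (simp_all add: agree_def)
      show ?case using 4(1,2,3) e by (auto simp: less_Suc_eq)
    qed auto
    then show ?thesis
      unfolding pick_source_def wp_Seq wp_Store aval.simps by (rule wp_use) auto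
  qed
  have remove: "wp remove_source (\<lambda>t s. (?U s = ?U s1 - {x} \<and> ?C s) \<and> t \<le> 120 * Suc L) s1"
    if ag: "agree ?M s0 s1" and x: "s1 46 0 = Suc x" "x \<in> ?U s1" and C: "?C s1" for s1 x
  proof -
    let ?s = "upd (upd s1 46 0 x) 26 x 1"
    have ag': "agree ?M s0 ?s" using ag by simp
    have W: "wp (For 42 (V 10) (Store 25 (V 42) (Sub (Load 25 (V 42)) (Load 24 (ix2 (V 46) (V 42))))))
      (\<lambda>t s. (\<forall>l. s 25 l = (if l < L then s1 25 l - of_bool ((x, l) \<in> A) else s1 25 l)) \<and> t \<le> (60 + 20) * (Suc L * 1)) ?s"
    proof (rule wp_For[where I = "\<lambda>k s. \<forall>l. s 25 l = (if l < k then s1 25 l - of_bool ((x, l) \<in> A) else s1 25 l)"], goal_cases)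
      case (2 s)
      then show ?case using ag' baseD(6)[OF b] by (simp add: agree_def)
    next
      case (4 k s)
      have ag4: "agree ?M s0 s" using agree_trans[OF ag' 4(4)] by simp
      have e: "s 46 0 = x" using 4(4) by (simp add: agree_def)
      have "aval (ix2 (V 46) (V 42)) s = ad2 x k"
        using aval_ix2[OF bM[OF ag4], of "V 46"] 4(1,3) e x L_le by simp
      then show ?case using 4(1,2,3) AM[OF ag4 _ 4(1), of x] x(2) by (auto simp: less_Suc_eq)
    qed auto
    have e: "aval (Sub (V 46) (Const 1)) s1 = x" "aval (V 46) (upd s1 46 0 x) = x"
      using x by simp_all
    show ?thesis
      unfolding remove_source_def wp_Seq wp_Store e aval.simps(1)
    proof (rule wp_use[OF W], goal_cases)
      case (1 t s)
      have "s 26 = (s1 26)(x := 1)" using agreeD[OF 1(2), of 26] by (simp add: fun_upd_def)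
      then have U: "?U s = ?U s1 - {x}" by auto
      have "s 25 l' = card {l \<in> ?U s. (l, l') \<in> A}" if l': "l' < L" for l'
      proof -
        have "{l \<in> ?U s. (l, l') \<in> A} = {l \<in> ?U s1. (l, l') \<in> A} - {x}" using U by auto
        moreover have "s1 25 l' = card {l \<in> ?U s1. (l, l') \<in> A}" using C l' by simp
        \<comment> \<open>The truncated subtraction is exact: \<open>x\<close> is still present,
          hence counted in the in-degree of each lock to which it has an edge.\<close>
        moreover have "x \<in> {l \<in> ?U s1. (l, l') \<in> A} \<longleftrightarrow> (x, l') \<in> A" using x by simp
        ultimately show ?thesis using 1(1) l' by (auto simp: card_Diff_singleton_if)
      qed
      then show ?case using U 1(1) by simp
    qed
  qed
  \<comment> \<open>After \<open>k\<close> rounds either \<open>k\<close> locks have been removed or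
    the remaining ones have no source; the second alternative persists, since further rounds then
    change nothing.\<close>
  let ?K = "\<lambda>k s. ?C s \<and> (acyclic (A \<inter> ?U s \<times> ?U s) \<longleftrightarrow> acyclic A) \<and>
      (card (?U s) + k \<le> L \<or> (\<forall>x\<in>?U s. \<exists>y\<in>?U s. (y, x) \<in> A))"
  have fin: "finite (?U s)" for s by simp
  have round: "wp peel_round (\<lambda>t s. ?K (Suc k) s \<and> t \<le> 250 * Suc L) s1"
    if ag: "agree ?M s0 s1" and K: "?K k s1" for s1 k
    unfolding peel_round_def wp_Seq
  proof (rule wp_use[OF pick[OF ag]], goal_cases)
    case (1 t2 s2)
    have t2: "t2 \<le> 100 * Suc L" using 1(1) by blast
    have ag2: "agree ?M s0 s2" using agree_trans[OF ag 1(2)] by simp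
    have e2: "s2 25 = s1 25" "s2 26 = s1 26" using 1(2) by (simp_all add: agree_def)
    have C: "?C s1" using K by blast
    have src: "s1 25 x = 0 \<longleftrightarrow> (\<forall>y\<in>?U s1. (y, x) \<notin> A)" if "x \<in> ?U s1" for x
      using C that by (auto simp: card_eq_0_iff)
    show ?case
      unfolding wp_If
    proof (intro conjI impI, goal_cases)
      case 1
      then obtain x where x: "x \<in> ?U s1" "s2 46 0 = Suc x" "s1 25 x = 0"
        using \<open>(_ \<or> _) \<and> t2 \<le> _\<close> by auto
      have x2: "x \<in> ?U s2" "?C s2" using x C e2 by simp_all
      have ns: "\<And>y. y \<in> ?U s1 \<Longrightarrow> (y, x) \<notin> A" using src x by blast
      show ?case
      proof (rule wp_use[OF remove[OF ag2 x(2) x2]], goal_cases)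
        case (1 t3 s3)
        have U: "?U s3 = ?U s1 - {x}" using 1(1) e2 by simp
        have "card (?U s1) + k \<le> L" using K ns x(1) by blast
        moreover have "card (?U s1) = Suc (card (?U s3))"
          unfolding U using card_Suc_Diff1[OF fin[of s1] x(1)] by (rule sym)
        ultimately have "card (?U s3) + Suc k \<le> L" by simp
        moreover have "acyclic (A \<inter> ?U s3 \<times> ?U s3) \<longleftrightarrow> acyclic A"
          unfolding U using acyclic_remove_source[of "?U s1" x A] ns K by blast
        moreover have "?C s3" using 1(1) by blast
        moreover have "t3 \<le> 120 * Suc L" using 1(1) by blast
        then have "t2 + (1 + bcost (Less (Const 0) (V 46)) + t3) \<le> 250 * Suc L" using t2 by simp
        ultimately show ?case by blast
      qed
    next
      case 2
      then have "\<forall>l\<in>?U s1. s1 25 l \<noteq> 0" using \<open>(_ \<or> _) \<and> t2 \<le> _\<close> by auto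
      then have "\<forall>x\<in>?U s1. \<exists>y\<in>?U s1. (y, x) \<in> A" using src by blast
      then have "?K (Suc k) s1" using K by blast
      then have "?K (Suc k) s2" unfolding e2 .
      then show ?case using t2 by (simp only: wp_Skip) simp
    qed
  qed
  show ?thesis
    unfolding peel_def wp_Seq
  proof (rule wp_use[OF count], goal_cases)
    case (1 t1 s1)
    have ag1: "agree ?M s0 s1" using 1(2) by (auto simp: agree_def)
    have o1: "s1 40 0 = 1" using 1(2) ok by (simp add: agree_def)
    have t1: "t1 \<le> 140 * (Suc L * Suc L)" using 1(1) by simp
    have U1: "?U s1 = {..<L}" using 1(1) by auto
    have "A \<inter> {..<L} \<times> {..<L} = A" using sub by blast
    then have K1: "?K 0 s1" unfolding U1 using 1(1) by auto
    have "wp (For 44 (V 10) peel_round) (\<lambda>t s. ?K L s \<and> t \<le> (250 + 20) * (Suc L * Suc L)) s1"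
    proof (rule wp_For[where I = ?K], goal_cases)
      case (2 s)
      then show ?case using ag1 baseD(6)[OF b] by (simp add: agree_def)
    next
      case 3
      have "(upd s1 44 0 0) 25 = s1 25" "(upd s1 44 0 0) 26 = s1 26" by simp_all
      then show ?case using K1 by simp
    next
      case (4 k s)
      have ag: "agree ?M s0 s" using agree_trans[OF ag1 4(4)] by simp
      show ?case
      proof (rule wp_use[OF round[OF ag 4(2)]], goal_cases)
        case (1 t s')
        have "(upd s' 44 0 (Suc k)) 25 = s' 25" "(upd s' 44 0 (Suc k)) 26 = s' 26" by simp_all
        then show ?case using 1(1) by presburger
      qed
    qed auto
    then show ?case
    proof (rule wp_use, goal_cases)
      case (1 t2 s2)
      have ag2: "agree ?M s0 s2" using agree_trans[OF ag1 1(2)] by simp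
      have t2: "t2 \<le> 270 * (Suc L * Suc L)" using 1(1) by simp
      have o2: "s2 40 0 = 1" using 1(2) o1 by (simp add: agree_def)
      \<comment> \<open>After \<open>L\<close> rounds the first alternative of \<open>?K\<close>
        leaves no lock; so if any lock is left, the remaining ones have no source and contain a
        cycle.\<close>
      have fin_iff: "?U s2 = {} \<longleftrightarrow> acyclic A"
      proof (cases "?U s2 = {}")
        case True
        have "acyclic (A \<inter> ?U s2 \<times> ?U s2)" unfolding True by (simp add: acyclic_def)
        then show ?thesis using 1(1) True by blast
      next
        case False
        then have "0 < card (?U s2)" by (simp add: card_gt_0_iff)
        then have "\<forall>x\<in>?U s2. \<exists>y\<in>?U s2. (y, x) \<in> A" using 1(1) by linarith
        then have "\<not> acyclic (A \<inter> ?U s2 \<times> ?U s2)"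
          by (intro not_acyclic_if_no_source[OF fin[of s2] False]) blast
        then show ?thesis using 1(1) False by blast
      qed
      have "wp (For 41 (V 10) (If (Eq (Load 26 (V 41)) (Const 0)) (Set 40 (Const 0)) Skip))
         (\<lambda>t s. (s 40 0 = 1 \<longleftrightarrow> (\<forall>l<L. s2 26 l \<noteq> 0)) \<and> t \<le> (40 + 20) * (Suc L * 1)) s2"
      proof (rule wp_For[where I = "\<lambda>k s. s 40 0 = 1 \<longleftrightarrow> (\<forall>l<k. s2 26 l \<noteq> 0)"], goal_cases)
        case (2 s)
        then show ?case using ag2 baseD(6)[OF b] by (simp add: agree_def)
      next
        case (4 k s)
        have "s 26 = s2 26" using 4(4) by (simp add: agree_def)
        then show ?case using 4(1,2,3) by (auto simp: less_Suc_eq)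
      qed (use o2 in auto)
      then show ?case
      proof (rule wp_use, goal_cases)
        case (1 t3 s3)
        have "s3 40 0 = 1 \<longleftrightarrow> ?U s2 = {}" using 1(1) by auto
        moreover have "t3 \<le> 60 * (Suc L * Suc L)" using 1(1) by simp
        ultimately show ?case using fin_iff t1 t2 by simp
      qed
    qed
  qed
qed

definition race :: "nat \<Rightarrow> nat \<Rightarrow> bool" where
  "race i j \<longleftrightarrow> cf i j \<and> i \<notin> Cl i j \<and> j \<notin> Cl i j \<and> feasible (Cl i j)"

lemma feasible_iff:
  assumes cl: "dep_closed C"
  shows "feasible C \<longleftrightarrow> (\<forall>a b. open_acq C a \<and> open_acq C b \<and> lk a = lk b \<longrightarrow> a = b) \<and> acyclic (lock_graph C)"
proof -
  have "od a = od b \<longleftrightarrow> lk a = lk b" if "open_acq C a" "open_acq C b" for a b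
    using that lk_eq_iff[of a b] dep_closed_less[OF cl] by (auto simp: open_acq_def)
  then have "(\<forall>a b. open_acq C a \<and> open_acq C b \<and> od a = od b \<longrightarrow> a = b) \<longleftrightarrow>
      (\<forall>a b. open_acq C a \<and> open_acq C b \<and> lk a = lk b \<longrightarrow> a = b)" by blast
  then show ?thesis unfolding feasible_def using acyclic_lock_graph[OF cl] by blast
qed

lemma lock_graph_bounded: "dep_closed C \<Longrightarrow> lock_graph C \<subseteq> {..<L} \<times> {..<L}"
  using lk_less dep_closed_less by (auto simp: lock_graph_def open_acq_def)

lemma wp_race_check:
  assumes tb: "tables s0" and i: "s0 30 0 = i" "i < n" "s0 31 0 = j" "j < n"
    and v: "vec (\<lambda>t. s0 19 (ad3 i j t)) C" and cl: "dep_closed C"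
  shows "wp race_check (\<lambda>t s. s 35 0 = (if feasible C then 1 else s0 35 0) \<and>
    t \<le> 2500 * (Suc L * (Suc T * Suc T + Suc L * Suc T))) s0"
  unfolding race_check_def wp_Seq
proof (rule wp_use[OF wp_load_v[OF tb i v]], goal_cases)
  case (1 t1 s1)
  \<comment> \<open>The cost of building the lock graph, up to a constant. It dominates loading the
    vector, scanning for open acquires and removing sources.\<close>
  define Y where "Y = Suc L * (Suc T * Suc T + Suc L * Suc T)"
  have Y: "Suc L * Suc T \<le> Y" "Suc L * Suc L \<le> Y" "Suc T \<le> Y" "1 \<le> Y"
  proof -
    show "Suc L * Suc L \<le> Y" unfolding Y_def by (intro mult_le_mono2 trans_le_add2) simp
    show "Suc L * Suc T \<le> Y" unfolding Y_def by (intro mult_le_mono2 trans_le_add1) simp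
  qed (simp_all add: Y_def)
  let ?s = "upd s1 40 0 1"
  have ts: "tables ?s"
    by (rule tables_agree[OF tb, of "{20, 39, 40}"]) (use 1(2) in \<open>auto simp: agree_def\<close>)
  have e: "?s 35 0 = s0 35 0" using 1(2) by (simp add: agree_def)
  have t1: "t1 \<le> 60 * Y" using 1(1) order_trans[OF _ mult_le_mono2[OF Y(3)]] by blast
  have v1: "vec (?s 20) C" using 1(1) by simp
  show ?case
    unfolding wp_Store aval.simps
  proof (rule wp_use[OF wp_open_scan[OF ts v1 cl]], goal_cases)
    case (2 t2 s2)
    have t2: "t2 \<le> 300 * Y" using 2(1) order_trans[OF _ mult_le_mono2[OF Y(1)]] by blast
    have ts2: "tables s2" by (rule tables_agree[OF ts 2(2)]) simp
    have e2: "s2 35 0 = s0 35 0" using 2(2) e by (simp add: agree_def)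
    have v2: "vec (s2 20) C" using 2(2) v1 by (simp add: agree_def)
    show ?case
    proof (cases "s2 40 0 = 1")
      case False
      then have "\<not> feasible C" using 2(1) feasible_iff[OF cl] by blast
      then show ?thesis using False e2 t1 t2 Y(4) unfolding Y_def[symmetric] by simp
    next
      case True
      have uniq: "a = b" if "open_acq C a" "open_acq C b" "lk a = lk b" for a b
        using True 2(1) that by blast
      have b: "bval (Eq (V 40) (Const 1)) s2" using True by simp
      have op: "open_found C s2" using 2(1) by blast
      have "wp (Seq graph peel) (\<lambda>t s. (s 40 0 = 1 \<longleftrightarrow> feasible C) \<and> t \<le> 1900 * Y) s2"
        unfolding wp_Seq
      proof (rule wp_use[OF wp_graph[OF ts2 v2 cl op uniq]], goal_cases)
        case (4 t3 s3)
        have ts3: "tables s3" by (rule tables_agree[OF ts2 4(2)]) simp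
        have o3: "s3 40 0 = 1" using 4(2) True by (simp add: agree_def)
        have t3: "t3 \<le> 1000 * Y" using 4(1) unfolding Y_def by blast
        show ?case
        proof (rule wp_use[OF wp_peel[OF tables_base[OF ts3] _ lock_graph_bounded[OF cl] o3]], goal_cases)
          case (2 t4 s4)
          have "t4 \<le> 800 * Y" using 2(1) order_trans[OF _ mult_le_mono2[OF Y(2)]] by blast
          then show ?case using 2(1) t3 feasible_iff[OF cl] uniq by auto
        qed (use 4(1) in blast)
      qed
      then show ?thesis
        unfolding wp_If[of "Eq (V 40) (Const 1)" "Seq graph peel"]
      proof (intro conjI impI, goal_cases)
        case 1
        then show ?case
        proof (elim wp_use, goal_cases)
          case (1 t3 s3)
          have "s3 35 0 = s0 35 0" using 1(3) e2 by (simp add: agree_def)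
          then show ?case using 1(2) t1 t2 Y(4) unfolding Y_def[symmetric] by simp
        qed
      qed (use b in blast)
    qed
  qed simp
qed

lemma wp_pairs:
  assumes tb: "tables s0" and v: "\<And>i j. i < n \<Longrightarrow> j < n \<Longrightarrow> vec (\<lambda>t. s0 19 (ad3 i j t)) (Cl i j)"
  shows "wp pairs (\<lambda>t s. s 35 0 = of_bool (\<exists>i<n. \<exists>j<n. race i j) \<and>
    t \<le> 3000 * (Suc n * (Suc n * (Suc L * (Suc T * Suc T + Suc L * Suc T))))) s0"
proof -
  define Y where "Y = Suc L * (Suc T * Suc T + Suc L * Suc T)"
  have Y: "1 \<le> Y" unfolding Y_def by simp
  let ?A = "{20, 21, 22, 23, 24, 25, 26, 30, 31, 35, 39, 40, 41, 42, 43, 44, 46, 47}"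
  have cell: "wp pair_cell (\<lambda>t s. s 35 0 = (if race i j then 1 else s1 35 0) \<and> t \<le> 2650 * Y) s1"
    if ag: "agree ?A s0 s1" and i: "s1 30 0 = i" "i < n" "s1 31 0 = j" "j < n" for s1 i j
  proof -
    have ts: "tables s1" by (rule tables_agree[OF tb ag]) simp
    have bs: "base s1" using ts by (rule tables_base)
    have v1: "vec (\<lambda>t. s1 19 (ad3 i j t)) (Cl i j)" using v[OF i(2,4)] ag by (simp add: agree_def)
    have c: "bval (Conj (conflictB 30 31)
       (Conj (Neg (Less (V 30) (Load 19 (ix3 (V 30) (V 31) (Load 8 (V 30))))))
       (Neg (Less (V 31) (Load 19 (ix3 (V 30) (V 31) (Load 8 (V 31)))))))) s1
      \<longleftrightarrow> cf i j \<and> i \<notin> Cl i j \<and> j \<notin> Cl i j"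
      using bval_conflictB[OF bs, of 30 31] i vecD[OF v1]
      by (simp add: aval_ix3[OF bs] baseD[OF bs])
    show ?thesis
      unfolding pair_cell_def wp_If c
    proof (intro conjI impI, goal_cases)
      case 1
      show ?case
        by (rule wp_use[OF wp_race_check[OF ts i v1 dep_closed_Cl[OF i(2,4)], folded Y_def]])
          (use 1 Y in \<open>auto simp: race_def\<close>)
    next
      case 2
      then show ?case using Y by (auto simp: race_def)
    qed
  qed
  have row: "wp (For 31 (V 0) pair_cell) (\<lambda>t s. s 35 0 = (if \<exists>j<n. race i j then 1 else s1 35 0) \<and>
      t \<le> (2650 + 20) * (Suc n * Y)) s1"
    if ag: "agree ?A s0 s1" and i: "s1 30 0 = i" "i < n" for s1 i
  proof (rule wp_For[where I = "\<lambda>k s. s 35 0 = (if \<exists>j<k. race i j then 1 else s1 35 0)"], goal_cases)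
    case (2 s)
    then show ?case using ag baseD(1)[OF tables_base[OF tb]] by (simp add: agree_def)
  next
    case (4 k s)
    have ag4: "agree ?A s0 s" using agree_trans[OF ag 4(4)] by simp
    have e: "s 30 0 = i" using 4(4) i by (simp add: agree_def)
    show ?case
      by (rule wp_use[OF cell[OF ag4 e i(2) 4(3,1)]]) (use 4(2) in \<open>auto simp: less_Suc_eq\<close>)
  qed (use Y in auto)
  have all: "wp (For 30 (V 0) (For 31 (V 0) pair_cell)) (\<lambda>t s. s 35 0 = of_bool (\<exists>i<n. \<exists>j<n. race i j) \<and>
      t \<le> (2670 + 20) * (Suc n * (Suc n * Y))) (upd s0 35 0 0)"
  proof (rule wp_For[where I = "\<lambda>k s. s 35 0 = of_bool (\<exists>i<k. \<exists>j<n. race i j)"], goal_cases)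
    case (2 s)
    then show ?case using baseD(1)[OF tables_base[OF tb]] by (simp add: agree_def)
  next
    case (4 k s)
    have ag: "agree ?A s0 s" using 4(4) by (auto simp: agree_def)
    show ?case
    proof (rule wp_use[OF row[OF ag 4(3,1)]], goal_cases)
      case (1 t s')
      have ex: "(\<exists>i<Suc k. \<exists>j<n. race i j) \<longleftrightarrow> (\<exists>i<k. \<exists>j<n. race i j) \<or> (\<exists>j<n. race k j)"
        by (auto simp: less_Suc_eq)
      show ?case unfolding ex using 1(1) 4(2) by auto
    qed
  qed (use Y in auto)
  show ?thesis
    unfolding pairs_def wp_Seq wp_Store aval.simps Y_def[symmetric]
  proof (rule wp_use[OF all], goal_cases)
    case (1 t s)
    have "1 \<le> Suc n * (Suc n * Y)" using Y by simp
    then show ?case using 1(1) by simp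
  qed
qed

end

section \<open>The whole program\<close>

definition mult_step :: com where
  "mult_step = Store 5 (Add (V 30) (Const 1)) (Add (Load 5 (V 30)) (Add (V 0) (Const 1)))"

text \<open>The square of \<open>n + 1\<close> is needed as a loop bound but cannot be multiplied
  out. A first pass of \<open>n + 1\<close> additions produces it as entry \<open>n + 1\<close>, and
  a second pass extends the table up to this bound.\<close>

definition mult_table :: com where
  "mult_table = Seq (For 30 (Add (V 0) (Const 1)) mult_step)
     (Seq (Set 48 (Load 5 (Add (V 0) (Const 1)))) (For 30 (V 48) mult_step))"

text \<open>Consecutive numbering, in order of first occurrence, of the values in array \<open>src\<close> at the
  positions whose operation code plus \<open>c\<close> exceeds 1: all events for \<open>c = 2\<close>, the lock operations
  for \<open>c = 0\<close>. Array \<open>mp\<close> maps a value to its number plus 1.\<close>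

definition renumber :: "nat \<Rightarrow> nat \<Rightarrow> nat \<Rightarrow> nat \<Rightarrow> nat \<Rightarrow> com" where
  "renumber c src mp cnt out = For 30 (V 0) (If (Less (Const 1) (Add (Load 3 (V 30)) (Const c)))
     (Seq (If (Eq (Load mp (Load src (V 30))) (Const 0))
        (Seq (Set cnt (Add (V cnt) (Const 1))) (Store mp (Load src (V 30)) (V cnt))) Skip)
       (Store out (V 30) (Sub (Load mp (Load src (V 30))) (Const 1)))) Skip)"

definition race_program :: com where
  "race_program = Seq mult_table (Seq (renumber 2 2 6 7 8) (Seq (renumber 0 4 9 10 11)
     (Seq match_table (Seq rf_table (Seq closure_table (Seq last_table (Seq succ_table
     (Seq range_table (Seq sweep_all (Seq pairs (Set 0 (V 35))))))))))))"

lemma mods_program [simp]: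
  "mods mult_table = {5, 30, 48}"
  "mods (renumber c src mp cnt out) = {30, mp, cnt, out}"
  "mods match_table = {12, 30, 31, 32}"
  "mods rf_table = {13, 30, 31}"
  "mods closure_table = {14, 20, 30, 31, 39}"
  "mods last_table = {15, 16, 30, 31}"
  "mods succ_table = {17, 30, 31, 32, 39}"
  "mods range_table = {18, 30, 31, 39}"
  "mods sweep_all = {19, 20, 30, 31, 32, 33, 34, 36, 37, 38, 39}"
  by (auto simp: mult_table_def mult_step_def renumber_def sweep_all_def table_defs)

lemma wp_mult_table:
  assumes n: "s0 0 0 = n" and z: "s0 5 0 = 0"
  shows "wp mult_table (\<lambda>t s. (\<forall>k\<le>Suc n * Suc n. s 5 k = k * Suc n) \<and> t \<le> 300 * (Suc n * Suc n)) s0"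
proof -
  let ?I = "\<lambda>k s. \<forall>m\<le>k. s 5 m = m * Suc n"
  have loop: "wp (For 30 ub mult_step) (\<lambda>t s. ?I N s \<and> t \<le> (40 + 20) * (Suc N * 1)) st"
    if st: "st 0 0 = n" "st 5 0 = 0" and ub: "\<And>s. agree {30, 5} st s \<Longrightarrow> aval ub s = N" and c: "acost ub \<le> 8"
    for st ub N
  proof (rule wp_For[where I = ?I], goal_cases)
    case (2 s)
    then show ?case using ub by (simp add: mult_step_def)
  next
    case (4 k s)
    have "s 0 0 = n" using 4(4) st by (simp add: agree_def mult_step_def)
    then show ?case using 4 by (auto simp: mult_step_def le_Suc_eq)
  qed (use st c in \<open>auto simp: mult_step_def\<close>)
  have mm: "mods mult_step = {5}" by (simp add: mult_step_def)
  show ?thesis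
    unfolding mult_table_def wp_Seq
  proof (rule wp_use[OF loop[of s0 "Add (V 0) (Const 1)" "Suc n", OF n z]], goal_cases)
    case (1 s)
    then show ?case using n by (simp add: agree_def)
  next
    case (3 t1 s1)
    let ?s = "upd s1 48 0 (Suc n * Suc n)"
    have s1: "s1 0 0 = n" using 3(2) n by (simp add: agree_def mm)
    have e: "aval (Const 0) s1 = 0" "aval (Load 5 (Add (V 0) (Const 1))) s1 = Suc n * Suc n"
      using 3(1) s1 by simp_all
    have s: "?s 0 0 = n" "?s 5 0 = 0" using 3(1) s1 by simp_all
    show ?case
      unfolding wp_Store e
    proof (rule wp_use[OF loop[of ?s "V 48" "Suc n * Suc n", OF s]], goal_cases)
      case (1 s)
      then show ?case by (simp add: agree_def)
    next
      case (3 t2 s2)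
      have "t1 \<le> 60 * Suc (Suc n)" "t2 \<le> 60 * Suc (Suc n * Suc n)"
        using 3(1) \<open>_ \<and> t1 \<le> _\<close> by simp_all
      then show ?case using 3(1) by simp
    qed simp
  qed simp
qed

text \<open>Array \<open>mp\<close> is addressed by the raw names, so a lookup takes unit time
  however large they are; a zero cell marks a name not seen before.\<close>

lemma wp_renumber:
  assumes d: "distinct [0, 3, 30, src, mp, cnt, out]" and n: "s0 0 0 = n"
    and z: "\<And>x. s0 mp x = 0" "s0 cnt 0 = 0"
  shows "wp (renumber c src mp cnt out) (\<lambda>t s.
     s cnt 0 = card (s0 src ` {i. i < n \<and> 1 < s0 3 i + c}) \<and>
     (\<forall>i<n. 1 < s0 3 i + c \<longrightarrow> s out i < s cnt 0) \<and>
     (\<forall>i<n. \<forall>j<n. 1 < s0 3 i + c \<and> 1 < s0 3 j + c \<longrightarrow> (s out i = s out j \<longleftrightarrow> s0 src i = s0 src j)) \<and>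
     t \<le> 120 * Suc n) s0"
proof -
  let ?f = "s0 src"
  let ?Q = "\<lambda>i. 1 < s0 3 i + c"
  let ?X = "\<lambda>k. ?f ` {i. i < k \<and> ?Q i}"
  let ?I = "\<lambda>k s. s cnt 0 = card (?X k) \<and> (\<forall>x. s mp x = 0 \<longleftrightarrow> x \<notin> ?X k) \<and> inj_on (s mp) (?X k) \<and>
     (\<forall>x\<in>?X k. s mp x \<le> card (?X k)) \<and> (\<forall>i<k. ?Q i \<longrightarrow> Suc (s out i) = s mp (?f i))"
  have "wp (renumber c src mp cnt out) (\<lambda>t s. ?I n s \<and> t \<le> (80 + 20) * (Suc n * 1)) s0"
    unfolding renumber_def
  proof (rule wp_For[where I = ?I], goal_cases)
    case (2 s)
    then show ?case using n d by (simp add: agree_def)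
  next
    case 3
    then show ?case using d z by simp
  next
    case (4 k s)
    have e: "s 3 = s0 3" "s src = ?f" using 4(4) d by (auto simp: agree_def)
    have I: "s cnt 0 = card (?X k)" "\<And>x. s mp x = 0 \<longleftrightarrow> x \<notin> ?X k" "inj_on (s mp) (?X k)"
      "\<And>x. x \<in> ?X k \<Longrightarrow> s mp x \<le> card (?X k)" "\<And>i. i < k \<Longrightarrow> ?Q i \<Longrightarrow> Suc (s out i) = s mp (?f i)"
      using 4(2) by blast+
    have fin: "finite (?X k)" by simp
    show ?case
    proof (cases "?Q k")
      case False
      then have X: "?X (Suc k) = ?X k" by (auto simp: less_Suc_eq)
      have "?I (Suc k) (upd s 30 0 (Suc k))"
        unfolding X using I d False by (auto simp: less_Suc_eq)
      then show ?thesis using False 4(3) e by simp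
    next
      case True
      then have X: "?X (Suc k) = insert (?f k) (?X k)" by (auto simp: less_Suc_eq)
      show ?thesis
      proof (cases "?f k \<in> ?X k")
        case in_X: True
        then have X': "?X (Suc k) = ?X k" unfolding X by blast
        have p: "0 < s mp (?f k)" using I(2) in_X by blast
        let ?s = "upd (upd s out k (s mp (?f k) - 1)) 30 0 (Suc k)"
        have "?I (Suc k) ?s"
          unfolding X' using I d True p by (auto simp: less_Suc_eq)
        then show ?thesis using True p 4(3) e d by simp
      next
        case new: False
        then have c: "card (?X (Suc k)) = Suc (card (?X k))" unfolding X using fin by simp
        have p: "s mp (?f k) = 0" using I(2) new by blast
        \<comment> \<open>The new number exceeds all numbers given so far, which keeps the map
          injective.\<close>
        let ?m = "(s mp)(?f k := Suc (card (?X k)))"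
        have m1: "?m x = s mp x" if "x \<in> ?X k" for x
        proof -
          have "x \<noteq> ?f k" using that new by blast
          then show ?thesis by simp
        qed
        have ne: "Suc (card (?X k)) \<notin> s mp ` ?X k"
        proof
          assume "Suc (card (?X k)) \<in> s mp ` ?X k"
          then obtain x where x: "x \<in> ?X k" "Suc (card (?X k)) = s mp x" by (rule imageE)
          then show False using I(4)[OF x(1)] by linarith
        qed
        have inj: "inj_on ?m (?X (Suc k))"
          unfolding X inj_on_insert
        proof
          show "inj_on ?m (?X k)" by (rule inj_on_fun_updI[OF I(3) ne])
          have "?m ` (?X k - {?f k}) \<subseteq> s mp ` ?X k"
          proof (rule image_subsetI)
            fix x assume "x \<in> ?X k - {?f k}"
            then have "x \<in> ?X k" by (rule DiffD1)
            then show "?m x \<in> s mp ` ?X k" unfolding m1[OF \<open>x \<in> ?X k\<close>] by (rule imageI)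
          qed
          then show "?m (?f k) \<notin> ?m ` (?X k - {?f k})" using ne unfolding fun_upd_same by blast
        qed
        have zero: "?m x = 0 \<longleftrightarrow> x \<notin> ?X (Suc k)" for x unfolding X using I(2) by auto
        have le: "?m x \<le> card (?X (Suc k))" if "x \<in> ?X (Suc k)" for x
        proof (cases "x = ?f k")
          case False
          then have x: "x \<in> ?X k" using that X by blast
          then have "?m x \<le> card (?X k)" using I(4) m1 by simp
          then show ?thesis unfolding c by (rule le_SucI)
        qed (simp only: c fun_upd_same)
        have old: "Suc (((s out)(k := card (?X k))) i) = ?m (?f i)" if "i < Suc k" "?Q i" for i
        proof (cases "i = k")
          case False
          then have "i < k" "?f i \<in> ?X k" using that by auto
          then show ?thesis using I(5) that False m1 by auto
        qed simp
        let ?s = "upd (upd (upd (upd s cnt 0 (Suc (card (?X k)))) mp (?f k) (Suc (card (?X k)))) out k (card (?X k))) 30 0 (Suc k)"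
        have sm: "?s cnt 0 = Suc (card (?X k))" "?s mp = ?m" "?s out = (s out)(k := card (?X k))"
          using d by auto
        have "?I (Suc k) ?s"
        proof (intro conjI)
          show "?s cnt 0 = card (?X (Suc k))" unfolding sm c ..
          show "\<forall>x. ?s mp x = 0 \<longleftrightarrow> x \<notin> ?X (Suc k)" unfolding sm using zero by blast
          show "inj_on (?s mp) (?X (Suc k))" unfolding sm by (rule inj)
          show "\<forall>x\<in>?X (Suc k). ?s mp x \<le> card (?X (Suc k))" unfolding sm using le by blast
          show "\<forall>i<Suc k. ?Q i \<longrightarrow> Suc (?s out i) = ?s mp (?f i)" unfolding sm using old by blast
        qed
        then show ?thesis using True p 4(3) e d I(1) by simp
      qed
    qed
  qed (use d in auto)
  then show ?thesis
  proof (rule wp_use, goal_cases)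
    case (1 t s)
    have fX: "?f i \<in> ?X n" if "i < n" "?Q i" for i using that by auto
    have inj: "inj_on (s mp) (?X n)" using 1(1) by blast
    have "s out i < s cnt 0" if "i < n" "?Q i" for i
    proof -
      have "Suc (s out i) = s mp (?f i)" "s cnt 0 = card (?X n)" using 1(1) that by blast+
      moreover have "s mp (?f i) \<le> card (?X n)" using 1(1) fX[OF that] by blast
      ultimately show ?thesis by simp
    qed
    moreover have "s out i = s out j \<longleftrightarrow> ?f i = ?f j" if "i < n" "j < n" "?Q i" "?Q j" for i j
    proof -
      have "Suc (s out i) = s mp (?f i)" "Suc (s out j) = s mp (?f j)" using 1(1) that by blast+
      moreover have "s mp (?f i) = s mp (?f j) \<longleftrightarrow> ?f i = ?f j"
        by (rule inj_on_eq_iff[OF inj fX[OF that(1,3)] fX[OF that(2,4)]])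
      ultimately show ?thesis by (metis Suc_inject)
    qed
    moreover have "s cnt 0 = card (?X n)" using 1(1) by blast
    moreover have "t \<le> 120 * Suc n" using 1(1) by simp
    ultimately show ?case by blast
  qed
qed

text \<open>The target bound. The running time uses it at successors, so that no factor vanishes
  when the trace is empty or has no locks.\<close>

definition cost_bound :: "nat \<Rightarrow> nat \<Rightarrow> nat \<Rightarrow> nat" where
  "cost_bound N T L = N * N * (L * (T * (T * T + L)))"

lemma (in coded_trace) wp_main:
  assumes b: "base s0" and z: "\<And>x. s0 15 x = 0" "\<And>x. s0 16 x = 0"
  shows "wp (Seq match_table (Seq rf_table (Seq closure_table (Seq last_table (Seq succ_table
     (Seq range_table (Seq sweep_all (Seq pairs (Set 0 (V 35)))))))))
     ) (\<lambda>t s. s 0 0 = of_bool (has_osr_race \<sigma>) \<and> t \<le> 20000 * cost_bound (Suc n) (Suc T) (Suc L)) s0"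
proof -
  define H where "H = cost_bound (Suc n) (Suc T) (Suc L)"
  let ?N = "Suc n" and ?T = "Suc T" and ?L = "Suc L"
  have H: "?N * ?N * m \<le> H" if "m \<le> ?L * (?T * (?T * ?T + ?L))" for m
    unfolding H_def cost_bound_def using that by (rule mult_le_mono2)
  have one: "1 \<le> ?T * ?T + ?L" by simp
  have HT: "?T \<le> ?L * (?T * (?T * ?T + ?L))"
  proof -
    have "1 * (?T * 1) \<le> ?L * (?T * (?T * ?T + ?L))" by (intro mult_le_mono one) auto
    then show ?thesis by simp
  qed
  have H1: "?N * ?N \<le> H" using H[of 1] HT by simp
  have H2: "?N * (?N * ?T) \<le> H" using H[OF HT] by (simp only: mult.assoc)
  \<comment> \<open>The sweeps: one factor \<open>T\<close> is absorbed by
    \<open>T * T + L\<close>.\<close>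
  have H3: "?N * (?T * (?N * (?T * ?L))) \<le> H"
  proof -
    have "?T \<le> ?T * ?T + ?L" by simp
    then have "?L * (?T * ?T) \<le> ?L * (?T * (?T * ?T + ?L))" by (intro mult_le_mono2)
    from H[OF this] show ?thesis by (simp only: ac_simps)
  qed
  \<comment> \<open>The checks of all pairs: \<open>T * T + L * T\<close> is at most
    \<open>T * (T * T + L)\<close>.\<close>
  have H4: "?N * (?N * (?L * (?T * ?T + ?L * ?T))) \<le> H"
  proof -
    have "?T * ?T + ?L * ?T \<le> ?T * (?T * ?T + ?L)"
    proof -
      have "?T * ?T \<le> ?T * (?T * ?T)" by simp
      then show ?thesis by (simp only: distrib_left mult.commute[of ?L ?T] add_le_mono1)
    qed
    then have "?L * (?T * ?T + ?L * ?T) \<le> ?L * (?T * (?T * ?T + ?L))" by (intro mult_le_mono2)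
    from H[OF this] show ?thesis by (simp only: mult.assoc)
  qed
  have le: "t \<le> k * H" if "t \<le> k * m" "m \<le> H" for t k m
    using that by (meson mult_le_mono2 order_trans)
  show ?thesis
    unfolding wp_Seq H_def[symmetric]
  proof (rule wp_use[OF wp_match_table[OF b]], goal_cases)
    case (1 t1 s1)
    have b1: "base s1" by (rule base_agree[OF b 1(2)]) simp
    have t1: "t1 \<le> 200 * H" by (rule le[OF _ H1]) (use 1 in blast)
    have z1: "\<And>x. s1 15 x = 0" "\<And>x. s1 16 x = 0" using 1(2) z by (simp_all add: agree_def)
    have M1: "\<forall>a<n. s1 12 a = M a" using 1(1) by blast
    show ?case
    proof (rule wp_use[OF wp_rf_table[OF b1]], goal_cases)
      case (1 t2 s2)
      have b2: "base s2" by (rule base_agree[OF b1 1(2)]) simp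
      have t2: "t2 \<le> 200 * H" by (rule le[OF _ H1]) (use 1 in blast)
      have z2: "\<And>x. s2 15 x = 0" "\<And>x. s2 16 x = 0" using 1(2) z1 by (simp_all add: agree_def)
      have M2: "\<forall>a<n. s2 12 a = M a" using 1(2) M1 by (simp add: agree_def)
      have rf: "\<And>i. i < n \<Longrightarrow> s2 13 i = RF i" using 1(1) by blast
      show ?case
      proof (rule wp_use[OF wp_closure_table[OF b2 rf]], goal_cases)
        case (2 t3 s3)
        have b3: "base s3" by (rule base_agree[OF b2 2(2)]) simp
        have t3: "t3 \<le> 500 * H" by (rule le[OF _ H2]) (use 2 in blast)
        have z3: "\<And>x. s3 15 x = 0" "\<And>x. s3 16 x = 0" using 2(2) z2 by (simp_all add: agree_def)
        have M3: "\<forall>a<n. s3 12 a = M a" using 2(2) M2 by (simp add: agree_def)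
        have V3: "\<forall>i<n. vec (\<lambda>t. s3 14 (ad2 i t)) (TRC i)" using 2(1) by blast
        show ?case
        proof (rule wp_use[OF wp_last_table[OF b3 z3]], goal_cases)
          case (1 t4 s4)
          have b4: "base s4" by (rule base_agree[OF b3 1(2)]) simp
          have t4: "t4 \<le> 400 * H" by (rule le[OF _ H1]) (use 1 in blast)
          have M4: "\<forall>a<n. s4 12 a = M a" using 1(2) M3 by (simp add: agree_def)
          have V4: "\<forall>i<n. vec (\<lambda>t. s4 14 (ad2 i t)) (TRC i)" using 1(2) V3 by (simp add: agree_def)
          have L4: "\<forall>q\<le>n. \<forall>t<T. \<forall>l<L. s4 15 (ad3 q t l) = LA q t l \<and> s4 16 (ad3 q t l) = LR q t l"
            using 1(1) by blast
          show ?case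
          proof (rule wp_use[OF wp_succ_table[OF b4]], goal_cases)
            case (1 t5 s5)
            have b5: "base s5" by (rule base_agree[OF b4 1(2)]) simp
            have t5: "t5 \<le> 400 * H" by (rule le[OF _ H1]) (use 1 in blast)
            have M5: "\<forall>a<n. s5 12 a = M a" using 1(2) M4 by (simp add: agree_def)
            have V5: "\<forall>i<n. vec (\<lambda>t. s5 14 (ad2 i t)) (TRC i)" using 1(2) V4 by (simp add: agree_def)
            have L5: "\<forall>q\<le>n. \<forall>t<T. \<forall>l<L. s5 15 (ad3 q t l) = LA q t l \<and> s5 16 (ad3 q t l) = LR q t l"
              using 1(2) L4 by (simp add: agree_def)
            have su: "\<And>i t. i < n \<Longrightarrow> t < T \<Longrightarrow> s5 17 (ad2 i t) = SU i t" using 1(1) by blast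
            show ?case
            proof (rule wp_use[OF wp_range_table[OF b5 su]], goal_cases)
              case (3 t6 s6)
              have t6: "t6 \<le> 500 * H" by (rule le[OF _ H2]) (use 3 in blast)
              have b6: "base s6" by (rule base_agree[OF b5 3(2)]) simp
              have e6: "s6 12 = s5 12" "s6 14 = s5 14" "s6 15 = s5 15" "s6 16 = s5 16"
                using 3(2) by (simp_all add: agree_def)
              have tb: "tables s6" unfolding tables_def e6 using b6 M5 V5 L5 3(1) by blast
              show ?case
              proof (rule wp_use[OF wp_sweep_all[OF tb]], goal_cases)
                case (1 t7 s7)
                have t7: "t7 \<le> 2000 * H" by (rule le[OF _ H3]) (use 1 in blast)
                have tb7: "tables s7" by (rule tables_agree[OF tb 1(2)]) simp
                have C: "\<And>i j. i < n \<Longrightarrow> j < n \<Longrightarrow> vec (\<lambda>t. s7 19 (ad3 i j t)) (Cl i j)" using 1(1) by blast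
                show ?case
                proof (rule wp_use[OF wp_pairs[OF tb7 C]], goal_cases)
                  case (3 t8 s8)
                  have t8: "t8 \<le> 3000 * H" by (rule le[OF _ H4]) (use 3 in blast)
                  have "1 \<le> H" using H1 by simp
                  then have "t1 + (t2 + (t3 + (t4 + (t5 + (t6 + (t7 + (t8 +
                      (1 + acost (Const 0) + acost (V 35))))))))) \<le> 20000 * H"
                    using t1 t2 t3 t4 t5 t6 t7 t8 by simp
                  then show ?case using 3(1) has_osr_race_ix by (simp add: race_def)
                qed auto
              qed
            qed auto
          qed
        qed
      qed auto
    qed
  qed
qed

lemma input_store_simps:
  "input_store \<sigma> 0 0 = length \<sigma>"
  "i < length \<sigma> \<Longrightarrow> input_store \<sigma> 2 i = th (\<sigma> ! i)"
  "i < length \<sigma> \<Longrightarrow> input_store \<sigma> 3 i = opcode (oper (\<sigma> ! i))"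
  "i < length \<sigma> \<Longrightarrow> input_store \<sigma> 4 i = operand (oper (\<sigma> ! i))"
  "5 \<le> a \<Longrightarrow> input_store \<sigma> a i = 0"
  by (simp_all add: input_store_def)

lemma num_threads_ix: "num_threads \<sigma> = card ((\<lambda>i. th (\<sigma> ! i)) ` {i. i < length \<sigma>})"
proof -
  have "th ` set \<sigma> = (\<lambda>i. th (\<sigma> ! i)) ` {i. i < length \<sigma>}"
    by (auto simp: set_conv_nth)
  then show ?thesis by (simp add: num_threads_def)
qed

lemma num_locks_ix:
  "num_locks \<sigma> = card ((\<lambda>i. operand (oper (\<sigma> ! i))) ` {i. i < length \<sigma> \<and> 1 < opcode (oper (\<sigma> ! i))})"
proof -
  have lock: "(oper e = Acq l \<or> oper e = Rel l) \<longleftrightarrow> 1 < opcode (oper e) \<and> operand (oper e) = l" for e l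
    by (cases "oper e") auto
  have "{l. \<exists>e \<in> set \<sigma>. oper e = Acq l \<or> oper e = Rel l} =
      (\<lambda>i. operand (oper (\<sigma> ! i))) ` {i. i < length \<sigma> \<and> 1 < opcode (oper (\<sigma> ! i))}"
    unfolding lock by (auto simp: set_conv_nth)
  then show ?thesis by (simp add: num_locks_def)
qed

lemma card_image_le_length: "card (f ` {i. i < m \<and> P i}) \<le> m"
proof -
  have "card (f ` {i. i < m \<and> P i}) \<le> card {i. i < m \<and> P i}" by (rule card_image_le) simp
  also have "\<dots> \<le> card {..<m}" by (rule card_mono) auto
  finally show ?thesis by simp
qed

lemma square_le_cost_bound: "1 \<le> T \<Longrightarrow> 1 \<le> L \<Longrightarrow> N * N \<le> cost_bound N T L"
proof -
  assume "1 \<le> T" "1 \<le> L"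
  then have "1 * (1 * 1) \<le> L * (T * (T * T + L))" by (intro mult_le_mono) auto
  then have "N * N * 1 \<le> N * N * (L * (T * (T * T + L)))" by (intro mult_le_mono2) simp
  then show ?thesis by (simp add: cost_bound_def)
qed

lemma wp_race_program:
  assumes \<sigma>: "\<sigma> \<in> input_traces"
  shows "wp race_program (\<lambda>t s. s 0 0 = of_bool (has_osr_race \<sigma>) \<and>
    t \<le> 30000 * cost_bound (Suc (length \<sigma>)) (Suc (num_threads \<sigma>)) (Suc (num_locks \<sigma>))) (input_store \<sigma>)"
proof -
  let ?n = "length \<sigma>" and ?s0 = "input_store \<sigma>"
  define H where "H = cost_bound (Suc ?n) (Suc (num_threads \<sigma>)) (Suc (num_locks \<sigma>))"
  have sq: "Suc ?n * Suc ?n \<le> H" unfolding H_def by (rule square_le_cost_bound) simp_all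
  have lin: "Suc ?n \<le> H" using sq by (metis le_add1 mult_Suc order_trans)
  have z0: "?s0 5 0 = 0" by (simp add: input_store_simps)
  show ?thesis
    unfolding race_program_def wp_Seq[of mult_table] wp_Seq[of "renumber _ _ _ _ _"] H_def[symmetric]
  proof (rule wp_use[OF wp_mult_table[of ?s0 ?n, OF input_store_simps(1) z0]], goal_cases)
    case (1 t1 s1)
    have t1: "t1 \<le> 300 * H" using 1(1) sq by (meson mult_le_mono2 order_trans)
    have e1: "s1 0 = ?s0 0" "s1 2 = ?s0 2" "s1 3 = ?s0 3" "s1 4 = ?s0 4" "s1 6 = ?s0 6" "s1 7 = ?s0 7"
      "s1 9 = ?s0 9" "s1 10 = ?s0 10" "s1 15 = ?s0 15" "s1 16 = ?s0 16"
      using 1(2) by (simp_all add: agree_def)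
    have m1: "\<forall>k\<le>Suc ?n * Suc ?n. s1 5 k = k * Suc ?n" using 1(1) by blast
    have R1: "distinct [0, 3, 30, 2, 6, 7, 8::nat]" "s1 0 0 = ?n" "\<And>x. s1 6 x = 0" "s1 7 0 = 0"
      unfolding e1 by (simp_all add: input_store_simps)
    show ?case
    proof (rule wp_use[OF wp_renumber[of 2 6 7 8 s1 ?n 2, OF R1]], goal_cases)
      case (1 t2 s2)
      have t2: "t2 \<le> 120 * H" using 1(1) lin by (meson mult_le_mono2 order_trans)
      have e2: "s2 0 = ?s0 0" "s2 3 = ?s0 3" "s2 4 = ?s0 4" "s2 5 = s1 5"
        "s2 9 = ?s0 9" "s2 10 = ?s0 10" "s2 15 = ?s0 15" "s2 16 = ?s0 16"
        using 1(2) e1 by (simp_all add: agree_def)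
      have T: "s2 7 0 = num_threads \<sigma>"
      proof -
        have "s1 2 ` {i. i < ?n \<and> 1 < s1 3 i + 2} = (\<lambda>i. th (\<sigma> ! i)) ` {i. i < ?n}"
          unfolding e1 by (auto simp: input_store_simps)
        then show ?thesis using 1(1) by (simp add: num_threads_ix)
      qed
      have tn: "s2 8 i < s2 7 0" "s2 8 i = s2 8 j \<longleftrightarrow> th (\<sigma> ! i) = th (\<sigma> ! j)" if "i < ?n" "j < ?n" for i j
      proof -
        have "1 < s1 3 k + 2" for k by simp
        then show "s2 8 i < s2 7 0" "s2 8 i = s2 8 j \<longleftrightarrow> th (\<sigma> ! i) = th (\<sigma> ! j)"
          using 1(1) that unfolding e1 by (auto simp: input_store_simps)
      qed
      have R2: "distinct [0, 3, 30, 4, 9, 10, 11::nat]" "s2 0 0 = ?n" "\<And>x. s2 9 x = 0" "s2 10 0 = 0"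
        unfolding e2 by (simp_all add: input_store_simps)
      show ?case
      proof (rule wp_use[OF wp_renumber[of 4 9 10 11 s2 ?n 0, OF R2]], goal_cases)
        case (1 t3 s3)
        have t3: "t3 \<le> 120 * H" using 1(1) lin by (meson mult_le_mono2 order_trans)
        have e3: "s3 0 = ?s0 0" "s3 3 = ?s0 3" "s3 4 = ?s0 4" "s3 5 = s1 5" "s3 7 = s2 7" "s3 8 = s2 8"
          "s3 15 = ?s0 15" "s3 16 = ?s0 16"
          using 1(2) e2 by (simp_all add: agree_def)
        have L: "s3 10 0 = num_locks \<sigma>"
        proof -
          have "s2 4 ` {i. i < ?n \<and> 1 < s2 3 i + 0} =
              (\<lambda>i. operand (oper (\<sigma> ! i))) ` {i. i < ?n \<and> 1 < opcode (oper (\<sigma> ! i))}"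
            unfolding e2 by (auto simp: input_store_simps image_iff)
          then show ?thesis using 1(1) by (simp add: num_locks_ix)
        qed
        have lk: "s3 11 i < s3 10 0" if "i < ?n" "2 \<le> opcode (oper (\<sigma> ! i))" for i
          using 1(1) that unfolding e2 by (auto simp: input_store_simps)
        have lk2: "s3 11 i = s3 11 j \<longleftrightarrow> operand (oper (\<sigma> ! i)) = operand (oper (\<sigma> ! j))"
          if "i < ?n" "j < ?n" "2 \<le> opcode (oper (\<sigma> ! i))" "2 \<le> opcode (oper (\<sigma> ! j))" for i j
          using 1(1) that unfolding e2 by (auto simp: input_store_simps)
        \<comment> \<open>The numberings of threads and locks are those left in the store by the two
          renumbering passes.\<close>
        interpret ix: indexed_trace \<sigma> "s3 8"
          by unfold_locales (use \<sigma> tn(2) e3 in \<open>auto simp: input_traces_def\<close>)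
        interpret coded_trace \<sigma> "s3 8" "s3 11" "num_threads \<sigma>" "num_locks \<sigma>"
        proof
          show "num_threads \<sigma> \<le> ?n"
            unfolding num_threads_ix using card_image_le_length[of _ ?n "\<lambda>_. True"] by simp
          show "num_locks \<sigma> \<le> ?n"
            unfolding num_locks_ix by (rule card_image_le_length)
        qed (use tn lk lk2 T L e3 in \<open>auto simp: ix.oc_def ix.od_def\<close>)
        have b: "base s3"
          unfolding base_def using m1 T L by (simp add: e3 input_store_simps ix.oc_def ix.od_def)
        have z: "\<And>x. s3 15 x = 0" "\<And>x. s3 16 x = 0" unfolding e3 by (simp_all add: input_store_simps)
        show ?case
        proof (rule wp_use[OF wp_main[OF b z]], goal_cases)
          case (1 t4 s4)
          have "t4 \<le> 20000 * H" using 1(1) unfolding H_def by blast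
          then have "t1 + (t2 + (t3 + t4)) \<le> 30000 * H" using t1 t2 t3 by linarith
          then show ?case using 1(1) by blast
        qed
      qed
    qed
  qed
qed

text \<open>Each successor is at most twice the corresponding maximum with 1. The squared length
  contributes 4, the factors for locks and threads 2 each, and the sum 4, where its linear term is
  rounded up to match the square; together 64.\<close>

lemma cost_bound_le:
  "cost_bound (Suc N) (Suc T) (Suc L) \<le>
     64 * (max 1 T * max 1 L * ((max 1 T)\<^sup>2 + max 1 L) * (max 1 N)\<^sup>2)"
proof -
  define n t l where "n = max 1 N" and "t = max 1 T" and "l = max 1 L"
  have s: "Suc N \<le> 2 * n" "Suc T \<le> 2 * t" "Suc L \<le> 2 * l"
    by (auto simp: n_def t_def l_def)
  have "Suc T * Suc T + Suc L \<le> (2 * t) * (2 * t) + 4 * l"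
    using s by (intro add_mono mult_le_mono) auto
  then have "cost_bound (Suc N) (Suc T) (Suc L) \<le>
      (2 * n) * (2 * n) * ((2 * l) * ((2 * t) * ((2 * t) * (2 * t) + 4 * l)))"
    unfolding cost_bound_def using s by (intro mult_le_mono)
  also have "\<dots> = 64 * (t * l * (t\<^sup>2 + l) * n\<^sup>2)"
    by (simp add: power2_eq_square algebra_simps)
  finally show ?thesis unfolding n_def t_def l_def .
qed

text \<open>With \<open>p = 1 + T + L\<close> both outer factors are at most \<open>p\<close> and
  the sum is at most \<open>2 * p\<^sup>2\<close>, hence degree 4 and the constant 2.\<close>

lemma target_le_poly:
  fixes N T L :: nat
  shows "max 1 T * max 1 L * ((max 1 T)\<^sup>2 + max 1 L) * (max 1 N)\<^sup>2 \<le> 2 * ((1 + T + L) ^ 4 * (max 1 N)\<^sup>2)"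
proof -
  define p where "p = 1 + T + L"
  have s: "max 1 T \<le> p" "max 1 L \<le> p" "1 \<le> p" by (auto simp: p_def)
  have "max 1 L \<le> p\<^sup>2" using s by (meson order_trans self_le_power zero_less_numeral)
  moreover have "(max 1 T)\<^sup>2 \<le> p\<^sup>2" using s by (intro power_mono) auto
  ultimately have "(max 1 T)\<^sup>2 + max 1 L \<le> 2 * p\<^sup>2" by linarith
  then have "max 1 T * max 1 L * ((max 1 T)\<^sup>2 + max 1 L) * (max 1 N)\<^sup>2 \<le> p * p * (2 * p\<^sup>2) * (max 1 N)\<^sup>2"
    using s by (intro mult_le_mono) auto
  also have "\<dots> = 2 * (p ^ 4 * (max 1 N)\<^sup>2)"
    by (simp add: power2_eq_square power4_eq_xxxx)
  finally show ?thesis unfolding p_def .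
qed

theorem theorem4p3:
  "\<exists>(c :: com) (time :: trace \<Rightarrow> nat).
     decides_in_time c has_osr_race time \<and>
     (\<lambda>\<sigma>. real (time \<sigma>)) \<in>
       O[principal input_traces](\<lambda>\<sigma>. let N = max 1 (length \<sigma>); T = max 1 (num_threads \<sigma>); L = max 1 (num_locks \<sigma>)
          in real (T * L * (T\<^sup>2 + L) * N\<^sup>2)) \<and>
     (\<lambda>\<sigma>. real (time \<sigma>)) \<in> soft_O (\<lambda>\<sigma>. real ((max 1 (length \<sigma>))\<^sup>2))"
proof -
  define g :: "trace \<Rightarrow> nat" where
    "g \<sigma> = max 1 (num_threads \<sigma>) * max 1 (num_locks \<sigma>) *
       ((max 1 (num_threads \<sigma>))\<^sup>2 + max 1 (num_locks \<sigma>)) * (max 1 (length \<sigma>))\<^sup>2" for \<sigma>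
  \<comment> \<open>The constant is \<open>30000 * 64\<close>, from the program and from
    \<open>cost_bound_le\<close>.\<close>
  have "\<exists>t. (\<exists>s. run race_program (input_store \<sigma>) t s \<and> s 0 0 = of_bool (has_osr_race \<sigma>)) \<and>
      t \<le> 1920000 * g \<sigma>" if \<sigma>: "\<sigma> \<in> input_traces" for \<sigma>
  proof -
    obtain t s where r: "run race_program (input_store \<sigma>) t s" "s 0 0 = of_bool (has_osr_race \<sigma>)"
      and t: "t \<le> 30000 * cost_bound (Suc (length \<sigma>)) (Suc (num_threads \<sigma>)) (Suc (num_locks \<sigma>))"
      using wp_race_program[OF \<sigma>] by (auto simp: wp_def)
    have "t \<le> 30000 * (64 * g \<sigma>)"
      using t cost_bound_le[of "length \<sigma>" "num_threads \<sigma>" "num_locks \<sigma>"]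
      unfolding g_def by (meson mult_le_mono2 order_trans)
    then have "t \<le> 1920000 * g \<sigma>" by simp
    then show ?thesis using r by blast
  qed
  \<comment> \<open>The step count is turned into a function of the trace by choice. Its values
    outside \<open>input_traces\<close> are arbitrary, and the filter does not see them.\<close>
  then obtain time where run: "\<And>\<sigma>. \<sigma> \<in> input_traces \<Longrightarrow>
      \<exists>s. run race_program (input_store \<sigma>) (time \<sigma>) s \<and> s 0 0 = of_bool (has_osr_race \<sigma>)"
    and time: "\<And>\<sigma>. \<sigma> \<in> input_traces \<Longrightarrow> time \<sigma> \<le> 1920000 * g \<sigma>"
    by metis
  have "decides_in_time race_program has_osr_race time"
    using run by (simp add: decides_in_time_def)
  moreover have "(\<lambda>\<sigma>. real (time \<sigma>)) \<in>
       O[principal input_traces](\<lambda>\<sigma>. let N = max 1 (length \<sigma>); T = max 1 (num_threads \<sigma>); L = max 1 (num_locks \<sigma>)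
          in real (T * L * (T\<^sup>2 + L) * N\<^sup>2))"
  proof (rule bigoI)
    have "real (time \<sigma>) \<le> 1920000 * real (g \<sigma>)" if "\<sigma> \<in> input_traces" for \<sigma>
      using time[OF that] by (metis of_nat_le_iff of_nat_mult of_nat_numeral)
    then show "eventually (\<lambda>\<sigma>. norm (real (time \<sigma>)) \<le> 1920000 *
        norm (let N = max 1 (length \<sigma>); T = max 1 (num_threads \<sigma>); L = max 1 (num_locks \<sigma>)
          in real (T * L * (T\<^sup>2 + L) * N\<^sup>2))) (principal input_traces)"
      unfolding eventually_principal Let_def g_def by simp
  qed
  moreover have "(\<lambda>\<sigma>. real (time \<sigma>)) \<in> soft_O (\<lambda>\<sigma>. real ((max 1 (length \<sigma>))\<^sup>2))"
    unfolding soft_O_def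
  \<comment> \<open>The exponent is the degree in \<open>target_le_poly\<close>, whose factor 2
    doubles the constant.\<close>
  proof (intro CollectI exI[of _ 4] bigoI)
    have "real (time \<sigma>) \<le> 3840000 *
        (real ((1 + num_threads \<sigma> + num_locks \<sigma>) ^ 4) * real ((max 1 (length \<sigma>))\<^sup>2))"
      if "\<sigma> \<in> input_traces" for \<sigma>
    proof -
      have "g \<sigma> \<le> 2 * ((1 + num_threads \<sigma> + num_locks \<sigma>) ^ 4 * (max 1 (length \<sigma>))\<^sup>2)"
        unfolding g_def by (rule target_le_poly)
      then have "time \<sigma> \<le> 3840000 * ((1 + num_threads \<sigma> + num_locks \<sigma>) ^ 4 * (max 1 (length \<sigma>))\<^sup>2)"
        using time[OF that] by linarith
      then show ?thesis by (metis of_nat_le_iff of_nat_mult of_nat_numeral)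
    qed
    then show "eventually (\<lambda>\<sigma>. norm (real (time \<sigma>)) \<le> 3840000 *
        norm (real ((1 + num_threads \<sigma> + num_locks \<sigma>) ^ 4) * real ((max 1 (length \<sigma>))\<^sup>2)))
        (principal input_traces)"
      unfolding eventually_principal by simp
  qed
  ultimately show ?thesis by blast
qed

end
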